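(* Let $P\colon\mathcal C^{op}\to\mathbf{InfSL}$ be an elementary existential doctrine. Then $\mathcal A_P$ is a cartesian bicategory. Moreover, the assignment $P\mapsto\mathcal A_P$ extends to a functor $\mathcal L\colon\mathbf{EED}\to\mathbf{CBC}$ which sends a morphism $(F,b)\colon P\to R$ in $\mathbf{EED}$, with $R\colon\mathcal D^{op}\to\mathbf{InfSL}$, to the functor $\mathcal L(F,b)\colon\mathcal A_P\to\mathcal A_R$ given on objects by $X\mapsto F(X)$ and on morphisms by $r\in P(X\times Y)\mapsto b_{X\times Y}(r)\in R(F(X)\times F(Y))$.
   Context: $\mathcal C$ is a cartesian category (chosen products $\times$, projections $\pi_i$, pairing, terminal $I$, diagonals $\Delta_A$, unique maps $!_A$). $\mathbf{InfSL}$: meet-semilattices with top and finite-meet-preserving maps; $P_f=P(f)$. An elementary existential doctrine is $P\colon\mathcal C^{op}\to\mathbf{InfSL}$ with elements $\delta_A\in P(A\times A)$ such that for $e=\mathrm{id}_X\times\Delta_A$, $P_e$ has left adjoint $\exists_e(\alpha)=P_{\langle\pi_1,\pi_2\rangle}(\alpha)\wedge P_{\langle\pi_2,\pi_3\rangle}(\delta_A)$, and for each product projection $\pi$, $P_\pi$ has a left adjoint $\exists_\pi$ satisfying Beck–Chevalley (for any projection $\pi\colon X\times A\to A$ and pullback $\pi f'=f\pi'$, $\exists_{\pi'}P_{f'}=P_f\exists_\pi$) and Frobenius reciprocity ($\exists_\pi(P_\pi(\alpha)\wedge\beta)=\alpha\wedge\exists_\pi(\beta)$). $\mathbf{EED}$: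 objects elementary existential doctrines; morphisms $P\to R$ are pairs $(F,b)$ with $F\colon\mathcal C\to\mathcal D$ a strict cartesian functor and $b\colon P\to R\circ F^{op}$ natural, with $b_{A\times A}(\delta^P_A)=\delta^R_{FA}$ and $b_A\circ\exists^P_\pi=\exists^R_{F\pi}\circ b_{X\times A}$ for projections $\pi\colon X\times A\to A$; composition $(G,c)\circ(F,b)=(GF,cF\circ b)$. $\mathcal A_P$: objects of $\mathcal C$; $\mathrm{Hom}(X,Y)=P(X\times Y)$ ordered as in $P$; identity $\delta_X$; composite of $f\in P(X\times Y)$, $g\in P(Y\times Z)$ is $\exists_{\langle\pi_1,\pi_3\rangle}(P_{\langle\pi_1,\pi_2\rangle}(f)\wedge P_{\langle\pi_2,\pi_3\rangle}(g))$ (projections out of $X\times Y\times Z$); tensor $\times$ on objects and $f\otimes g=P_{\langle\pi_1,\pi_3\rangle}(f)\wedge P_{\langle\pi_2,\pi_4\rangle}(g)\in P(A\times C\times B\times D)$ for $f\in P(A\times B)$, $g\in P(C\times D)$; graph functor $\Gamma_P(f)=P_{f\times\mathrm{id}_Y}(\delta_Y)$ for $f\colon X\to Y$; associator, unitors, symmetry are $\Gamma_P$ of those of $\mathcal C$; comonoid on $X$ is $d_X=\Gamma_P(\Delta_X)$, $e_X=\Gamma_P(!_X)$. A cartesian bicategory is a poset-enriched symmetric monoidal category $(\mathcal B,\otimes,I)$ where each $X$ has $d_X\colon X\to X\otimes X$, $e_X\colon X\to I$ such that (composition written $;$): (1) $(d_X,e_X)$ is a cocommutative comonoid; (2) $d_X,e_X$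 have right adjoints $d^*_X,e^*_X$ ($\mathrm{id}\le d;d^*$, $d^*;d\le\mathrm{id}$, likewise for $e$); (3) $(d_X\otimes\mathrm{id});(\mathrm{id}\otimes d_X^* )=d_X^*;d_X$; (4) $R;d_Y\le d_X;(R\otimes R)$ and $R;e_Y\le e_X$ for all $R\colon X\to Y$; (5) $e_{X\otimes Y}=e_X\otimes e_Y$, $d_{X\otimes Y}=(d_X\otimes d_Y);(\mathrm{id}\otimes\sigma\otimes\mathrm{id})$ up to coherence isomorphisms. $\mathbf{CBC}$: cartesian bicategories with strict monoidal functors preserving order and the chosen $d,e,d^*,e^*$. *)

theory Defs
  imports "HOL-Algebra.Galois_Connection"
begin

section \<open>Categories and functors\<close>

text \<open>
  Hom-sets are indexed by source and target and need not be disjoint, so composition carries its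
  three objects: \<open>cmp C X Y Z f g\<close> is the composite, in diagrammatic order, of
  \<open>f : X \<rightarrow> Y\<close> followed by \<open>g : Y \<rightarrow> Z\<close>.
\<close>

record ('o, 'm) cat =
  Obj :: "'o set"
  hom :: "'o \<Rightarrow> 'o \<Rightarrow> 'm set"
  ide :: "'o \<Rightarrow> 'm"
  cmp :: "'o \<Rightarrow> 'o \<Rightarrow> 'o \<Rightarrow> 'm \<Rightarrow> 'm \<Rightarrow> 'm"

locale category =
  fixes C :: "('o, 'm, 'z) cat_scheme"
  assumes ide_in_hom: "X \<in> Obj C \<Longrightarrow> ide C X \<in> hom C X X"
    and cmp_in_hom:
      "\<lbrakk>X \<in> Obj C; Y \<in> Obj C; Z \<in> Obj C; f \<in> hom C X Y; g \<in> hom C Y Z\<rbrakk>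
        \<Longrightarrow> cmp C X Y Z f g \<in> hom C X Z"
    and cmp_ide_left:
      "\<lbrakk>X \<in> Obj C; Y \<in> Obj C; f \<in> hom C X Y\<rbrakk> \<Longrightarrow> cmp C X X Y (ide C X) f = f"
    and cmp_ide_right:
      "\<lbrakk>X \<in> Obj C; Y \<in> Obj C; f \<in> hom C X Y\<rbrakk> \<Longrightarrow> cmp C X Y Y f (ide C Y) = f"
    and cmp_assoc:
      "\<lbrakk>W \<in> Obj C; X \<in> Obj C; Y \<in> Obj C; Z \<in> Obj C;
        f \<in> hom C W X; g \<in> hom C X Y; h \<in> hom C Y Z\<rbrakk>
        \<Longrightarrow> cmp C W Y Z (cmp C W X Y f g) h = cmp C W X Z f (cmp C X Y Z g h)"

definition inverse_mors :: "('o, 'm, 'z) cat_scheme \<Rightarrow> 'o \<Rightarrow> 'o \<Rightarrow> 'm \<Rightarrow> 'm \<Rightarrow> bool" where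
  "inverse_mors C X Y f g \<longleftrightarrow>
     f \<in> hom C X Y \<and> g \<in> hom C Y X \<and>
     cmp C X Y X f g = ide C X \<and> cmp C Y X Y g f = ide C Y"

definition iso_mor :: "('o, 'm, 'z) cat_scheme \<Rightarrow> 'o \<Rightarrow> 'o \<Rightarrow> 'm \<Rightarrow> bool" where
  "iso_mor C X Y f \<longleftrightarrow> (\<exists>g. inverse_mors C X Y f g)"

definition inv_mor :: "('o, 'm, 'z) cat_scheme \<Rightarrow> 'o \<Rightarrow> 'o \<Rightarrow> 'm \<Rightarrow> 'm" where
  "inv_mor C X Y f = (THE g. inverse_mors C X Y f g)"

definition is_pullback ::
  "('o, 'm, 'z) cat_scheme \<Rightarrow> 'o \<Rightarrow> 'o \<Rightarrow> 'o \<Rightarrow> 'o \<Rightarrow> 'm \<Rightarrow> 'm \<Rightarrow> 'm \<Rightarrow> 'm \<Rightarrow> bool" where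
  \<comment> \<open>\<open>f' : W \<rightarrow> B\<close>, \<open>p' : W \<rightarrow> A'\<close> is a pullback of \<open>p : B \<rightarrow> A\<close> and \<open>f : A' \<rightarrow> A\<close>\<close>
  "is_pullback C W B A' A f' p' p f \<longleftrightarrow>
     W \<in> Obj C \<and> B \<in> Obj C \<and> A' \<in> Obj C \<and> A \<in> Obj C \<and>
     f' \<in> hom C W B \<and> p' \<in> hom C W A' \<and> p \<in> hom C B A \<and> f \<in> hom C A' A \<and>
     cmp C W B A f' p = cmp C W A' A p' f \<and>
     (\<forall>Z\<in>Obj C. \<forall>h\<in>hom C Z B. \<forall>k\<in>hom C Z A'.
        cmp C Z B A h p = cmp C Z A' A k f \<longrightarrow>
        (\<exists>!u. u \<in> hom C Z W \<and> cmp C Z W B u f' = h \<and> cmp C Z W A' u p' = k))"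

text \<open>
  Functors are required to be \<open>undefined\<close> off their domain, so that equality of functors is
  equality in the logic.
\<close>

record ('o1, 'm1, 'o2, 'm2) fctr =
  fobj :: "'o1 \<Rightarrow> 'o2"
  fmor :: "'o1 \<Rightarrow> 'o1 \<Rightarrow> 'm1 \<Rightarrow> 'm2"

locale cat_functor = dom: category C + cod: category D
  for C :: "('o1, 'm1, 'z1) cat_scheme"
  and D :: "('o2, 'm2, 'z2) cat_scheme"
  and F :: "('o1, 'm1, 'o2, 'm2) fctr" +
  assumes fobj_in: "X \<in> Obj C \<Longrightarrow> fobj F X \<in> Obj D"
    and fmor_in:
      "\<lbrakk>X \<in> Obj C; Y \<in> Obj C; f \<in> hom C X Y\<rbrakk> \<Longrightarrow> fmor F X Y f \<in> hom D (fobj F X) (fobj F Y)"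
    and fmor_ide: "X \<in> Obj C \<Longrightarrow> fmor F X X (ide C X) = ide D (fobj F X)"
    and fmor_cmp:
      "\<lbrakk>X \<in> Obj C; Y \<in> Obj C; Z \<in> Obj C; f \<in> hom C X Y; g \<in> hom C Y Z\<rbrakk>
        \<Longrightarrow> fmor F X Z (cmp C X Y Z f g)
          = cmp D (fobj F X) (fobj F Y) (fobj F Z) (fmor F X Y f) (fmor F Y Z g)"
    and fobj_undefined: "X \<notin> Obj C \<Longrightarrow> fobj F X = undefined"
    and fmor_undefined:
      "\<not> (X \<in> Obj C \<and> Y \<in> Obj C \<and> f \<in> hom C X Y) \<Longrightarrow> fmor F X Y f = undefined"

definition fctr_id :: "('o, 'm, 'z) cat_scheme \<Rightarrow> ('o, 'm, 'o, 'm) fctr" where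
  "fctr_id C =
     \<lparr>fobj = (\<lambda>X. if X \<in> Obj C then X else undefined),
      fmor = (\<lambda>X Y f. if X \<in> Obj C \<and> Y \<in> Obj C \<and> f \<in> hom C X Y then f else undefined)\<rparr>"

text \<open>\<open>fctr_comp C F G\<close> is the functor \<open>F\<close> out of \<open>C\<close> followed by \<open>G\<close>.\<close>

definition fctr_comp ::
  "('o1, 'm1, 'z) cat_scheme \<Rightarrow> ('o1, 'm1, 'o2, 'm2) fctr \<Rightarrow> ('o2, 'm2, 'o3, 'm3) fctr
    \<Rightarrow> ('o1, 'm1, 'o3, 'm3) fctr" where
  "fctr_comp C F G =
     \<lparr>fobj = (\<lambda>X. if X \<in> Obj C then fobj G (fobj F X) else undefined),
      fmor = (\<lambda>X Y f. if X \<in> Obj C \<and> Y \<in> Obj C \<and> f \<in> hom C X Y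
                then fmor G (fobj F X) (fobj F Y) (fmor F X Y f) else undefined)\<rparr>"


section \<open>Cartesian categories\<close>

record ('o, 'm) ccat = "('o, 'm) cat" +
  prd :: "'o \<Rightarrow> 'o \<Rightarrow> 'o"  (infixr "\<boxtimes>\<index>" 75)
  pr1 :: "'o \<Rightarrow> 'o \<Rightarrow> 'm"
  pr2 :: "'o \<Rightarrow> 'o \<Rightarrow> 'm"
  pair :: "'o \<Rightarrow> 'o \<Rightarrow> 'o \<Rightarrow> 'm \<Rightarrow> 'm \<Rightarrow> 'm"  \<comment> \<open>\<open>pair C Z X Y f g : Z \<rightarrow> X \<times> Y\<close>\<close>
  trm :: "'o"
  bang :: "'o \<Rightarrow> 'm"

locale cartesian_category = category C
  for C :: "('o, 'm, 'z) ccat_scheme" (structure) +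
  assumes prd_in: "\<lbrakk>X \<in> Obj C; Y \<in> Obj C\<rbrakk> \<Longrightarrow> X \<boxtimes> Y \<in> Obj C"
    and pr1_in: "\<lbrakk>X \<in> Obj C; Y \<in> Obj C\<rbrakk> \<Longrightarrow> pr1 C X Y \<in> hom C (X \<boxtimes> Y) X"
    and pr2_in: "\<lbrakk>X \<in> Obj C; Y \<in> Obj C\<rbrakk> \<Longrightarrow> pr2 C X Y \<in> hom C (X \<boxtimes> Y) Y"
    and pair_in:
      "\<lbrakk>Z \<in> Obj C; X \<in> Obj C; Y \<in> Obj C; f \<in> hom C Z X; g \<in> hom C Z Y\<rbrakk>
        \<Longrightarrow> pair C Z X Y f g \<in> hom C Z (X \<boxtimes> Y)"
    and pair_pr1:
      "\<lbrakk>Z \<in> Obj C; X \<in> Obj C; Y \<in> Obj C; f \<in> hom C Z X; g \<in> hom C Z Y\<rbrakk>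
        \<Longrightarrow> cmp C Z (X \<boxtimes> Y) X (pair C Z X Y f g) (pr1 C X Y) = f"
    and pair_pr2:
      "\<lbrakk>Z \<in> Obj C; X \<in> Obj C; Y \<in> Obj C; f \<in> hom C Z X; g \<in> hom C Z Y\<rbrakk>
        \<Longrightarrow> cmp C Z (X \<boxtimes> Y) Y (pair C Z X Y f g) (pr2 C X Y) = g"
    and pair_unique:
      "\<lbrakk>Z \<in> Obj C; X \<in> Obj C; Y \<in> Obj C; h \<in> hom C Z (X \<boxtimes> Y)\<rbrakk>
        \<Longrightarrow> pair C Z X Y (cmp C Z (X \<boxtimes> Y) X h (pr1 C X Y)) (cmp C Z (X \<boxtimes> Y) Y h (pr2 C X Y)) = h"
    and trm_in: "trm C \<in> Obj C"
    and bang_in: "X \<in> Obj C \<Longrightarrow> bang C X \<in> hom C X (trm C)"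
    and bang_unique: "\<lbrakk>X \<in> Obj C; f \<in> hom C X (trm C)\<rbrakk> \<Longrightarrow> f = bang C X"

definition diag :: "('o, 'm, 'z) ccat_scheme \<Rightarrow> 'o \<Rightarrow> 'm" where
  "diag C X = pair C X X X (ide C X) (ide C X)"

definition prdmor ::
  "('o, 'm, 'z) ccat_scheme \<Rightarrow> 'o \<Rightarrow> 'o \<Rightarrow> 'o \<Rightarrow> 'o \<Rightarrow> 'm \<Rightarrow> 'm \<Rightarrow> 'm" where
  \<comment> \<open>\<open>f \<times> g : A \<times> C' \<rightarrow> B \<times> D\<close> for \<open>f : A \<rightarrow> B\<close> and \<open>g : C' \<rightarrow> D\<close>\<close>
  "prdmor C A B C' D f g =
     pair C (A \<boxtimes>\<^bsub>C\<^esub> C') B D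
       (cmp C (A \<boxtimes>\<^bsub>C\<^esub> C') A B (pr1 C A C') f)
       (cmp C (A \<boxtimes>\<^bsub>C\<^esub> C') C' D (pr2 C A C') g)"

text \<open>
  Ternary products are bracketed to the right, \<open>X \<times> (Y \<times> Z)\<close>, so that
  \<open>id\<^sub>X \<times> \<Delta>\<^sub>A\<close> is literally a morphism \<open>X \<times> A \<rightarrow> X \<times> A \<times> A\<close>.
\<close>

definition tr1 :: "('o, 'm, 'z) ccat_scheme \<Rightarrow> 'o \<Rightarrow> 'o \<Rightarrow> 'o \<Rightarrow> 'm" where
  "tr1 C X Y Z = pr1 C X (Y \<boxtimes>\<^bsub>C\<^esub> Z)"

definition tr2 :: "('o, 'm, 'z) ccat_scheme \<Rightarrow> 'o \<Rightarrow> 'o \<Rightarrow> 'o \<Rightarrow> 'm" where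
  "tr2 C X Y Z =
     cmp C (X \<boxtimes>\<^bsub>C\<^esub> (Y \<boxtimes>\<^bsub>C\<^esub> Z)) (Y \<boxtimes>\<^bsub>C\<^esub> Z) Y (pr2 C X (Y \<boxtimes>\<^bsub>C\<^esub> Z)) (pr1 C Y Z)"

definition tr3 :: "('o, 'm, 'z) ccat_scheme \<Rightarrow> 'o \<Rightarrow> 'o \<Rightarrow> 'o \<Rightarrow> 'm" where
  "tr3 C X Y Z =
     cmp C (X \<boxtimes>\<^bsub>C\<^esub> (Y \<boxtimes>\<^bsub>C\<^esub> Z)) (Y \<boxtimes>\<^bsub>C\<^esub> Z) Z (pr2 C X (Y \<boxtimes>\<^bsub>C\<^esub> Z)) (pr2 C Y Z)"

definition tr12 :: "('o, 'm, 'z) ccat_scheme \<Rightarrow> 'o \<Rightarrow> 'o \<Rightarrow> 'o \<Rightarrow> 'm" where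
  "tr12 C X Y Z = pair C (X \<boxtimes>\<^bsub>C\<^esub> (Y \<boxtimes>\<^bsub>C\<^esub> Z)) X Y (tr1 C X Y Z) (tr2 C X Y Z)"

definition tr23 :: "('o, 'm, 'z) ccat_scheme \<Rightarrow> 'o \<Rightarrow> 'o \<Rightarrow> 'o \<Rightarrow> 'm" where
  "tr23 C X Y Z = pair C (X \<boxtimes>\<^bsub>C\<^esub> (Y \<boxtimes>\<^bsub>C\<^esub> Z)) Y Z (tr2 C X Y Z) (tr3 C X Y Z)"

definition tr13 :: "('o, 'm, 'z) ccat_scheme \<Rightarrow> 'o \<Rightarrow> 'o \<Rightarrow> 'o \<Rightarrow> 'm" where
  "tr13 C X Y Z = pair C (X \<boxtimes>\<^bsub>C\<^esub> (Y \<boxtimes>\<^bsub>C\<^esub> Z)) X Z (tr1 C X Y Z) (tr3 C X Y Z)"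

text \<open>
  Out of \<open>(X\<^sub>1 \<times> X\<^sub>2) \<times> (X\<^sub>3 \<times> X\<^sub>4)\<close>: the morphisms
  \<open>\<langle>\<pi>\<^sub>1, \<pi>\<^sub>3\<rangle>\<close> and \<open>\<langle>\<pi>\<^sub>2, \<pi>\<^sub>4\<rangle>\<close>.
\<close>

definition qu13 :: "('o, 'm, 'z) ccat_scheme \<Rightarrow> 'o \<Rightarrow> 'o \<Rightarrow> 'o \<Rightarrow> 'o \<Rightarrow> 'm" where
  "qu13 C X1 X2 X3 X4 =
     prdmor C (X1 \<boxtimes>\<^bsub>C\<^esub> X2) X1 (X3 \<boxtimes>\<^bsub>C\<^esub> X4) X3 (pr1 C X1 X2) (pr1 C X3 X4)"

definition qu24 :: "('o, 'm, 'z) ccat_scheme \<Rightarrow> 'o \<Rightarrow> 'o \<Rightarrow> 'o \<Rightarrow> 'o \<Rightarrow> 'm" where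
  "qu24 C X1 X2 X3 X4 =
     prdmor C (X1 \<boxtimes>\<^bsub>C\<^esub> X2) X2 (X3 \<boxtimes>\<^bsub>C\<^esub> X4) X4 (pr2 C X1 X2) (pr2 C X3 X4)"

definition cassoc :: "('o, 'm, 'z) ccat_scheme \<Rightarrow> 'o \<Rightarrow> 'o \<Rightarrow> 'o \<Rightarrow> 'm" where
  \<comment> \<open>\<open>(X \<times> Y) \<times> Z \<rightarrow> X \<times> (Y \<times> Z)\<close>\<close>
  "cassoc C X Y Z =
     pair C ((X \<boxtimes>\<^bsub>C\<^esub> Y) \<boxtimes>\<^bsub>C\<^esub> Z) X (Y \<boxtimes>\<^bsub>C\<^esub> Z)
       (cmp C ((X \<boxtimes>\<^bsub>C\<^esub> Y) \<boxtimes>\<^bsub>C\<^esub> Z) (X \<boxtimes>\<^bsub>C\<^esub> Y) X (pr1 C (X \<boxtimes>\<^bsub>C\<^esub> Y) Z) (pr1 C X Y))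
       (prdmor C (X \<boxtimes>\<^bsub>C\<^esub> Y) Y Z Z (pr2 C X Y) (ide C Z))"

definition cbraid :: "('o, 'm, 'z) ccat_scheme \<Rightarrow> 'o \<Rightarrow> 'o \<Rightarrow> 'm" where
  "cbraid C X Y = pair C (X \<boxtimes>\<^bsub>C\<^esub> Y) Y X (pr2 C X Y) (pr1 C X Y)"

text \<open>Product projections, both first and second, for the chosen products.\<close>

definition projection :: "('o, 'm, 'z) ccat_scheme \<Rightarrow> 'o \<Rightarrow> 'o \<Rightarrow> 'm \<Rightarrow> bool" where
  "projection C B A p \<longleftrightarrow>
     A \<in> Obj C \<and>
     (\<exists>X\<in>Obj C. B = X \<boxtimes>\<^bsub>C\<^esub> A \<and> p = pr2 C X A \<or> B = A \<boxtimes>\<^bsub>C\<^esub> X \<and> p = pr1 C A X)"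

text \<open>Preservation of pairings and of the maps to the terminal object follows.\<close>

locale strict_cartesian_functor =
  cat_functor C D F + dom: cartesian_category C + cod: cartesian_category D
  for C :: "('o1, 'm1, 'z1) ccat_scheme"
  and D :: "('o2, 'm2, 'z2) ccat_scheme"
  and F :: "('o1, 'm1, 'o2, 'm2) fctr" +
  assumes fobj_prd:
      "\<lbrakk>X \<in> Obj C; Y \<in> Obj C\<rbrakk> \<Longrightarrow> fobj F (X \<boxtimes>\<^bsub>C\<^esub> Y) = fobj F X \<boxtimes>\<^bsub>D\<^esub> fobj F Y"
    and fmor_pr1:
      "\<lbrakk>X \<in> Obj C; Y \<in> Obj C\<rbrakk>
        \<Longrightarrow> fmor F (X \<boxtimes>\<^bsub>C\<^esub> Y) X (pr1 C X Y) = pr1 D (fobj F X) (fobj F Y)"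
    and fmor_pr2:
      "\<lbrakk>X \<in> Obj C; Y \<in> Obj C\<rbrakk>
        \<Longrightarrow> fmor F (X \<boxtimes>\<^bsub>C\<^esub> Y) Y (pr2 C X Y) = pr2 D (fobj F X) (fobj F Y)"
    and fobj_trm: "fobj F (trm C) = trm D"


section \<open>Elementary existential doctrines\<close>

text \<open>For \<open>f : X \<rightarrow> Y\<close>, \<open>re P X Y f\<close> is the reindexing map
  \<open>P\<^sub>f : P Y \<rightarrow> P X\<close>.\<close>

record ('o, 'm, 'p) doctrine =
  base :: "('o, 'm) ccat"
  fib :: "'o \<Rightarrow> 'p gorder"
  re :: "'o \<Rightarrow> 'o \<Rightarrow> 'm \<Rightarrow> 'p \<Rightarrow> 'p"
  dlt :: "'o \<Rightarrow> 'p"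

definition inf_sl :: "'p gorder \<Rightarrow> bool" where
  "inf_sl L \<longleftrightarrow> lower_semilattice L \<and> weak_partial_order_top L"

definition inf_sl_hom :: "'p gorder \<Rightarrow> 'q gorder \<Rightarrow> ('p \<Rightarrow> 'q) \<Rightarrow> bool" where
  "inf_sl_hom L M h \<longleftrightarrow>
     h \<in> carrier L \<rightarrow> carrier M \<and>
     h \<top>\<^bsub>L\<^esub> = \<top>\<^bsub>M\<^esub> \<and>
     (\<forall>x\<in>carrier L. \<forall>y\<in>carrier L. h (x \<sqinter>\<^bsub>L\<^esub> y) = h x \<sqinter>\<^bsub>M\<^esub> h y)"

definition left_adjoint ::
  "('o, 'm, 'p) doctrine \<Rightarrow> 'o \<Rightarrow> 'o \<Rightarrow> 'm \<Rightarrow> ('p \<Rightarrow> 'p) \<Rightarrow> bool" where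
  \<comment> \<open>\<open>L\<close> is left adjoint to \<open>P\<^sub>f\<close>, where \<open>f : X \<rightarrow> Y\<close>\<close>
  "left_adjoint P X Y f L \<longleftrightarrow>
     galois_connection \<lparr>orderA = fib P X, orderB = fib P Y, lower = L, upper = re P X Y f\<rparr>"

text \<open>The left adjoint, if it exists, is unique on the elements of the fibre.\<close>

definition exq :: "('o, 'm, 'p) doctrine \<Rightarrow> 'o \<Rightarrow> 'o \<Rightarrow> 'm \<Rightarrow> 'p \<Rightarrow> 'p" where
  "exq P X Y f = (SOME L. left_adjoint P X Y f L)"

locale elementary_existential_doctrine = cartesian_category "base P"
  for P :: "('o, 'm, 'p) doctrine" +
  assumes fib_inf_sl: "X \<in> Obj (base P) \<Longrightarrow> inf_sl (fib P X)"
    and re_hom: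
      "\<lbrakk>X \<in> Obj (base P); Y \<in> Obj (base P); f \<in> hom (base P) X Y\<rbrakk>
        \<Longrightarrow> inf_sl_hom (fib P Y) (fib P X) (re P X Y f)"
    and re_ide:
      "\<lbrakk>X \<in> Obj (base P); \<alpha> \<in> carrier (fib P X)\<rbrakk> \<Longrightarrow> re P X X (ide (base P) X) \<alpha> = \<alpha>"
    and re_cmp:
      "\<lbrakk>X \<in> Obj (base P); Y \<in> Obj (base P); Z \<in> Obj (base P);
        f \<in> hom (base P) X Y; g \<in> hom (base P) Y Z; \<alpha> \<in> carrier (fib P Z)\<rbrakk>
        \<Longrightarrow> re P X Z (cmp (base P) X Y Z f g) \<alpha> = re P X Y f (re P Y Z g \<alpha>)"
    and dlt_in:
      "A \<in> Obj (base P) \<Longrightarrow> dlt P A \<in> carrier (fib P (A \<boxtimes>\<^bsub>base P\<^esub> A))"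
    and elementary:
      "\<lbrakk>X \<in> Obj (base P); A \<in> Obj (base P)\<rbrakk>
        \<Longrightarrow> left_adjoint P (X \<boxtimes>\<^bsub>base P\<^esub> A) (X \<boxtimes>\<^bsub>base P\<^esub> (A \<boxtimes>\<^bsub>base P\<^esub> A))
              (prdmor (base P) X X A (A \<boxtimes>\<^bsub>base P\<^esub> A) (ide (base P) X) (diag (base P) A))
              (\<lambda>\<alpha>. re P (X \<boxtimes>\<^bsub>base P\<^esub> (A \<boxtimes>\<^bsub>base P\<^esub> A)) (X \<boxtimes>\<^bsub>base P\<^esub> A) (tr12 (base P) X A A) \<alpha>
                   \<sqinter>\<^bsub>fib P (X \<boxtimes>\<^bsub>base P\<^esub> (A \<boxtimes>\<^bsub>base P\<^esub> A))\<^esub>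
                   re P (X \<boxtimes>\<^bsub>base P\<^esub> (A \<boxtimes>\<^bsub>base P\<^esub> A)) (A \<boxtimes>\<^bsub>base P\<^esub> A) (tr23 (base P) X A A) (dlt P A))"
    and existential: "projection (base P) B A p \<Longrightarrow> \<exists>L. left_adjoint P B A p L"
    and beck_chevalley:
      "\<lbrakk>projection (base P) B A p; is_pullback (base P) W B A' A f' p' p f;
        \<alpha> \<in> carrier (fib P B)\<rbrakk>
        \<Longrightarrow> exq P W A' p' (re P W B f' \<alpha>) = re P A' A f (exq P B A p \<alpha>)"
    and frobenius:
      "\<lbrakk>projection (base P) B A p; \<alpha> \<in> carrier (fib P A); \<beta> \<in> carrier (fib P B)\<rbrakk>
        \<Longrightarrow> exq P B A p (re P B A p \<alpha> \<sqinter>\<^bsub>fib P B\<^esub> \<beta>) = \<alpha> \<sqinter>\<^bsub>fib P A\<^esub> exq P B A p \<beta>"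

type_synonym ('o1, 'm1, 'p1, 'o2, 'm2, 'p2) eed_mor =
  "('o1, 'm1, 'o2, 'm2) fctr \<times> ('o1 \<Rightarrow> 'p1 \<Rightarrow> 'p2)"

text \<open>As for functors, the components of \<open>b\<close> are \<open>undefined\<close> off their domain.\<close>

locale eed_morphism =
  dom: elementary_existential_doctrine P + cod: elementary_existential_doctrine R +
  strict_cartesian_functor "base P" "base R" F
  for P :: "('o1, 'm1, 'p1) doctrine"
  and R :: "('o2, 'm2, 'p2) doctrine"
  and F :: "('o1, 'm1, 'o2, 'm2) fctr"
  and b :: "'o1 \<Rightarrow> 'p1 \<Rightarrow> 'p2" +
  assumes b_hom: "A \<in> Obj (base P) \<Longrightarrow> inf_sl_hom (fib P A) (fib R (fobj F A)) (b A)"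
    and b_natural:
      "\<lbrakk>X \<in> Obj (base P); Y \<in> Obj (base P); f \<in> hom (base P) X Y; \<alpha> \<in> carrier (fib P Y)\<rbrakk>
        \<Longrightarrow> b X (re P X Y f \<alpha>) = re R (fobj F X) (fobj F Y) (fmor F X Y f) (b Y \<alpha>)"
    and b_dlt: "A \<in> Obj (base P) \<Longrightarrow> b (A \<boxtimes>\<^bsub>base P\<^esub> A) (dlt P A) = dlt R (fobj F A)"
    and b_exq:
      "\<lbrakk>projection (base P) B A p; \<alpha> \<in> carrier (fib P B)\<rbrakk>
        \<Longrightarrow> b A (exq P B A p \<alpha>) = exq R (fobj F B) (fobj F A) (fmor F B A p) (b B \<alpha>)"
    and b_undefined:
      "\<not> (A \<in> Obj (base P) \<and> \<alpha> \<in> carrier (fib P A)) \<Longrightarrow> b A \<alpha> = undefined"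

definition eed_id :: "('o, 'm, 'p) doctrine \<Rightarrow> ('o, 'm, 'p, 'o, 'm, 'p) eed_mor" where
  "eed_id P =
     (fctr_id (base P),
      \<lambda>A \<alpha>. if A \<in> Obj (base P) \<and> \<alpha> \<in> carrier (fib P A) then \<alpha> else undefined)"

text \<open>\<open>eed_comp P (F, b) (G, c)\<close> is \<open>(F, b)\<close> followed by \<open>(G, c)\<close>, that is,
  \<open>(G, c) \<circ> (F, b) = (G F, c F \<circ> b)\<close>.\<close>

fun eed_comp ::
  "('o1, 'm1, 'p1) doctrine \<Rightarrow> ('o1, 'm1, 'p1, 'o2, 'm2, 'p2) eed_mor
    \<Rightarrow> ('o2, 'm2, 'p2, 'o3, 'm3, 'p3) eed_mor \<Rightarrow> ('o1, 'm1, 'p1, 'o3, 'm3, 'p3) eed_mor" where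
  "eed_comp P (F, b) (G, c) =
     (fctr_comp (base P) F G,
      \<lambda>A \<alpha>. if A \<in> Obj (base P) \<and> \<alpha> \<in> carrier (fib P A) then c (fobj F A) (b A \<alpha>) else undefined)"

text \<open>The category of all elementary existential doctrines with objects, morphisms and fibre
  elements drawn from three given (arbitrary) types.\<close>

definition EED :: "(('o, 'm, 'p) doctrine, ('o, 'm, 'p, 'o, 'm, 'p) eed_mor) cat" where
  "EED =
     \<lparr>Obj = {P. elementary_existential_doctrine P},
      hom = (\<lambda>P R. {(F, b). eed_morphism P R F b}),
      ide = eed_id,
      cmp = (\<lambda>P R S. eed_comp P)\<rparr>"


section \<open>Cartesian bicategories\<close>

record ('o, 'm) bicat = "('o, 'm) cat" +
  hle :: "'o \<Rightarrow> 'o \<Rightarrow> 'm \<Rightarrow> 'm \<Rightarrow> bool"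
  tobj :: "'o \<Rightarrow> 'o \<Rightarrow> 'o"  (infixr "\<otimes>\<index>" 75)
  unt :: "'o"  ("\<one>\<index>")
  tmor :: "'o \<Rightarrow> 'o \<Rightarrow> 'o \<Rightarrow> 'o \<Rightarrow> 'm \<Rightarrow> 'm \<Rightarrow> 'm"
    \<comment> \<open>\<open>tmor \<B> X Y X' Y' f g : X \<otimes> X' \<rightarrow> Y \<otimes> Y'\<close> for \<open>f : X \<rightarrow> Y\<close> and \<open>g : X' \<rightarrow> Y'\<close>\<close>
  assoc :: "'o \<Rightarrow> 'o \<Rightarrow> 'o \<Rightarrow> 'm"  \<comment> \<open>\<open>(X \<otimes> Y) \<otimes> Z \<rightarrow> X \<otimes> (Y \<otimes> Z)\<close>\<close>
  lun :: "'o \<Rightarrow> 'm"  \<comment> \<open>\<open>I \<otimes> X \<rightarrow> X\<close>\<close>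
  run :: "'o \<Rightarrow> 'm"  \<comment> \<open>\<open>X \<otimes> I \<rightarrow> X\<close>\<close>
  braid :: "'o \<Rightarrow> 'o \<Rightarrow> 'm"  \<comment> \<open>\<open>X \<otimes> Y \<rightarrow> Y \<otimes> X\<close>\<close>
  dup :: "'o \<Rightarrow> 'm"
  del :: "'o \<Rightarrow> 'm"

definition hom_poset :: "('o, 'm, 'z) bicat_scheme \<Rightarrow> 'o \<Rightarrow> 'o \<Rightarrow> 'm gorder" where
  "hom_poset \<B> X Y = \<lparr>carrier = hom \<B> X Y, eq = (=), le = hle \<B> X Y\<rparr>"

locale poset_symmetric_monoidal_category = category \<B>
  for \<B> :: "('o, 'm, 'z) bicat_scheme" (structure) +
  assumes hom_partial_order: "\<lbrakk>X \<in> Obj \<B>; Y \<in> Obj \<B>\<rbrakk> \<Longrightarrow> partial_order (hom_poset \<B> X Y)"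
    and cmp_mono:
      "\<lbrakk>X \<in> Obj \<B>; Y \<in> Obj \<B>; Z \<in> Obj \<B>; f \<in> hom \<B> X Y; f' \<in> hom \<B> X Y;
        g \<in> hom \<B> Y Z; g' \<in> hom \<B> Y Z; hle \<B> X Y f f'; hle \<B> Y Z g g'\<rbrakk>
        \<Longrightarrow> hle \<B> X Z (cmp \<B> X Y Z f g) (cmp \<B> X Y Z f' g')"
    and tobj_in: "\<lbrakk>X \<in> Obj \<B>; Y \<in> Obj \<B>\<rbrakk> \<Longrightarrow> X \<otimes> Y \<in> Obj \<B>"
    and unt_in: "\<one> \<in> Obj \<B>"
    and tmor_in:
      "\<lbrakk>X \<in> Obj \<B>; Y \<in> Obj \<B>; X' \<in> Obj \<B>; Y' \<in> Obj \<B>; f \<in> hom \<B> X Y; g \<in> hom \<B> X' Y'\<rbrakk>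
        \<Longrightarrow> tmor \<B> X Y X' Y' f g \<in> hom \<B> (X \<otimes> X') (Y \<otimes> Y')"
    and tmor_mono:
      "\<lbrakk>X \<in> Obj \<B>; Y \<in> Obj \<B>; X' \<in> Obj \<B>; Y' \<in> Obj \<B>; f \<in> hom \<B> X Y; f' \<in> hom \<B> X Y;
        g \<in> hom \<B> X' Y'; g' \<in> hom \<B> X' Y'; hle \<B> X Y f f'; hle \<B> X' Y' g g'\<rbrakk>
        \<Longrightarrow> hle \<B> (X \<otimes> X') (Y \<otimes> Y') (tmor \<B> X Y X' Y' f g) (tmor \<B> X Y X' Y' f' g')"
    and tmor_ide:
      "\<lbrakk>X \<in> Obj \<B>; Y \<in> Obj \<B>\<rbrakk> \<Longrightarrow> tmor \<B> X X Y Y (ide \<B> X) (ide \<B> Y) = ide \<B> (X \<otimes> Y)"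
    and tmor_cmp:
      "\<lbrakk>X \<in> Obj \<B>; Y \<in> Obj \<B>; Z \<in> Obj \<B>; X' \<in> Obj \<B>; Y' \<in> Obj \<B>; Z' \<in> Obj \<B>;
        f \<in> hom \<B> X Y; g \<in> hom \<B> Y Z; f' \<in> hom \<B> X' Y'; g' \<in> hom \<B> Y' Z'\<rbrakk>
        \<Longrightarrow> tmor \<B> X Z X' Z' (cmp \<B> X Y Z f g) (cmp \<B> X' Y' Z' f' g')
          = cmp \<B> (X \<otimes> X') (Y \<otimes> Y') (Z \<otimes> Z') (tmor \<B> X Y X' Y' f f') (tmor \<B> Y Z Y' Z' g g')"
    and assoc_iso:
      "\<lbrakk>X \<in> Obj \<B>; Y \<in> Obj \<B>; Z \<in> Obj \<B>\<rbrakk>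
        \<Longrightarrow> iso_mor \<B> ((X \<otimes> Y) \<otimes> Z) (X \<otimes> (Y \<otimes> Z)) (assoc \<B> X Y Z)"
    and lun_iso: "X \<in> Obj \<B> \<Longrightarrow> iso_mor \<B> (\<one> \<otimes> X) X (lun \<B> X)"
    and run_iso: "X \<in> Obj \<B> \<Longrightarrow> iso_mor \<B> (X \<otimes> \<one>) X (run \<B> X)"
    and braid_in: "\<lbrakk>X \<in> Obj \<B>; Y \<in> Obj \<B>\<rbrakk> \<Longrightarrow> braid \<B> X Y \<in> hom \<B> (X \<otimes> Y) (Y \<otimes> X)"
    and braid_braid:
      "\<lbrakk>X \<in> Obj \<B>; Y \<in> Obj \<B>\<rbrakk>
        \<Longrightarrow> cmp \<B> (X \<otimes> Y) (Y \<otimes> X) (X \<otimes> Y) (braid \<B> X Y) (braid \<B> Y X) = ide \<B> (X \<otimes> Y)"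
    and assoc_natural:
      "\<lbrakk>X \<in> Obj \<B>; Y \<in> Obj \<B>; Z \<in> Obj \<B>; X' \<in> Obj \<B>; Y' \<in> Obj \<B>; Z' \<in> Obj \<B>;
        f \<in> hom \<B> X X'; g \<in> hom \<B> Y Y'; h \<in> hom \<B> Z Z'\<rbrakk>
        \<Longrightarrow> cmp \<B> ((X \<otimes> Y) \<otimes> Z) ((X' \<otimes> Y') \<otimes> Z') (X' \<otimes> (Y' \<otimes> Z'))
              (tmor \<B> (X \<otimes> Y) (X' \<otimes> Y') Z Z' (tmor \<B> X X' Y Y' f g) h) (assoc \<B> X' Y' Z')
          = cmp \<B> ((X \<otimes> Y) \<otimes> Z) (X \<otimes> (Y \<otimes> Z)) (X' \<otimes> (Y' \<otimes> Z'))
              (assoc \<B> X Y Z) (tmor \<B> X X' (Y \<otimes> Z) (Y' \<otimes> Z') f (tmor \<B> Y Y' Z Z' g h))"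
    and lun_natural:
      "\<lbrakk>X \<in> Obj \<B>; Y \<in> Obj \<B>; f \<in> hom \<B> X Y\<rbrakk>
        \<Longrightarrow> cmp \<B> (\<one> \<otimes> X) (\<one> \<otimes> Y) Y (tmor \<B> \<one> \<one> X Y (ide \<B> \<one>) f) (lun \<B> Y)
          = cmp \<B> (\<one> \<otimes> X) X Y (lun \<B> X) f"
    and run_natural:
      "\<lbrakk>X \<in> Obj \<B>; Y \<in> Obj \<B>; f \<in> hom \<B> X Y\<rbrakk>
        \<Longrightarrow> cmp \<B> (X \<otimes> \<one>) (Y \<otimes> \<one>) Y (tmor \<B> X Y \<one> \<one> f (ide \<B> \<one>)) (run \<B> Y)
          = cmp \<B> (X \<otimes> \<one>) X Y (run \<B> X) f"
    and braid_natural: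
      "\<lbrakk>X \<in> Obj \<B>; Y \<in> Obj \<B>; X' \<in> Obj \<B>; Y' \<in> Obj \<B>; f \<in> hom \<B> X X'; g \<in> hom \<B> Y Y'\<rbrakk>
        \<Longrightarrow> cmp \<B> (X \<otimes> Y) (X' \<otimes> Y') (Y' \<otimes> X') (tmor \<B> X X' Y Y' f g) (braid \<B> X' Y')
          = cmp \<B> (X \<otimes> Y) (Y \<otimes> X) (Y' \<otimes> X') (braid \<B> X Y) (tmor \<B> Y Y' X X' g f)"
    and pentagon:
      "\<lbrakk>W \<in> Obj \<B>; X \<in> Obj \<B>; Y \<in> Obj \<B>; Z \<in> Obj \<B>\<rbrakk>
        \<Longrightarrow> cmp \<B> (((W \<otimes> X) \<otimes> Y) \<otimes> Z) ((W \<otimes> X) \<otimes> (Y \<otimes> Z)) (W \<otimes> (X \<otimes> (Y \<otimes> Z)))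
              (assoc \<B> (W \<otimes> X) Y Z) (assoc \<B> W X (Y \<otimes> Z))
          = cmp \<B> (((W \<otimes> X) \<otimes> Y) \<otimes> Z) ((W \<otimes> (X \<otimes> Y)) \<otimes> Z) (W \<otimes> (X \<otimes> (Y \<otimes> Z)))
              (tmor \<B> ((W \<otimes> X) \<otimes> Y) (W \<otimes> (X \<otimes> Y)) Z Z (assoc \<B> W X Y) (ide \<B> Z))
              (cmp \<B> ((W \<otimes> (X \<otimes> Y)) \<otimes> Z) (W \<otimes> ((X \<otimes> Y) \<otimes> Z)) (W \<otimes> (X \<otimes> (Y \<otimes> Z)))
                (assoc \<B> W (X \<otimes> Y) Z)
                (tmor \<B> W W ((X \<otimes> Y) \<otimes> Z) (X \<otimes> (Y \<otimes> Z)) (ide \<B> W) (assoc \<B> X Y Z)))"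
    and triangle:
      "\<lbrakk>X \<in> Obj \<B>; Y \<in> Obj \<B>\<rbrakk>
        \<Longrightarrow> cmp \<B> ((X \<otimes> \<one>) \<otimes> Y) (X \<otimes> (\<one> \<otimes> Y)) (X \<otimes> Y)
              (assoc \<B> X \<one> Y) (tmor \<B> X X (\<one> \<otimes> Y) Y (ide \<B> X) (lun \<B> Y))
          = tmor \<B> (X \<otimes> \<one>) X Y Y (run \<B> X) (ide \<B> Y)"
    and hexagon:
      "\<lbrakk>X \<in> Obj \<B>; Y \<in> Obj \<B>; Z \<in> Obj \<B>\<rbrakk>
        \<Longrightarrow> cmp \<B> ((X \<otimes> Y) \<otimes> Z) (X \<otimes> (Y \<otimes> Z)) (Y \<otimes> (Z \<otimes> X))
              (assoc \<B> X Y Z)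
              (cmp \<B> (X \<otimes> (Y \<otimes> Z)) ((Y \<otimes> Z) \<otimes> X) (Y \<otimes> (Z \<otimes> X))
                (braid \<B> X (Y \<otimes> Z)) (assoc \<B> Y Z X))
          = cmp \<B> ((X \<otimes> Y) \<otimes> Z) ((Y \<otimes> X) \<otimes> Z) (Y \<otimes> (Z \<otimes> X))
              (tmor \<B> (X \<otimes> Y) (Y \<otimes> X) Z Z (braid \<B> X Y) (ide \<B> Z))
              (cmp \<B> ((Y \<otimes> X) \<otimes> Z) (Y \<otimes> (X \<otimes> Z)) (Y \<otimes> (Z \<otimes> X))
                (assoc \<B> Y X Z)
                (tmor \<B> Y Y (X \<otimes> Z) (Z \<otimes> X) (ide \<B> Y) (braid \<B> X Z)))"

definition is_radj :: "('o, 'm, 'z) bicat_scheme \<Rightarrow> 'o \<Rightarrow> 'o \<Rightarrow> 'm \<Rightarrow> 'm \<Rightarrow> bool" where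
  \<comment> \<open>\<open>g\<close> is right adjoint to \<open>f : X \<rightarrow> Y\<close>\<close>
  "is_radj \<B> X Y f g \<longleftrightarrow>
     g \<in> hom \<B> Y X \<and>
     hle \<B> X X (ide \<B> X) (cmp \<B> X Y X f g) \<and>
     hle \<B> Y Y (cmp \<B> Y X Y g f) (ide \<B> Y)"

text \<open>Right adjoints are unique in a poset-enriched category, so \<open>d\<^sup>*\<close> and \<open>e\<^sup>*\<close> are determined
  by \<open>d\<close> and \<open>e\<close>.\<close>

definition radj :: "('o, 'm, 'z) bicat_scheme \<Rightarrow> 'o \<Rightarrow> 'o \<Rightarrow> 'm \<Rightarrow> 'm" where
  "radj \<B> X Y f = (THE g. is_radj \<B> X Y f g)"

abbreviation dup_star :: "('o, 'm, 'z) bicat_scheme \<Rightarrow> 'o \<Rightarrow> 'm" where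
  "dup_star \<B> X \<equiv> radj \<B> X (X \<otimes>\<^bsub>\<B>\<^esub> X) (dup \<B> X)"

abbreviation del_star :: "('o, 'm, 'z) bicat_scheme \<Rightarrow> 'o \<Rightarrow> 'm" where
  "del_star \<B> X \<equiv> radj \<B> X \<one>\<^bsub>\<B>\<^esub> (del \<B> X)"

definition middle4 :: "('o, 'm, 'z) bicat_scheme \<Rightarrow> 'o \<Rightarrow> 'o \<Rightarrow> 'm" where
  \<comment> \<open>\<open>id \<otimes> \<sigma> \<otimes> id : (X \<otimes> X) \<otimes> (Y \<otimes> Y) \<rightarrow> (X \<otimes> Y) \<otimes> (X \<otimes> Y)\<close> with its rebracketings\<close>
  "middle4 \<B> X Y =
     (let c = cmp \<B>; t = (\<lambda>U V. U \<otimes>\<^bsub>\<B>\<^esub> V);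
          S0 = t (t X X) (t Y Y);
          S1 = t X (t X (t Y Y));
          S2 = t X (t (t X Y) Y);
          S3 = t X (t (t Y X) Y);
          S4 = t X (t Y (t X Y));
          S5 = t (t X Y) (t X Y)
      in c S0 S1 S5 (assoc \<B> X X (t Y Y))
          (c S1 S2 S5
            (tmor \<B> X X (t X (t Y Y)) (t (t X Y) Y) (ide \<B> X)
              (inv_mor \<B> (t (t X Y) Y) (t X (t Y Y)) (assoc \<B> X Y Y)))
          (c S2 S3 S5
            (tmor \<B> X X (t (t X Y) Y) (t (t Y X) Y) (ide \<B> X)
              (tmor \<B> (t X Y) (t Y X) Y Y (braid \<B> X Y) (ide \<B> Y)))
          (c S3 S4 S5
            (tmor \<B> X X (t (t Y X) Y) (t Y (t X Y)) (ide \<B> X) (assoc \<B> Y X Y))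
            (inv_mor \<B> S5 S4 (assoc \<B> X Y (t X Y)))))))"

locale cartesian_bicategory = poset_symmetric_monoidal_category \<B>
  for \<B> :: "('o, 'm, 'z) bicat_scheme" (structure) +
  assumes dup_in: "X \<in> Obj \<B> \<Longrightarrow> dup \<B> X \<in> hom \<B> X (X \<otimes> X)"
    and del_in: "X \<in> Obj \<B> \<Longrightarrow> del \<B> X \<in> hom \<B> X \<one>"
    and dup_coassoc:
      "X \<in> Obj \<B> \<Longrightarrow>
        cmp \<B> X (X \<otimes> X) (X \<otimes> (X \<otimes> X)) (dup \<B> X)
          (cmp \<B> (X \<otimes> X) ((X \<otimes> X) \<otimes> X) (X \<otimes> (X \<otimes> X))
            (tmor \<B> X (X \<otimes> X) X X (dup \<B> X) (ide \<B> X)) (assoc \<B> X X X))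
        = cmp \<B> X (X \<otimes> X) (X \<otimes> (X \<otimes> X)) (dup \<B> X)
          (tmor \<B> X X X (X \<otimes> X) (ide \<B> X) (dup \<B> X))"
    and dup_counit_left:
      "X \<in> Obj \<B> \<Longrightarrow>
        cmp \<B> X (X \<otimes> X) X (dup \<B> X)
          (cmp \<B> (X \<otimes> X) (\<one> \<otimes> X) X (tmor \<B> X \<one> X X (del \<B> X) (ide \<B> X)) (lun \<B> X))
        = ide \<B> X"
    and dup_counit_right:
      "X \<in> Obj \<B> \<Longrightarrow>
        cmp \<B> X (X \<otimes> X) X (dup \<B> X)
          (cmp \<B> (X \<otimes> X) (X \<otimes> \<one>) X (tmor \<B> X X X \<one> (ide \<B> X) (del \<B> X)) (run \<B> X))
        = ide \<B> X"
    and dup_cocomm: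
      "X \<in> Obj \<B> \<Longrightarrow> cmp \<B> X (X \<otimes> X) (X \<otimes> X) (dup \<B> X) (braid \<B> X X) = dup \<B> X"
    and dup_has_radj: "X \<in> Obj \<B> \<Longrightarrow> \<exists>g. is_radj \<B> X (X \<otimes> X) (dup \<B> X) g"
    and del_has_radj: "X \<in> Obj \<B> \<Longrightarrow> \<exists>g. is_radj \<B> X \<one> (del \<B> X) g"
    and frobenius_law:
      "X \<in> Obj \<B> \<Longrightarrow>
        cmp \<B> (X \<otimes> X) ((X \<otimes> X) \<otimes> X) (X \<otimes> X)
          (tmor \<B> X (X \<otimes> X) X X (dup \<B> X) (ide \<B> X))
          (cmp \<B> ((X \<otimes> X) \<otimes> X) (X \<otimes> (X \<otimes> X)) (X \<otimes> X)
            (assoc \<B> X X X) (tmor \<B> X X (X \<otimes> X) X (ide \<B> X) (dup_star \<B> X)))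
        = cmp \<B> (X \<otimes> X) X (X \<otimes> X) (dup_star \<B> X) (dup \<B> X)"
    and dup_lax:
      "\<lbrakk>X \<in> Obj \<B>; Y \<in> Obj \<B>; R \<in> hom \<B> X Y\<rbrakk>
        \<Longrightarrow> hle \<B> X (Y \<otimes> Y)
              (cmp \<B> X Y (Y \<otimes> Y) R (dup \<B> Y))
              (cmp \<B> X (X \<otimes> X) (Y \<otimes> Y) (dup \<B> X) (tmor \<B> X Y X Y R R))"
    and del_lax:
      "\<lbrakk>X \<in> Obj \<B>; Y \<in> Obj \<B>; R \<in> hom \<B> X Y\<rbrakk>
        \<Longrightarrow> hle \<B> X \<one> (cmp \<B> X Y \<one> R (del \<B> Y)) (del \<B> X)"
    and del_tensor:
      "\<lbrakk>X \<in> Obj \<B>; Y \<in> Obj \<B>\<rbrakk>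
        \<Longrightarrow> del \<B> (X \<otimes> Y)
          = cmp \<B> (X \<otimes> Y) (\<one> \<otimes> \<one>) \<one> (tmor \<B> X \<one> Y \<one> (del \<B> X) (del \<B> Y)) (lun \<B> \<one>)"
    and dup_tensor:
      "\<lbrakk>X \<in> Obj \<B>; Y \<in> Obj \<B>\<rbrakk>
        \<Longrightarrow> dup \<B> (X \<otimes> Y)
          = cmp \<B> (X \<otimes> Y) ((X \<otimes> X) \<otimes> (Y \<otimes> Y)) ((X \<otimes> Y) \<otimes> (X \<otimes> Y))
              (tmor \<B> X (X \<otimes> X) Y (Y \<otimes> Y) (dup \<B> X) (dup \<B> Y)) (middle4 \<B> X Y)"

locale cbc_morphism =
  dom: cartesian_bicategory \<B> + cod: cartesian_bicategory \<D> + cat_functor \<B> \<D> F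
  for \<B> :: "('o1, 'm1) bicat"
  and \<D> :: "('o2, 'm2) bicat"
  and F :: "('o1, 'm1, 'o2, 'm2) fctr" +
  assumes fmor_mono:
      "\<lbrakk>X \<in> Obj \<B>; Y \<in> Obj \<B>; f \<in> hom \<B> X Y; g \<in> hom \<B> X Y; hle \<B> X Y f g\<rbrakk>
        \<Longrightarrow> hle \<D> (fobj F X) (fobj F Y) (fmor F X Y f) (fmor F X Y g)"
    and fobj_tobj:
      "\<lbrakk>X \<in> Obj \<B>; Y \<in> Obj \<B>\<rbrakk> \<Longrightarrow> fobj F (X \<otimes>\<^bsub>\<B>\<^esub> Y) = fobj F X \<otimes>\<^bsub>\<D>\<^esub> fobj F Y"
    and fobj_unt: "fobj F \<one>\<^bsub>\<B>\<^esub> = \<one>\<^bsub>\<D>\<^esub>"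
    and fmor_tmor:
      "\<lbrakk>X \<in> Obj \<B>; Y \<in> Obj \<B>; X' \<in> Obj \<B>; Y' \<in> Obj \<B>; f \<in> hom \<B> X Y; g \<in> hom \<B> X' Y'\<rbrakk>
        \<Longrightarrow> fmor F (X \<otimes>\<^bsub>\<B>\<^esub> X') (Y \<otimes>\<^bsub>\<B>\<^esub> Y') (tmor \<B> X Y X' Y' f g)
          = tmor \<D> (fobj F X) (fobj F Y) (fobj F X') (fobj F Y') (fmor F X Y f) (fmor F X' Y' g)"
    and fmor_assoc:
      "\<lbrakk>X \<in> Obj \<B>; Y \<in> Obj \<B>; Z \<in> Obj \<B>\<rbrakk>
        \<Longrightarrow> fmor F ((X \<otimes>\<^bsub>\<B>\<^esub> Y) \<otimes>\<^bsub>\<B>\<^esub> Z) (X \<otimes>\<^bsub>\<B>\<^esub> (Y \<otimes>\<^bsub>\<B>\<^esub> Z)) (assoc \<B> X Y Z)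
          = assoc \<D> (fobj F X) (fobj F Y) (fobj F Z)"
    and fmor_lun: "X \<in> Obj \<B> \<Longrightarrow> fmor F (\<one>\<^bsub>\<B>\<^esub> \<otimes>\<^bsub>\<B>\<^esub> X) X (lun \<B> X) = lun \<D> (fobj F X)"
    and fmor_run: "X \<in> Obj \<B> \<Longrightarrow> fmor F (X \<otimes>\<^bsub>\<B>\<^esub> \<one>\<^bsub>\<B>\<^esub>) X (run \<B> X) = run \<D> (fobj F X)"
    and fmor_braid:
      "\<lbrakk>X \<in> Obj \<B>; Y \<in> Obj \<B>\<rbrakk>
        \<Longrightarrow> fmor F (X \<otimes>\<^bsub>\<B>\<^esub> Y) (Y \<otimes>\<^bsub>\<B>\<^esub> X) (braid \<B> X Y) = braid \<D> (fobj F X) (fobj F Y)"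
    and fmor_dup:
      "X \<in> Obj \<B> \<Longrightarrow> fmor F X (X \<otimes>\<^bsub>\<B>\<^esub> X) (dup \<B> X) = dup \<D> (fobj F X)"
    and fmor_del: "X \<in> Obj \<B> \<Longrightarrow> fmor F X \<one>\<^bsub>\<B>\<^esub> (del \<B> X) = del \<D> (fobj F X)"
    and fmor_dup_star:
      "X \<in> Obj \<B> \<Longrightarrow> fmor F (X \<otimes>\<^bsub>\<B>\<^esub> X) X (dup_star \<B> X) = dup_star \<D> (fobj F X)"
    and fmor_del_star: "X \<in> Obj \<B> \<Longrightarrow> fmor F \<one>\<^bsub>\<B>\<^esub> X (del_star \<B> X) = del_star \<D> (fobj F X)"

definition CBC :: "(('o, 'm) bicat, ('o, 'm, 'o, 'm) fctr) cat" where
  "CBC =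
     \<lparr>Obj = {\<B>. cartesian_bicategory \<B>},
      hom = (\<lambda>\<B> \<D>. {F. cbc_morphism \<B> \<D> F}),
      ide = fctr_id,
      cmp = (\<lambda>\<B> \<D> \<E>. fctr_comp \<B>)\<rparr>"


section \<open>The bicategory of relations of a doctrine\<close>

definition graph :: "('o, 'm, 'p) doctrine \<Rightarrow> 'o \<Rightarrow> 'o \<Rightarrow> 'm \<Rightarrow> 'p" where
  "graph P X Y f =
     re P (X \<boxtimes>\<^bsub>base P\<^esub> Y) (Y \<boxtimes>\<^bsub>base P\<^esub> Y)
       (prdmor (base P) X Y Y Y f (ide (base P) Y)) (dlt P Y)"

definition rel_comp :: "('o, 'm, 'p) doctrine \<Rightarrow> 'o \<Rightarrow> 'o \<Rightarrow> 'o \<Rightarrow> 'p \<Rightarrow> 'p \<Rightarrow> 'p" where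
  "rel_comp P X Y Z f g =
     (let XYZ = X \<boxtimes>\<^bsub>base P\<^esub> (Y \<boxtimes>\<^bsub>base P\<^esub> Z) in
      exq P XYZ (X \<boxtimes>\<^bsub>base P\<^esub> Z) (tr13 (base P) X Y Z)
        (re P XYZ (X \<boxtimes>\<^bsub>base P\<^esub> Y) (tr12 (base P) X Y Z) f
         \<sqinter>\<^bsub>fib P XYZ\<^esub>
         re P XYZ (Y \<boxtimes>\<^bsub>base P\<^esub> Z) (tr23 (base P) X Y Z) g))"

definition rel_tensor ::
  "('o, 'm, 'p) doctrine \<Rightarrow> 'o \<Rightarrow> 'o \<Rightarrow> 'o \<Rightarrow> 'o \<Rightarrow> 'p \<Rightarrow> 'p \<Rightarrow> 'p" where
  \<comment> \<open>for \<open>f \<in> P (A \<times> B)\<close> and \<open>g \<in> P (C \<times> D)\<close>, an element of \<open>P ((A \<times> C) \<times> (B \<times> D))\<close>\<close>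
  "rel_tensor P A B C D f g =
     (let ACBD = (A \<boxtimes>\<^bsub>base P\<^esub> C) \<boxtimes>\<^bsub>base P\<^esub> (B \<boxtimes>\<^bsub>base P\<^esub> D) in
      re P ACBD (A \<boxtimes>\<^bsub>base P\<^esub> B) (qu13 (base P) A C B D) f
      \<sqinter>\<^bsub>fib P ACBD\<^esub>
      re P ACBD (C \<boxtimes>\<^bsub>base P\<^esub> D) (qu24 (base P) A C B D) g)"

definition AP :: "('o, 'm, 'p) doctrine \<Rightarrow> ('o, 'p) bicat" where
  "AP P =
     (let C = base P; I = trm C; Gr = graph P in
     \<lparr>Obj = Obj C,
      hom = (\<lambda>X Y. carrier (fib P (X \<boxtimes>\<^bsub>C\<^esub> Y))),
      ide = dlt P,
      cmp = rel_comp P,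
      hle = (\<lambda>X Y. le (fib P (X \<boxtimes>\<^bsub>C\<^esub> Y))),
      tobj = prd C,
      unt = I,
      tmor = rel_tensor P,
      assoc = (\<lambda>X Y Z. Gr ((X \<boxtimes>\<^bsub>C\<^esub> Y) \<boxtimes>\<^bsub>C\<^esub> Z) (X \<boxtimes>\<^bsub>C\<^esub> (Y \<boxtimes>\<^bsub>C\<^esub> Z)) (cassoc C X Y Z)),
      lun = (\<lambda>X. Gr (I \<boxtimes>\<^bsub>C\<^esub> X) X (pr2 C I X)),
      run = (\<lambda>X. Gr (X \<boxtimes>\<^bsub>C\<^esub> I) X (pr1 C X I)),
      braid = (\<lambda>X Y. Gr (X \<boxtimes>\<^bsub>C\<^esub> Y) (Y \<boxtimes>\<^bsub>C\<^esub> X) (cbraid C X Y)),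
      dup = (\<lambda>X. Gr X (X \<boxtimes>\<^bsub>C\<^esub> X) (diag C X)),
      del = (\<lambda>X. Gr X I (bang C X))\<rparr>)"

fun L_mor ::
  "('o1, 'm1, 'p1) doctrine \<Rightarrow> ('o1, 'm1, 'p1, 'o2, 'm2, 'p2) eed_mor
    \<Rightarrow> ('o1, 'p1, 'o2, 'p2) fctr" where
  "L_mor P (F, b) =
     \<lparr>fobj = (\<lambda>X. if X \<in> Obj (base P) then fobj F X else undefined),
      fmor = (\<lambda>X Y r. if X \<in> Obj (base P) \<and> Y \<in> Obj (base P)
                          \<and> r \<in> carrier (fib P (X \<boxtimes>\<^bsub>base P\<^esub> Y))
                then b (X \<boxtimes>\<^bsub>base P\<^esub> Y) r else undefined)\<rparr>"

definition L_functor ::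
  "(('o, 'm, 'p) doctrine, ('o, 'm, 'p, 'o, 'm, 'p) eed_mor, ('o, 'p) bicat, ('o, 'p, 'o, 'p) fctr) fctr"
  where
  "L_functor =
     \<lparr>fobj = (\<lambda>P. if P \<in> Obj EED then AP P else undefined),
      fmor = (\<lambda>P R m. if P \<in> Obj EED \<and> R \<in> Obj EED \<and> m \<in> hom EED P R
                then L_mor P m else undefined)\<rparr>"

end

theory Submission
  imports Defs
begin

text \<open>
  The fibres of an elementary existential doctrine interpret a regular logic with equality. A relation
  \<open>r \<in> P (X \<times> Y)\<close> is evaluated at generalized elements \<open>x : Z \<rightarrow> X\<close>, \<open>y : Z \<rightarrow> Y\<close> under a hypothesis
  \<open>\<phi> \<in> P Z\<close>, and two relations agree as soon as they are forced at the same elements. By Beck-Chevalley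
  and Frobenius, \<open>r ; s\<close> is forced at \<open>(x, z)\<close> iff some context extension provides a \<open>y\<close> with
  \<open>r(x, y)\<close> and \<open>s(y, z)\<close>; by the formula for the left adjoint along \<open>id \<times> \<Delta>\<close>, \<open>\<delta>\<close> is a congruence.
  The axioms of a cartesian bicategory then become the familiar element computations for sets and
  relations: graphs compose and tensor like morphisms of the base, and the right adjoint of a graph
  is its converse. A morphism of doctrines preserves all operations involved, the only subtle one
  being the quantification along \<open>\<langle>\<pi>\<^sub>1, \<pi>\<^sub>3\<rangle>\<close>, which is a projection up to isomorphism.
\<close>

section \<open>Generalized elements in cartesian categories\<close>

text \<open>A fibre provides neither implication nor comprehension, so the part of a context where
  \<phi> holds need not be an object of the base. The pair of a context and a hypothesis \<phi>
  stands in for it, and every element computation runs under such a hypothesis. Existential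
  witnesses live only over an extended context and have to be discharged again. This is why a cover
  asks that \<phi> lie below every \<chi> whose restriction follows from \<psi>: this is the
  universal property of the image of \<psi> along \<open>s\<close>, stated without an
  \<open>exq\<close> along \<open>s\<close>, so nested witnesses can be discharged one cover at a
  time. A second difficulty is that \<open>exq\<close> is a Hilbert choice and \<open>radj\<close> a
  definite description. Neither can be computed, nor transported along a morphism of doctrines,
  before it is identified: the first by uniqueness of left adjoints on the elements of a fibre, the
  second as the converse of a graph. That converse is a reindexed equality, so morphisms of
  doctrines preserve it.\<close>

context category
begin

lemmas cat_typing [simp] = ide_in_hom cmp_in_hom cmp_ide_left cmp_ide_right

text \<open>Associativity is oriented to the left so that a generalized element stays at the head of
  a composite and the structural morphisms act on it one after the other.\<close>

lemma cmp_left_assoc [simp]: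
  "\<lbrakk>W \<in> Obj C; X \<in> Obj C; Y \<in> Obj C; Z \<in> Obj C;
    f \<in> hom C W X; g \<in> hom C X Y; h \<in> hom C Y Z\<rbrakk>
    \<Longrightarrow> cmp C W X Z f (cmp C X Y Z g h) = cmp C W Y Z (cmp C W X Y f g) h"
  by (simp add: cmp_assoc)

lemma inverse_mors_unique:
  assumes "X \<in> Obj C" "Y \<in> Obj C" "inverse_mors C X Y f g" "inverse_mors C X Y f g'"
  shows "g' = g"
proof -
  have "g' = cmp C Y X X g' (cmp C X Y X f g)"
    using assms by (simp add: inverse_mors_def del: cmp_left_assoc)
  also have "\<dots> = cmp C Y Y X (cmp C Y X Y g' f) g"
    by (rule cmp_left_assoc) (use assms in \<open>auto simp: inverse_mors_def\<close>)
  also have "\<dots> = g"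
    using assms by (simp add: inverse_mors_def)
  finally show ?thesis .
qed

lemma inv_mor_eqI:
  assumes "X \<in> Obj C" "Y \<in> Obj C" "inverse_mors C X Y f g"
  shows "inv_mor C X Y f = g"
  unfolding inv_mor_def using assms(3) inverse_mors_unique[OF assms] by (rule the_equality)

end

text \<open>
  Morphisms are compared by their action on generalized elements; a generalized element of a
  product is a pair, so that the structural morphisms act as on tuples.
\<close>

context cartesian_category
begin

lemmas cart_typing [simp] =
  prd_in pr1_in pr2_in pair_in pair_pr1 pair_pr2 trm_in bang_in

lemma cmp_pair [simp]:
  assumes "V \<in> Obj C" "Z \<in> Obj C" "X \<in> Obj C" "Y \<in> Obj C"
    "s \<in> hom C V Z" "f \<in> hom C Z X" "g \<in> hom C Z Y"
  shows "cmp C V Z (X \<boxtimes> Y) s (pair C Z X Y f g)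
       = pair C V X Y (cmp C V Z X s f) (cmp C V Z Y s g)"
  using pair_unique[of V X Y "cmp C V Z (X \<boxtimes> Y) s (pair C Z X Y f g)"] assms
  by (simp add: cmp_assoc del: cmp_left_assoc)

lemma pair_pr12 [simp]:
  assumes "X \<in> Obj C" "Y \<in> Obj C"
  shows "pair C (X \<boxtimes> Y) X Y (pr1 C X Y) (pr2 C X Y) = ide C (X \<boxtimes> Y)"
  using pair_unique[of "X \<boxtimes> Y" X Y "ide C (X \<boxtimes> Y)"] assms by simp

text \<open>As an elimination rule this splits an unknown element of a product into a tuple, on
  which the structural morphisms then compute by rewriting.\<close>

lemma pairE:
  assumes "f \<in> hom C Z (X \<boxtimes> Y)" "Z \<in> Obj C" "X \<in> Obj C" "Y \<in> Obj C"
  obtains a b where "a \<in> hom C Z X" "b \<in> hom C Z Y" "f = pair C Z X Y a b"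
proof
  show "f = pair C Z X Y (cmp C Z (X \<boxtimes> Y) X f (pr1 C X Y)) (cmp C Z (X \<boxtimes> Y) Y f (pr2 C X Y))"
    using assms by (simp add: pair_unique)
qed (use assms in auto)

lemma pair_eq_iff:
  assumes "Z \<in> Obj C" "X \<in> Obj C" "Y \<in> Obj C" "f \<in> hom C Z X" "g \<in> hom C Z Y"
    "f' \<in> hom C Z X" "g' \<in> hom C Z Y"
  shows "pair C Z X Y f g = pair C Z X Y f' g' \<longleftrightarrow> f = f' \<and> g = g'"
  using assms by (metis pair_pr1 pair_pr2)

text \<open>The generic element \<open>ide C X\<close> alone decides the equation. The hypothesis
  ranges over all elements so that they can be taken apart by \<open>pairE\<close>.\<close>

lemma mor_eqI:
  assumes "X \<in> Obj C" "Y \<in> Obj C" "f \<in> hom C X Y" "g \<in> hom C X Y"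
    and "\<And>Z x. Z \<in> Obj C \<Longrightarrow> x \<in> hom C Z X \<Longrightarrow> cmp C Z X Y x f = cmp C Z X Y x g"
  shows "f = g"
  using assms(5)[of X "ide C X"] assms(1-4) by simp

lemma cmp_bang [simp]:
  "\<lbrakk>Z \<in> Obj C; X \<in> Obj C; x \<in> hom C Z X\<rbrakk> \<Longrightarrow> cmp C Z X (trm C) x (bang C X) = bang C Z"
  by (rule bang_unique) auto

lemma trmE:
  assumes "f \<in> hom C Z (trm C)" "Z \<in> Obj C"
  obtains "f = bang C Z"
  using assms bang_unique by blast

lemma diag_in [simp]: "X \<in> Obj C \<Longrightarrow> diag C X \<in> hom C X (X \<boxtimes> X)"
  by (simp add: diag_def)

lemma cmp_diag [simp]:
  "\<lbrakk>Z \<in> Obj C; X \<in> Obj C; x \<in> hom C Z X\<rbrakk>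
    \<Longrightarrow> cmp C Z X (X \<boxtimes> X) x (diag C X) = pair C Z X X x x"
  by (simp add: diag_def)

lemma prdmor_in [simp]:
  "\<lbrakk>X \<in> Obj C; Y \<in> Obj C; X' \<in> Obj C; Y' \<in> Obj C; f \<in> hom C X Y; g \<in> hom C X' Y'\<rbrakk>
    \<Longrightarrow> prdmor C X Y X' Y' f g \<in> hom C (X \<boxtimes> X') (Y \<boxtimes> Y')"
  by (simp add: prdmor_def)

lemma pair_prdmor [simp]:
  "\<lbrakk>X \<in> Obj C; Y \<in> Obj C; X' \<in> Obj C; Y' \<in> Obj C; f \<in> hom C X Y; g \<in> hom C X' Y';
    Z \<in> Obj C; a \<in> hom C Z X; b \<in> hom C Z X'\<rbrakk>
    \<Longrightarrow> cmp C Z (X \<boxtimes> X') (Y \<boxtimes> Y') (pair C Z X X' a b) (prdmor C X Y X' Y' f g)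
      = pair C Z Y Y' (cmp C Z X Y a f) (cmp C Z X' Y' b g)"
  by (simp add: prdmor_def)

lemma prdmor_ide [simp]:
  "\<lbrakk>X \<in> Obj C; Y \<in> Obj C\<rbrakk> \<Longrightarrow> prdmor C X X Y Y (ide C X) (ide C Y) = ide C (X \<boxtimes> Y)"
  by (simp add: prdmor_def)

lemma tr_in [simp]:
  assumes "X \<in> Obj C" "Y \<in> Obj C" "Z \<in> Obj C"
  shows "tr1 C X Y Z \<in> hom C (X \<boxtimes> Y \<boxtimes> Z) X"
    "tr2 C X Y Z \<in> hom C (X \<boxtimes> Y \<boxtimes> Z) Y"
    "tr3 C X Y Z \<in> hom C (X \<boxtimes> Y \<boxtimes> Z) Z"
    "tr12 C X Y Z \<in> hom C (X \<boxtimes> Y \<boxtimes> Z) (X \<boxtimes> Y)"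
    "tr23 C X Y Z \<in> hom C (X \<boxtimes> Y \<boxtimes> Z) (Y \<boxtimes> Z)"
    "tr13 C X Y Z \<in> hom C (X \<boxtimes> Y \<boxtimes> Z) (X \<boxtimes> Z)"
  using assms by (simp_all add: tr1_def tr2_def tr3_def tr12_def tr23_def tr13_def)

lemma pair_tr [simp]:
  assumes "X \<in> Obj C" "Y \<in> Obj C" "Z \<in> Obj C" "W \<in> Obj C"
    "x \<in> hom C W X" "y \<in> hom C W Y" "z \<in> hom C W Z"
  shows "cmp C W (X \<boxtimes> Y \<boxtimes> Z) (X \<boxtimes> Y) (pair C W X (Y \<boxtimes> Z) x (pair C W Y Z y z)) (tr12 C X Y Z)
      = pair C W X Y x y"
    "cmp C W (X \<boxtimes> Y \<boxtimes> Z) (Y \<boxtimes> Z) (pair C W X (Y \<boxtimes> Z) x (pair C W Y Z y z)) (tr23 C X Y Z)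
      = pair C W Y Z y z"
    "cmp C W (X \<boxtimes> Y \<boxtimes> Z) (X \<boxtimes> Z) (pair C W X (Y \<boxtimes> Z) x (pair C W Y Z y z)) (tr13 C X Y Z)
      = pair C W X Z x z"
  using assms by (simp_all add: tr1_def tr2_def tr3_def tr12_def tr23_def tr13_def)

lemma qu_in [simp]:
  assumes "X1 \<in> Obj C" "X2 \<in> Obj C" "X3 \<in> Obj C" "X4 \<in> Obj C"
  shows "qu13 C X1 X2 X3 X4 \<in> hom C ((X1 \<boxtimes> X2) \<boxtimes> (X3 \<boxtimes> X4)) (X1 \<boxtimes> X3)"
    "qu24 C X1 X2 X3 X4 \<in> hom C ((X1 \<boxtimes> X2) \<boxtimes> (X3 \<boxtimes> X4)) (X2 \<boxtimes> X4)"
  using assms by (simp_all add: qu13_def qu24_def)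

lemma pair_qu [simp]:
  assumes "X1 \<in> Obj C" "X2 \<in> Obj C" "X3 \<in> Obj C" "X4 \<in> Obj C" "W \<in> Obj C"
    "a \<in> hom C W X1" "b \<in> hom C W X2" "c \<in> hom C W X3" "d \<in> hom C W X4"
  shows "cmp C W ((X1 \<boxtimes> X2) \<boxtimes> (X3 \<boxtimes> X4)) (X1 \<boxtimes> X3)
      (pair C W (X1 \<boxtimes> X2) (X3 \<boxtimes> X4) (pair C W X1 X2 a b) (pair C W X3 X4 c d)) (qu13 C X1 X2 X3 X4)
      = pair C W X1 X3 a c"
    "cmp C W ((X1 \<boxtimes> X2) \<boxtimes> (X3 \<boxtimes> X4)) (X2 \<boxtimes> X4)
      (pair C W (X1 \<boxtimes> X2) (X3 \<boxtimes> X4) (pair C W X1 X2 a b) (pair C W X3 X4 c d)) (qu24 C X1 X2 X3 X4)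
      = pair C W X2 X4 b d"
  using assms by (simp_all add: qu13_def qu24_def)

lemma cassoc_in [simp]:
  "\<lbrakk>X \<in> Obj C; Y \<in> Obj C; Z \<in> Obj C\<rbrakk>
    \<Longrightarrow> cassoc C X Y Z \<in> hom C ((X \<boxtimes> Y) \<boxtimes> Z) (X \<boxtimes> (Y \<boxtimes> Z))"
  by (simp add: cassoc_def)

lemma pair_cassoc [simp]:
  "\<lbrakk>X \<in> Obj C; Y \<in> Obj C; Z \<in> Obj C; W \<in> Obj C;
    x \<in> hom C W X; y \<in> hom C W Y; z \<in> hom C W Z\<rbrakk>
    \<Longrightarrow> cmp C W ((X \<boxtimes> Y) \<boxtimes> Z) (X \<boxtimes> (Y \<boxtimes> Z))
          (pair C W (X \<boxtimes> Y) Z (pair C W X Y x y) z) (cassoc C X Y Z)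
      = pair C W X (Y \<boxtimes> Z) x (pair C W Y Z y z)"
  by (simp add: cassoc_def)

lemma cbraid_in [simp]:
  "\<lbrakk>X \<in> Obj C; Y \<in> Obj C\<rbrakk> \<Longrightarrow> cbraid C X Y \<in> hom C (X \<boxtimes> Y) (Y \<boxtimes> X)"
  by (simp add: cbraid_def)

lemma pair_cbraid [simp]:
  "\<lbrakk>X \<in> Obj C; Y \<in> Obj C; W \<in> Obj C; x \<in> hom C W X; y \<in> hom C W Y\<rbrakk>
    \<Longrightarrow> cmp C W (X \<boxtimes> Y) (Y \<boxtimes> X) (pair C W X Y x y) (cbraid C X Y) = pair C W Y X y x"
  by (simp add: cbraid_def)

definition cassoc_inv :: "'o \<Rightarrow> 'o \<Rightarrow> 'o \<Rightarrow> 'm" where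
  "cassoc_inv X Y Z =
     pair C (X \<boxtimes> (Y \<boxtimes> Z)) (X \<boxtimes> Y) Z (tr12 C X Y Z) (tr3 C X Y Z)"

lemma cassoc_inv_in [simp]:
  "\<lbrakk>X \<in> Obj C; Y \<in> Obj C; Z \<in> Obj C\<rbrakk>
    \<Longrightarrow> cassoc_inv X Y Z \<in> hom C (X \<boxtimes> (Y \<boxtimes> Z)) ((X \<boxtimes> Y) \<boxtimes> Z)"
  by (simp add: cassoc_inv_def)

lemma pair_cassoc_inv [simp]:
  "\<lbrakk>X \<in> Obj C; Y \<in> Obj C; Z \<in> Obj C; W \<in> Obj C;
    x \<in> hom C W X; y \<in> hom C W Y; z \<in> hom C W Z\<rbrakk>
    \<Longrightarrow> cmp C W (X \<boxtimes> (Y \<boxtimes> Z)) ((X \<boxtimes> Y) \<boxtimes> Z)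
          (pair C W X (Y \<boxtimes> Z) x (pair C W Y Z y z)) (cassoc_inv X Y Z)
      = pair C W (X \<boxtimes> Y) Z (pair C W X Y x y) z"
  by (simp add: cassoc_inv_def tr3_def)

lemma cassoc_inverse:
  assumes "X \<in> Obj C" "Y \<in> Obj C" "Z \<in> Obj C"
  shows "inverse_mors C ((X \<boxtimes> Y) \<boxtimes> Z) (X \<boxtimes> (Y \<boxtimes> Z)) (cassoc C X Y Z) (cassoc_inv X Y Z)"
  unfolding inverse_mors_def
proof (intro conjI)
  show "cmp C ((X \<boxtimes> Y) \<boxtimes> Z) (X \<boxtimes> (Y \<boxtimes> Z)) ((X \<boxtimes> Y) \<boxtimes> Z) (cassoc C X Y Z) (cassoc_inv X Y Z)
      = ide C ((X \<boxtimes> Y) \<boxtimes> Z)"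
    by (rule mor_eqI[of "(X \<boxtimes> Y) \<boxtimes> Z" "(X \<boxtimes> Y) \<boxtimes> Z"]) (use assms in \<open>auto elim!: pairE\<close>)
  show "cmp C (X \<boxtimes> (Y \<boxtimes> Z)) ((X \<boxtimes> Y) \<boxtimes> Z) (X \<boxtimes> (Y \<boxtimes> Z)) (cassoc_inv X Y Z) (cassoc C X Y Z)
      = ide C (X \<boxtimes> (Y \<boxtimes> Z))"
    by (rule mor_eqI[of "X \<boxtimes> (Y \<boxtimes> Z)" "X \<boxtimes> (Y \<boxtimes> Z)"]) (use assms in \<open>auto elim!: pairE\<close>)
qed (use assms in auto)

lemma cbraid_inverse:
  assumes "X \<in> Obj C" "Y \<in> Obj C"
  shows "inverse_mors C (X \<boxtimes> Y) (Y \<boxtimes> X) (cbraid C X Y) (cbraid C Y X)"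
  unfolding inverse_mors_def
proof (intro conjI)
  show "cmp C (X \<boxtimes> Y) (Y \<boxtimes> X) (X \<boxtimes> Y) (cbraid C X Y) (cbraid C Y X) = ide C (X \<boxtimes> Y)"
    by (rule mor_eqI[of "X \<boxtimes> Y" "X \<boxtimes> Y"]) (use assms in \<open>auto elim!: pairE\<close>)
  show "cmp C (Y \<boxtimes> X) (X \<boxtimes> Y) (Y \<boxtimes> X) (cbraid C Y X) (cbraid C X Y) = ide C (Y \<boxtimes> X)"
    by (rule mor_eqI[of "Y \<boxtimes> X" "Y \<boxtimes> X"]) (use assms in \<open>auto elim!: pairE\<close>)
qed (use assms in auto)

lemma pr2_inverse:
  assumes "X \<in> Obj C"
  shows "inverse_mors C (trm C \<boxtimes> X) X (pr2 C (trm C) X) (pair C X (trm C) X (bang C X) (ide C X))"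
  unfolding inverse_mors_def
proof (intro conjI)
  show "cmp C (trm C \<boxtimes> X) X (trm C \<boxtimes> X) (pr2 C (trm C) X)
      (pair C X (trm C) X (bang C X) (ide C X)) = ide C (trm C \<boxtimes> X)"
    by (rule mor_eqI[of "trm C \<boxtimes> X" "trm C \<boxtimes> X"]) (use assms in \<open>auto elim!: pairE trmE\<close>)
qed (use assms in auto)

lemma pr1_inverse:
  assumes "X \<in> Obj C"
  shows "inverse_mors C (X \<boxtimes> trm C) X (pr1 C X (trm C)) (pair C X X (trm C) (ide C X) (bang C X))"
  unfolding inverse_mors_def
proof (intro conjI)
  show "cmp C (X \<boxtimes> trm C) X (X \<boxtimes> trm C) (pr1 C X (trm C))
      (pair C X X (trm C) (ide C X) (bang C X)) = ide C (X \<boxtimes> trm C)"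
    by (rule mor_eqI[of "X \<boxtimes> trm C" "X \<boxtimes> trm C"]) (use assms in \<open>auto elim!: pairE trmE\<close>)
qed (use assms in auto)

end

section \<open>Forcing in a doctrine\<close>

lemma left_adjoint_iff:
  "left_adjoint P X Y f L \<longleftrightarrow>
     partial_order (fib P X) \<and> partial_order (fib P Y) \<and>
     L \<in> carrier (fib P X) \<rightarrow> carrier (fib P Y) \<and>
     re P X Y f \<in> carrier (fib P Y) \<rightarrow> carrier (fib P X) \<and>
     (\<forall>\<alpha>\<in>carrier (fib P X). \<forall>\<beta>\<in>carrier (fib P Y).
        le (fib P Y) (L \<alpha>) \<beta> \<longleftrightarrow> le (fib P X) \<alpha> (re P X Y f \<beta>))"
  by (auto simp: left_adjoint_def galois_connection_def connection_def galois_connection_axioms_def)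

context elementary_existential_doctrine
begin

abbreviation prd_base (infixr "\<odot>" 75) where "X \<odot> Y \<equiv> X \<boxtimes>\<^bsub>base P\<^esub> Y"
abbreviation (input) ob where "ob \<equiv> Obj (base P)"
abbreviation (input) mor where "mor \<equiv> hom (base P)"
abbreviation (input) el where "el X \<equiv> carrier (fib P X)"
abbreviation leq ("(_/ \<sqsubseteq>[_] _)" [51,0,51] 50) where "\<alpha> \<sqsubseteq>[X] \<beta> \<equiv> le (fib P X) \<alpha> \<beta>"
abbreviation mt ("(_/ \<sqinter>[_] _)" [70,0,71] 70) where "\<alpha> \<sqinter>[X] \<beta> \<equiv> meet (fib P X) \<alpha> \<beta>"
abbreviation tp where "tp X \<equiv> top (fib P X)"

section \<open>Semilattice structure of the fibres and reindexing\<close>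

lemma fib_partial_order: "X \<in> ob \<Longrightarrow> partial_order (fib P X)"
  using fib_inf_sl[of X] by (simp add: inf_sl_def lower_semilattice_def)

lemma leq_refl [simp]: "X \<in> ob \<Longrightarrow> \<alpha> \<in> el X \<Longrightarrow> \<alpha> \<sqsubseteq>[X] \<alpha>"
  using fib_partial_order[of X] by (simp add: partial_order_def weak_partial_order.le_refl)

lemma leq_trans:
  "\<lbrakk>\<alpha> \<sqsubseteq>[X] \<beta>; \<beta> \<sqsubseteq>[X] \<gamma>; X \<in> ob; \<alpha> \<in> el X; \<beta> \<in> el X; \<gamma> \<in> el X\<rbrakk> \<Longrightarrow> \<alpha> \<sqsubseteq>[X] \<gamma>"
  using fib_partial_order[of X] weak_partial_order.le_trans[of "fib P X" \<alpha> \<beta> \<gamma>]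
  by (simp add: partial_order_def)

lemma leq_antisym:
  "\<lbrakk>\<alpha> \<sqsubseteq>[X] \<beta>; \<beta> \<sqsubseteq>[X] \<alpha>; X \<in> ob; \<alpha> \<in> el X; \<beta> \<in> el X\<rbrakk> \<Longrightarrow> \<alpha> = \<beta>"
  using fib_partial_order[of X] partial_order.le_antisym[of "fib P X" \<alpha> \<beta>] by simp

lemma weak_semilattice: "X \<in> ob \<Longrightarrow> weak_lower_semilattice (fib P X)"
  using fib_inf_sl[of X] unfolding inf_sl_def
  by (meson lower_semilattice.axioms(1) lower_semilattice.inf_of_two_exists
      partial_order.axioms(1) weak_lower_semilattice.intro weak_lower_semilattice_axioms.intro)

lemma mt_in [simp]: "\<lbrakk>X \<in> ob; \<alpha> \<in> el X; \<beta> \<in> el X\<rbrakk> \<Longrightarrow> \<alpha> \<sqinter>[X] \<beta> \<in> el X"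
  by (simp add: weak_semilattice weak_lower_semilattice.meet_closed)

lemma mt_left [simp]: "\<lbrakk>X \<in> ob; \<alpha> \<in> el X; \<beta> \<in> el X\<rbrakk> \<Longrightarrow> \<alpha> \<sqinter>[X] \<beta> \<sqsubseteq>[X] \<alpha>"
  by (simp add: weak_semilattice weak_lower_semilattice.meet_left)

lemma mt_right [simp]: "\<lbrakk>X \<in> ob; \<alpha> \<in> el X; \<beta> \<in> el X\<rbrakk> \<Longrightarrow> \<alpha> \<sqinter>[X] \<beta> \<sqsubseteq>[X] \<beta>"
  by (simp add: weak_semilattice weak_lower_semilattice.meet_right)

lemma leq_mt_iff:
  assumes "X \<in> ob" "\<alpha> \<in> el X" "\<beta> \<in> el X" "\<gamma> \<in> el X"
  shows "\<gamma> \<sqsubseteq>[X] \<alpha> \<sqinter>[X] \<beta> \<longleftrightarrow> \<gamma> \<sqsubseteq>[X] \<alpha> \<and> \<gamma> \<sqsubseteq>[X] \<beta>"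
  using assms weak_lower_semilattice.meet_le[OF weak_semilattice]
  by (meson leq_trans mt_in mt_left mt_right)

lemma tp_in [simp]: "X \<in> ob \<Longrightarrow> tp X \<in> el X"
  using fib_inf_sl[of X] by (simp add: inf_sl_def weak_partial_order_top.top_closed)

lemma leq_tp [simp]: "\<lbrakk>X \<in> ob; \<alpha> \<in> el X\<rbrakk> \<Longrightarrow> \<alpha> \<sqsubseteq>[X] tp X"
  using fib_inf_sl[of X] by (simp add: inf_sl_def weak_partial_order_top.top_higher)

lemma re_in [simp]:
  "\<lbrakk>X \<in> ob; Y \<in> ob; f \<in> mor X Y; \<alpha> \<in> el Y\<rbrakk> \<Longrightarrow> re P X Y f \<alpha> \<in> el X"
  using re_hom[of X Y f] by (auto simp: inf_sl_hom_def)

lemma re_tp [simp]: "\<lbrakk>X \<in> ob; Y \<in> ob; f \<in> mor X Y\<rbrakk> \<Longrightarrow> re P X Y f (tp Y) = tp X"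
  using re_hom[of X Y f] by (auto simp: inf_sl_hom_def)

lemma re_mt [simp]:
  "\<lbrakk>X \<in> ob; Y \<in> ob; f \<in> mor X Y; \<alpha> \<in> el Y; \<beta> \<in> el Y\<rbrakk>
    \<Longrightarrow> re P X Y f (\<alpha> \<sqinter>[Y] \<beta>) = re P X Y f \<alpha> \<sqinter>[X] re P X Y f \<beta>"
  using re_hom[of X Y f] by (auto simp: inf_sl_hom_def)

text \<open>Reindexing preserves meets, and \<alpha> \<le> \<beta> amounts to \<alpha> being its own
  meet with \<beta>.\<close>

lemma re_mono:
  assumes "X \<in> ob" "Y \<in> ob" "f \<in> mor X Y" "\<alpha> \<in> el Y" "\<beta> \<in> el Y" "\<alpha> \<sqsubseteq>[Y] \<beta>"
  shows "re P X Y f \<alpha> \<sqsubseteq>[X] re P X Y f \<beta>"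
proof -
  have "\<alpha> = \<alpha> \<sqinter>[Y] \<beta>"
    using assms by (intro leq_antisym) (auto simp: leq_mt_iff)
  then have "re P X Y f \<alpha> = re P X Y f \<alpha> \<sqinter>[X] re P X Y f \<beta>"
    using assms re_mt by metis
  then show ?thesis
    using assms by (metis mt_right re_in)
qed

lemma re_re [simp]:
  "\<lbrakk>X \<in> ob; Y \<in> ob; Z \<in> ob; f \<in> mor X Y; g \<in> mor Y Z; \<alpha> \<in> el Z\<rbrakk>
    \<Longrightarrow> re P X Y f (re P Y Z g \<alpha>) = re P X Z (cmp (base P) X Y Z f g) \<alpha>"
  by (simp add: re_cmp)

lemmas re_ide_dlt_in [simp] = re_ide dlt_in

text \<open>Two left adjoints of one map bound each other, by transposing reflexivity. This works
  only for elements of the fibre: elsewhere the choice made by \<open>exq\<close> is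
  unspecified.\<close>

lemma left_adjoint_exq:
  assumes "left_adjoint P X Y f L" "\<alpha> \<in> el X" "X \<in> ob" "Y \<in> ob"
  shows "exq P X Y f \<alpha> = L \<alpha>"
proof -
  have "left_adjoint P X Y f (exq P X Y f)"
    unfolding exq_def using assms(1) by (rule someI[where P = "left_adjoint P X Y f"])
  then show ?thesis
    using assms leq_antisym[of Y "exq P X Y f \<alpha>" "L \<alpha>"] leq_refl
    unfolding left_adjoint_iff by (metis PiE)
qed

section \<open>Quantification along projections and along the outer pair of a triple\<close>

lemma projection_pr1 [simp]:
  "\<lbrakk>X \<in> ob; Y \<in> ob\<rbrakk> \<Longrightarrow> projection (base P) (X \<odot> Y) X (pr1 (base P) X Y)"
  by (auto simp: projection_def)

lemma exq_pr1_left_adjoint: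
  assumes "X \<in> ob" "Y \<in> ob"
  shows "left_adjoint P (X \<odot> Y) X (pr1 (base P) X Y) (exq P (X \<odot> Y) X (pr1 (base P) X Y))"
proof -
  obtain L where "left_adjoint P (X \<odot> Y) X (pr1 (base P) X Y) L"
    using existential[OF projection_pr1[OF assms]] ..
  then show ?thesis
    unfolding exq_def by (rule someI[where P = "left_adjoint P (X \<odot> Y) X (pr1 (base P) X Y)"])
qed

lemma exq_pr1_in [simp]:
  assumes "X \<in> ob" "Y \<in> ob" "\<alpha> \<in> el (X \<odot> Y)"
  shows "exq P (X \<odot> Y) X (pr1 (base P) X Y) \<alpha> \<in> el X"
  using exq_pr1_left_adjoint[OF assms(1,2)] assms(3) unfolding left_adjoint_iff by blast

lemma exq_pr1_le_iff:
  assumes "X \<in> ob" "Y \<in> ob" "\<alpha> \<in> el (X \<odot> Y)" "\<beta> \<in> el X"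
  shows "exq P (X \<odot> Y) X (pr1 (base P) X Y) \<alpha> \<sqsubseteq>[X] \<beta>
    \<longleftrightarrow> \<alpha> \<sqsubseteq>[X \<odot> Y] re P (X \<odot> Y) X (pr1 (base P) X Y) \<beta>"
  using exq_pr1_left_adjoint[OF assms(1,2)] assms(3,4) unfolding left_adjoint_iff by blast

text \<open>
  The map \<open>\<langle>\<pi>\<^sub>1, \<pi>\<^sub>3\<rangle>\<close> in the composition of relations is a projection only up to the isomorphism
  below, along which its left adjoint is transported.
\<close>

definition mid_last :: "'o \<Rightarrow> 'o \<Rightarrow> 'o \<Rightarrow> 'm" where
  "mid_last X Y Z =
     (let C = base P; W = (X \<odot> Z) \<odot> Y; p = pr1 C (X \<odot> Z) Y in
      pair C W X (Y \<odot> Z) (cmp C W (X \<odot> Z) X p (pr1 C X Z))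
        (pair C W Y Z (pr2 C (X \<odot> Z) Y) (cmp C W (X \<odot> Z) Z p (pr2 C X Z))))"

definition mid_last_inv :: "'o \<Rightarrow> 'o \<Rightarrow> 'o \<Rightarrow> 'm" where
  "mid_last_inv X Y Z =
     pair (base P) (X \<odot> Y \<odot> Z) (X \<odot> Z) Y (tr13 (base P) X Y Z) (tr2 (base P) X Y Z)"

lemma mid_last_in [simp]:
  assumes "X \<in> ob" "Y \<in> ob" "Z \<in> ob"
  shows "mid_last X Y Z \<in> mor ((X \<odot> Z) \<odot> Y) (X \<odot> Y \<odot> Z)"
    "mid_last_inv X Y Z \<in> mor (X \<odot> Y \<odot> Z) ((X \<odot> Z) \<odot> Y)"
  using assms by (simp_all add: mid_last_def mid_last_inv_def Let_def)

lemma pair_mid_last [simp]: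
  assumes "X \<in> ob" "Y \<in> ob" "Z \<in> ob" "W \<in> ob" "x \<in> mor W X" "y \<in> mor W Y" "z \<in> mor W Z"
  shows "cmp (base P) W ((X \<odot> Z) \<odot> Y) (X \<odot> Y \<odot> Z)
      (pair (base P) W (X \<odot> Z) Y (pair (base P) W X Z x z) y) (mid_last X Y Z)
      = pair (base P) W X (Y \<odot> Z) x (pair (base P) W Y Z y z)"
    "cmp (base P) W (X \<odot> Y \<odot> Z) ((X \<odot> Z) \<odot> Y)
      (pair (base P) W X (Y \<odot> Z) x (pair (base P) W Y Z y z)) (mid_last_inv X Y Z)
      = pair (base P) W (X \<odot> Z) Y (pair (base P) W X Z x z) y"
  using assms by (simp_all add: mid_last_def mid_last_inv_def Let_def tr2_def)

lemma mid_last_cmp [simp]: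
  assumes "X \<in> ob" "Y \<in> ob" "Z \<in> ob"
  shows "cmp (base P) (X \<odot> Y \<odot> Z) ((X \<odot> Z) \<odot> Y) (X \<odot> Y \<odot> Z)
      (mid_last_inv X Y Z) (mid_last X Y Z) = ide (base P) (X \<odot> Y \<odot> Z)"
    "cmp (base P) ((X \<odot> Z) \<odot> Y) (X \<odot> Y \<odot> Z) ((X \<odot> Z) \<odot> Y)
      (mid_last X Y Z) (mid_last_inv X Y Z) = ide (base P) ((X \<odot> Z) \<odot> Y)"
    "cmp (base P) ((X \<odot> Z) \<odot> Y) (X \<odot> Y \<odot> Z) (X \<odot> Z) (mid_last X Y Z) (tr13 (base P) X Y Z)
      = pr1 (base P) (X \<odot> Z) Y"
    "cmp (base P) (X \<odot> Y \<odot> Z) ((X \<odot> Z) \<odot> Y) (X \<odot> Z) (mid_last_inv X Y Z) (pr1 (base P) (X \<odot> Z) Y)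
      = tr13 (base P) X Y Z"
proof -
  show "cmp (base P) (X \<odot> Y \<odot> Z) ((X \<odot> Z) \<odot> Y) (X \<odot> Y \<odot> Z)
      (mid_last_inv X Y Z) (mid_last X Y Z) = ide (base P) (X \<odot> Y \<odot> Z)"
    by (rule mor_eqI[of "X \<odot> Y \<odot> Z" "X \<odot> Y \<odot> Z"]) (use assms in \<open>auto elim!: pairE\<close>)
  show "cmp (base P) ((X \<odot> Z) \<odot> Y) (X \<odot> Y \<odot> Z) ((X \<odot> Z) \<odot> Y)
      (mid_last X Y Z) (mid_last_inv X Y Z) = ide (base P) ((X \<odot> Z) \<odot> Y)"
    by (rule mor_eqI[of "(X \<odot> Z) \<odot> Y" "(X \<odot> Z) \<odot> Y"]) (use assms in \<open>auto elim!: pairE\<close>)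
  show "cmp (base P) ((X \<odot> Z) \<odot> Y) (X \<odot> Y \<odot> Z) (X \<odot> Z) (mid_last X Y Z) (tr13 (base P) X Y Z)
      = pr1 (base P) (X \<odot> Z) Y"
    by (rule mor_eqI[of "(X \<odot> Z) \<odot> Y" "X \<odot> Z"]) (use assms in \<open>auto elim!: pairE\<close>)
  show "cmp (base P) (X \<odot> Y \<odot> Z) ((X \<odot> Z) \<odot> Y) (X \<odot> Z) (mid_last_inv X Y Z) (pr1 (base P) (X \<odot> Z) Y)
      = tr13 (base P) X Y Z"
    by (rule mor_eqI[of "X \<odot> Y \<odot> Z" "X \<odot> Z"]) (use assms in \<open>auto elim!: pairE\<close>)
qed

text \<open>\<open>mid_last\<close> followed by \<open>tr13\<close> is a first projection, and
  reindexing along the isomorphism \<open>mid_last\<close> preserves and reflects the order. Hence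
  the adjunction for the projection transposes to \<open>tr13\<close>.\<close>

lemma left_adjoint_tr13:
  assumes [simp]: "X \<in> ob" "Y \<in> ob" "Z \<in> ob"
  shows "left_adjoint P (X \<odot> Y \<odot> Z) (X \<odot> Z) (tr13 (base P) X Y Z)
    (\<lambda>\<theta>. exq P ((X \<odot> Z) \<odot> Y) (X \<odot> Z) (pr1 (base P) (X \<odot> Z) Y)
           (re P ((X \<odot> Z) \<odot> Y) (X \<odot> Y \<odot> Z) (mid_last X Y Z) \<theta>))"
  unfolding left_adjoint_iff
proof (intro conjI ballI)
  fix \<theta> \<chi> assume t [simp]: "\<theta> \<in> el (X \<odot> Y \<odot> Z)" "\<chi> \<in> el (X \<odot> Z)"
  let ?k = "re P ((X \<odot> Z) \<odot> Y) (X \<odot> Y \<odot> Z) (mid_last X Y Z)"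
  let ?k' = "re P (X \<odot> Y \<odot> Z) ((X \<odot> Z) \<odot> Y) (mid_last_inv X Y Z)"
  let ?p = "re P ((X \<odot> Z) \<odot> Y) (X \<odot> Z) (pr1 (base P) (X \<odot> Z) Y)"
  let ?t = "re P (X \<odot> Y \<odot> Z) (X \<odot> Z) (tr13 (base P) X Y Z)"
  have "?k \<theta> \<sqsubseteq>[(X \<odot> Z) \<odot> Y] ?p \<chi> \<longleftrightarrow> \<theta> \<sqsubseteq>[X \<odot> Y \<odot> Z] ?t \<chi>"
  proof
    assume "?k \<theta> \<sqsubseteq>[(X \<odot> Z) \<odot> Y] ?p \<chi>"
    then have "?k' (?k \<theta>) \<sqsubseteq>[X \<odot> Y \<odot> Z] ?k' (?p \<chi>)"
      by (intro re_mono) auto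
    then show "\<theta> \<sqsubseteq>[X \<odot> Y \<odot> Z] ?t \<chi>" by simp
  next
    assume "\<theta> \<sqsubseteq>[X \<odot> Y \<odot> Z] ?t \<chi>"
    then have "?k \<theta> \<sqsubseteq>[(X \<odot> Z) \<odot> Y] ?k (?t \<chi>)"
      by (intro re_mono) auto
    then show "?k \<theta> \<sqsubseteq>[(X \<odot> Z) \<odot> Y] ?p \<chi>" by simp
  qed
  then show "exq P ((X \<odot> Z) \<odot> Y) (X \<odot> Z) (pr1 (base P) (X \<odot> Z) Y) (?k \<theta>) \<sqsubseteq>[X \<odot> Z] \<chi>
    \<longleftrightarrow> \<theta> \<sqsubseteq>[X \<odot> Y \<odot> Z] ?t \<chi>"
    by (simp add: exq_pr1_le_iff)
qed (auto simp: fib_partial_order)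

text \<open>Replaces the quantifier in \<open>rel_comp\<close> by one along a genuine projection,
  where Beck-Chevalley, Frobenius and preservation by morphisms of doctrines are available.\<close>

lemma exq_tr13:
  assumes "X \<in> ob" "Y \<in> ob" "Z \<in> ob" "\<theta> \<in> el (X \<odot> Y \<odot> Z)"
  shows "exq P (X \<odot> Y \<odot> Z) (X \<odot> Z) (tr13 (base P) X Y Z) \<theta>
    = exq P ((X \<odot> Z) \<odot> Y) (X \<odot> Z) (pr1 (base P) (X \<odot> Z) Y)
        (re P ((X \<odot> Z) \<odot> Y) (X \<odot> Y \<odot> Z) (mid_last X Y Z) \<theta>)"
  using assms by (intro left_adjoint_exq[OF left_adjoint_tr13]) auto

lemma exq_tr13_in [simp]:
  "\<lbrakk>X \<in> ob; Y \<in> ob; Z \<in> ob; \<theta> \<in> el (X \<odot> Y \<odot> Z)\<rbrakk>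
    \<Longrightarrow> exq P (X \<odot> Y \<odot> Z) (X \<odot> Z) (tr13 (base P) X Y Z) \<theta> \<in> el (X \<odot> Z)"
  by (simp add: exq_tr13)

lemma exq_tr13_unit:
  assumes "X \<in> ob" "Y \<in> ob" "Z \<in> ob" "\<theta> \<in> el (X \<odot> Y \<odot> Z)"
  shows "\<theta> \<sqsubseteq>[X \<odot> Y \<odot> Z] re P (X \<odot> Y \<odot> Z) (X \<odot> Z) (tr13 (base P) X Y Z)
     (exq P (X \<odot> Y \<odot> Z) (X \<odot> Z) (tr13 (base P) X Y Z) \<theta>)"
  using left_adjoint_tr13[OF assms(1-3)] assms exq_tr13[OF assms] exq_tr13_in[OF assms]
  unfolding left_adjoint_iff by (metis leq_refl prd_in)

text \<open>The square of substituting \<open>h\<close> for the parameters while leaving the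
  quantified variable alone. Through it, Beck-Chevalley lets \<exists> commute with evaluation at a
  generalized element.\<close>

lemma pullback_pr1:
  assumes "X \<in> ob" "Y \<in> ob" "Z \<in> ob" "h \<in> mor Z X"
  shows "is_pullback (base P) (Z \<odot> Y) (X \<odot> Y) Z X
    (prdmor (base P) Z X Y Y h (ide (base P) Y)) (pr1 (base P) Z Y) (pr1 (base P) X Y) h"
  unfolding is_pullback_def
proof (intro conjI ballI impI)
  show "cmp (base P) (Z \<odot> Y) (X \<odot> Y) X (prdmor (base P) Z X Y Y h (ide (base P) Y)) (pr1 (base P) X Y)
      = cmp (base P) (Z \<odot> Y) Z X (pr1 (base P) Z Y) h"
    using assms by (simp add: prdmor_def)
next
  fix W u k
  assume "W \<in> ob" "u \<in> mor W (X \<odot> Y)" "k \<in> mor W Z"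
    and eq: "cmp (base P) W (X \<odot> Y) X u (pr1 (base P) X Y) = cmp (base P) W Z X k h"
  then show "\<exists>!v. v \<in> mor W (Z \<odot> Y) \<and>
      cmp (base P) W (Z \<odot> Y) (X \<odot> Y) v (prdmor (base P) Z X Y Y h (ide (base P) Y)) = u \<and>
      cmp (base P) W (Z \<odot> Y) Z v (pr1 (base P) Z Y) = k"
    using assms
    by (intro ex1I[of _ "pair (base P) W Z Y k (cmp (base P) W (X \<odot> Y) Y u (pr2 (base P) X Y))"])
      (auto elim!: pairE simp: pair_eq_iff)
qed (use assms in auto)

lemma rel_comp_in [simp]:
  assumes "X \<in> ob" "Y \<in> ob" "Z \<in> ob" "r \<in> el (X \<odot> Y)" "s \<in> el (Y \<odot> Z)"
  shows "rel_comp P X Y Z r s \<in> el (X \<odot> Z)"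
  using assms by (simp add: rel_comp_def Let_def)

lemma rel_tensor_in [simp]:
  assumes "X \<in> ob" "Y \<in> ob" "X' \<in> ob" "Y' \<in> ob" "r \<in> el (X \<odot> Y)" "s \<in> el (X' \<odot> Y')"
  shows "rel_tensor P X Y X' Y' r s \<in> el ((X \<odot> X') \<odot> (Y \<odot> Y'))"
  using assms by (simp add: rel_tensor_def Let_def)

lemma graph_in [simp]:
  assumes "X \<in> ob" "Y \<in> ob" "h \<in> mor X Y"
  shows "graph P X Y h \<in> el (X \<odot> Y)"
  using assms by (simp add: graph_def)

text \<open>
  The internal language: \<open>forces Z \<phi> X Y r x y\<close> means that the formula \<open>r(x, y)\<close> in the context \<open>Z\<close>
  is entailed by \<open>\<phi>\<close>. A cover \<open>s : (W, \<psi>) \<rightarrow> (Z, \<phi>)\<close> is a context extension by existential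
  witnesses: what holds after restriction along \<open>s\<close> holds already before.
\<close>

definition forces :: "'o \<Rightarrow> 'p \<Rightarrow> 'o \<Rightarrow> 'o \<Rightarrow> 'p \<Rightarrow> 'm \<Rightarrow> 'm \<Rightarrow> bool" where
  "forces Z \<phi> X Y r x y \<longleftrightarrow>
     Z \<in> ob \<and> X \<in> ob \<and> Y \<in> ob \<and> \<phi> \<in> el Z \<and> r \<in> el (X \<odot> Y) \<and> x \<in> mor Z X \<and> y \<in> mor Z Y \<and>
     \<phi> \<sqsubseteq>[Z] re P Z (X \<odot> Y) (pair (base P) Z X Y x y) r"

definition covers :: "'o \<Rightarrow> 'p \<Rightarrow> 'm \<Rightarrow> 'o \<Rightarrow> 'p \<Rightarrow> bool" where
  "covers W \<psi> s Z \<phi> \<longleftrightarrow>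
     W \<in> ob \<and> Z \<in> ob \<and> \<psi> \<in> el W \<and> \<phi> \<in> el Z \<and> s \<in> mor W Z \<and> \<psi> \<sqsubseteq>[W] re P W Z s \<phi> \<and>
     (\<forall>\<chi>\<in>el Z. \<psi> \<sqsubseteq>[W] re P W Z s \<chi> \<longrightarrow> \<phi> \<sqsubseteq>[Z] \<chi>)"

lemma forcesD:
  assumes "forces Z \<phi> X Y r x y"
  shows "Z \<in> ob" "X \<in> ob" "Y \<in> ob" "\<phi> \<in> el Z" "r \<in> el (X \<odot> Y)" "x \<in> mor Z X" "y \<in> mor Z Y"
  using assms by (simp_all add: forces_def)

text \<open>Stability under context extension, from the half of \<open>covers\<close> saying that
  \<psi> lies over \<phi>.\<close>

lemma forces_restrict:
  assumes "forces Z \<phi> X Y r x y" "covers W \<psi> s Z \<phi>"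
  shows "forces W \<psi> X Y r (cmp (base P) W Z X s x) (cmp (base P) W Z Y s y)"
proof -
  have "re P W Z s \<phi> \<sqsubseteq>[W] re P W Z s (re P Z (X \<odot> Y) (pair (base P) Z X Y x y) r)"
    using assms by (intro re_mono) (auto simp: forces_def covers_def)
  then have "\<psi> \<sqsubseteq>[W] re P W Z s (re P Z (X \<odot> Y) (pair (base P) Z X Y x y) r)"
    using assms by (elim leq_trans[rotated]) (auto simp: forces_def covers_def)
  then show ?thesis
    using assms by (auto simp: forces_def covers_def)
qed

text \<open>The other half of \<open>covers\<close>, applied with \<chi> the interpretation of the
  formula at \<open>x\<close> and \<open>y\<close>: this discharges an existential witness.\<close>

lemma forces_local:
  assumes "covers W \<psi> s Z \<phi>" "x \<in> mor Z X" "y \<in> mor Z Y"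
    "forces W \<psi> X Y r (cmp (base P) W Z X s x) (cmp (base P) W Z Y s y)"
  shows "forces Z \<phi> X Y r x y"
  using assms by (auto simp: forces_def covers_def)

text \<open>The generic instance suffices: over \<open>X \<odot> Y\<close> with hypothesis
  \<open>r\<close>, the two projections pair to the identity, so \<open>r\<close> is forced by
  reflexivity and forcing \<open>s\<close> is the desired inequality.\<close>

lemma rel_leqI:
  assumes "X \<in> ob" "Y \<in> ob" "r \<in> el (X \<odot> Y)" "s \<in> el (X \<odot> Y)"
    and "\<And>Z \<phi> x y. \<lbrakk>Z \<in> ob; \<phi> \<in> el Z; x \<in> mor Z X; y \<in> mor Z Y; forces Z \<phi> X Y r x y\<rbrakk>
      \<Longrightarrow> forces Z \<phi> X Y s x y"
  shows "r \<sqsubseteq>[X \<odot> Y] s"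
  using assms(5)[of "X \<odot> Y" r "pr1 (base P) X Y" "pr2 (base P) X Y"] assms(1-4)
  by (simp add: forces_def)

lemma rel_eqI:
  assumes "X \<in> ob" "Y \<in> ob" "r \<in> el (X \<odot> Y)" "s \<in> el (X \<odot> Y)"
    and "\<And>Z \<phi> x y. \<lbrakk>Z \<in> ob; \<phi> \<in> el Z; x \<in> mor Z X; y \<in> mor Z Y\<rbrakk>
      \<Longrightarrow> forces Z \<phi> X Y r x y \<longleftrightarrow> forces Z \<phi> X Y s x y"
  shows "r = s"
  using assms by (intro leq_antisym[of "X \<odot> Y" r s] rel_leqI) auto

lemma forces_mono:
  assumes "forces Z \<phi> X Y r x y" "r \<sqsubseteq>[X \<odot> Y] s" "s \<in> el (X \<odot> Y)"
  shows "forces Z \<phi> X Y s x y"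
  using assms re_mono[of Z "X \<odot> Y" "pair (base P) Z X Y x y" r s]
    leq_trans[of Z \<phi> "re P Z (X \<odot> Y) (pair (base P) Z X Y x y) r" "re P Z (X \<odot> Y) (pair (base P) Z X Y x y) s"]
  by (auto simp: forces_def)

text \<open>Existential introduction: the unit of \<exists> along \<open>tr13\<close>, pulled back
  along the triple of \<open>x\<close>, \<open>y\<close> and \<open>z\<close>.\<close>

lemma forces_compI:
  assumes "forces W \<psi> X Y r x y" "forces W \<psi> Y Z s y z"
  shows "forces W \<psi> X Z (rel_comp P X Y Z r s) x z"
proof -
  note t [simp] = forcesD[OF assms(1)] forcesD[OF assms(2)]
  let ?u = "pair (base P) W X (Y \<odot> Z) x (pair (base P) W Y Z y z)"
  let ?\<theta> = "re P (X \<odot> Y \<odot> Z) (X \<odot> Y) (tr12 (base P) X Y Z) r \<sqinter>[X \<odot> Y \<odot> Z]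
            re P (X \<odot> Y \<odot> Z) (Y \<odot> Z) (tr23 (base P) X Y Z) s"
  let ?q = "rel_comp P X Y Z r s"
  have \<theta>: "?\<theta> \<in> el (X \<odot> Y \<odot> Z)"
    by simp
  have "?\<theta> \<sqsubseteq>[X \<odot> Y \<odot> Z] re P (X \<odot> Y \<odot> Z) (X \<odot> Z) (tr13 (base P) X Y Z) ?q"
    using exq_tr13_unit[OF t(2,3) t(10) \<theta>] unfolding rel_comp_def Let_def .
  then have "re P W (X \<odot> Y \<odot> Z) ?u ?\<theta> \<sqsubseteq>[W]
      re P W (X \<odot> Y \<odot> Z) ?u (re P (X \<odot> Y \<odot> Z) (X \<odot> Z) (tr13 (base P) X Y Z) ?q)"
    by (rule re_mono[rotated 5]) simp_all
  then have "re P W (X \<odot> Y) (pair (base P) W X Y x y) r \<sqinter>[W]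
      re P W (Y \<odot> Z) (pair (base P) W Y Z y z) s
    \<sqsubseteq>[W] re P W (X \<odot> Z) (pair (base P) W X Z x z) ?q"
    by simp
  then have "\<psi> \<sqsubseteq>[W] re P W (X \<odot> Z) (pair (base P) W X Z x z) ?q"
    using assms by (elim leq_trans[rotated]) (auto simp: forces_def leq_mt_iff)
  then show ?thesis
    by (simp add: forces_def)
qed

text \<open>Existential elimination. No actual witness is extracted; the context is enlarged by a
  free variable, and the hypothesis is enlarged by the claim that this variable is a
  witness.\<close>

lemma forces_compE:
  assumes "forces V \<phi> X Z (rel_comp P X Y Z r s) x z"
    and "Y \<in> ob" "r \<in> el (X \<odot> Y)" "s \<in> el (Y \<odot> Z)"
  obtains W \<psi> p y where "covers W \<psi> p V \<phi>" "W \<in> ob" "\<psi> \<in> el W" "p \<in> mor W V" "y \<in> mor W Y"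
    "forces W \<psi> X Y r (cmp (base P) W V X p x) y"
    "forces W \<psi> Y Z s y (cmp (base P) W V Z p z)"
proof -
  note t [simp] = forcesD[OF assms(1)] assms(2-4)
  \<comment> \<open>\<open>y\<close> is the fresh variable of sort \<open>Y\<close>. Below, \<rho>
    says that it links \<open>x\<close> to \<open>z\<close>, and \<psi> adds the old hypothesis
    \<phi>.\<close>
  define W p y where "W = V \<odot> Y" and "p = pr1 (base P) V Y" and "y = pr2 (base P) V Y"
  have w [simp]: "W \<in> ob" "p \<in> mor W V" "y \<in> mor W Y"
    by (simp_all add: W_def p_def y_def)
  let ?h = "pair (base P) V X Z x z"
  let ?f = "prdmor (base P) V (X \<odot> Z) Y Y ?h (ide (base P) Y)"
  let ?\<theta> = "re P (X \<odot> Y \<odot> Z) (X \<odot> Y) (tr12 (base P) X Y Z) r \<sqinter>[X \<odot> Y \<odot> Z]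
            re P (X \<odot> Y \<odot> Z) (Y \<odot> Z) (tr23 (base P) X Y Z) s"
  let ?\<theta>' = "re P ((X \<odot> Z) \<odot> Y) (X \<odot> Y \<odot> Z) (mid_last X Y Z) ?\<theta>"
  let ?x = "cmp (base P) W V X p x" and ?z = "cmp (base P) W V Z p z"
  define \<rho> where "\<rho> = re P W (X \<odot> Y) (pair (base P) W X Y ?x y) r \<sqinter>[W]
      re P W (Y \<odot> Z) (pair (base P) W Y Z y ?z) s"
  define \<psi> where "\<psi> = re P W V p \<phi> \<sqinter>[W] \<rho>"
  have \<rho> [simp]: "\<rho> \<in> el W" and \<psi> [simp]: "\<psi> \<in> el W"
    by (simp_all add: \<rho>_def \<psi>_def)
  have f: "?f = pair (base P) W (X \<odot> Z) Y (pair (base P) W X Z ?x ?z) y"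
    by (simp add: prdmor_def W_def p_def y_def)
  have "re P W ((X \<odot> Z) \<odot> Y) ?f ?\<theta>' = \<rho>"
    unfolding f \<rho>_def by simp
  \<comment> \<open>Beck-Chevalley: the composite evaluated at \<open>x\<close> and \<open>z\<close>
    becomes a quantifier over the fresh variable in the context \<open>V\<close>.\<close>
  moreover have "re P V (X \<odot> Z) ?h (rel_comp P X Y Z r s)
      = exq P W V p (re P W ((X \<odot> Z) \<odot> Y) ?f ?\<theta>')"
    unfolding W_def p_def
    by (subst beck_chevalley[OF _ pullback_pr1]) (auto simp: rel_comp_def Let_def exq_tr13)
  ultimately have le: "\<phi> \<sqsubseteq>[V] exq P W V p \<rho>"
    using assms(1) by (simp add: forces_def)
  \<comment> \<open>Frobenius moves \<phi> out of the quantifier. Since \<phi> already entails the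
    remaining existential, it lies below the image of \<psi>, which is the covering
    condition.\<close>
  have ex: "exq P W V p \<psi> = \<phi> \<sqinter>[V] exq P W V p \<rho>"
    unfolding \<psi>_def W_def p_def using \<rho> by (intro frobenius) (auto simp: W_def)
  have "covers W \<psi> p V \<phi>"
    unfolding covers_def
  proof (intro conjI ballI impI)
    show "\<psi> \<sqsubseteq>[W] re P W V p \<phi>"
      by (simp add: \<psi>_def)
    fix \<chi> assume \<chi>: "\<chi> \<in> el V" "\<psi> \<sqsubseteq>[W] re P W V p \<chi>"
    have in': "exq P W V p \<psi> \<in> el V" "exq P W V p \<rho> \<in> el V"
      using \<psi> \<rho> unfolding W_def p_def by (simp_all del: \<psi> \<rho>)
    have "exq P W V p \<psi> \<sqsubseteq>[V] \<chi>"
      using \<chi> \<psi> unfolding W_def p_def by (simp add: exq_pr1_le_iff del: \<psi>)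
    moreover have "\<phi> \<sqsubseteq>[V] exq P W V p \<psi>"
      using le in' by (simp add: ex leq_mt_iff)
    ultimately show "\<phi> \<sqsubseteq>[V] \<chi>"
      using \<chi> in' by (auto elim: leq_trans)
  qed simp_all
  moreover have "\<psi> \<sqsubseteq>[W] \<rho>"
    unfolding \<psi>_def by simp
  then have "\<psi> \<sqsubseteq>[W] re P W (X \<odot> Y) (pair (base P) W X Y ?x y) r"
      "\<psi> \<sqsubseteq>[W] re P W (Y \<odot> Z) (pair (base P) W Y Z y ?z) s"
    by (simp_all add: \<rho>_def leq_mt_iff)
  ultimately show thesis
    by (intro that[of W \<psi> p y]) (auto simp: forces_def)
qed

end

section \<open>Equality and graphs\<close>

context elementary_existential_doctrine
begin

abbreviation eqv where "eqv Z \<phi> A x y \<equiv> forces Z \<phi> A A (dlt P A) x y"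

section \<open>Equality as a congruence\<close>

lemma elementary_iff:
  assumes "X \<in> ob" "A \<in> ob" "\<alpha> \<in> el (X \<odot> A)" "\<beta> \<in> el (X \<odot> A \<odot> A)"
  shows "re P (X \<odot> A \<odot> A) (X \<odot> A) (tr12 (base P) X A A) \<alpha> \<sqinter>[X \<odot> A \<odot> A]
      re P (X \<odot> A \<odot> A) (A \<odot> A) (tr23 (base P) X A A) (dlt P A) \<sqsubseteq>[X \<odot> A \<odot> A] \<beta>
    \<longleftrightarrow> \<alpha> \<sqsubseteq>[X \<odot> A] re P (X \<odot> A) (X \<odot> A \<odot> A)
      (prdmor (base P) X X A (A \<odot> A) (ide (base P) X) (diag (base P) A)) \<beta>"
  using elementary[OF assms(1,2)] assms(3,4) unfolding left_adjoint_iff by blast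

text \<open>Transpose the trivial inequality \<alpha> \<le> \<alpha>: with \<beta> the reindexing of
  \<alpha> along \<open>tr13\<close>, restricting \<beta> along \<open>id \<times> \<Delta>\<close>
  returns \<alpha>, and the adjunction yields substitution of equals at the generic triple.\<close>

lemma leibniz:
  assumes [simp]: "X \<in> ob" "A \<in> ob" "Z \<in> ob" "\<alpha> \<in> el (X \<odot> A)"
    "h \<in> mor Z X" "f \<in> mor Z A" "g \<in> mor Z A"
  shows "re P Z (X \<odot> A) (pair (base P) Z X A h f) \<alpha> \<sqinter>[Z]
      re P Z (A \<odot> A) (pair (base P) Z A A f g) (dlt P A)
    \<sqsubseteq>[Z] re P Z (X \<odot> A) (pair (base P) Z X A h g) \<alpha>"
proof -
  let ?e = "prdmor (base P) X X A (A \<odot> A) (ide (base P) X) (diag (base P) A)"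
  let ?l = "re P (X \<odot> A \<odot> A) (X \<odot> A) (tr12 (base P) X A A) \<alpha> \<sqinter>[X \<odot> A \<odot> A]
     re P (X \<odot> A \<odot> A) (A \<odot> A) (tr23 (base P) X A A) (dlt P A)"
  let ?r = "re P (X \<odot> A \<odot> A) (X \<odot> A) (tr13 (base P) X A A) \<alpha>"
  let ?u = "pair (base P) Z X (A \<odot> A) h (pair (base P) Z A A f g)"
  have "cmp (base P) (X \<odot> A) (X \<odot> A \<odot> A) (X \<odot> A) ?e (tr13 (base P) X A A) = ide (base P) (X \<odot> A)"
    by (rule mor_eqI[of "X \<odot> A" "X \<odot> A"]) (auto elim!: pairE)
  then have "\<alpha> \<sqsubseteq>[X \<odot> A] re P (X \<odot> A) (X \<odot> A \<odot> A) ?e ?r"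
    by simp
  then have "?l \<sqsubseteq>[X \<odot> A \<odot> A] ?r"
    by (subst elementary_iff) auto
  then have "re P Z (X \<odot> A \<odot> A) ?u ?l \<sqsubseteq>[Z] re P Z (X \<odot> A \<odot> A) ?u ?r"
    by (rule re_mono[rotated 5]) auto
  then show ?thesis
    by simp
qed

text \<open>Read the adjunction in the opposite direction, with \<alpha> the top element and \<beta>
  the equality of the last two variables. The parameter object is taken to be \<open>A\<close>, with
  \<open>f\<close> as its element.\<close>

lemma eqv_refl:
  assumes [simp]: "A \<in> ob" "Z \<in> ob" "\<phi> \<in> el Z" "f \<in> mor Z A"
  shows "eqv Z \<phi> A f f"
proof -
  let ?e = "prdmor (base P) A A A (A \<odot> A) (ide (base P) A) (diag (base P) A)"
  let ?l = "re P (A \<odot> A \<odot> A) (A \<odot> A) (tr12 (base P) A A A) (tp (A \<odot> A)) \<sqinter>[A \<odot> A \<odot> A]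
     re P (A \<odot> A \<odot> A) (A \<odot> A) (tr23 (base P) A A A) (dlt P A)"
  let ?r = "re P (A \<odot> A \<odot> A) (A \<odot> A) (tr23 (base P) A A A) (dlt P A)"
  let ?u = "pair (base P) Z A A f f"
  have "cmp (base P) Z (A \<odot> A) (A \<odot> A \<odot> A) ?u ?e
      = pair (base P) Z A (A \<odot> A) f (pair (base P) Z A A f f)"
    by simp
  then have u: "cmp (base P) Z (A \<odot> A) (A \<odot> A)
      ?u (cmp (base P) (A \<odot> A) (A \<odot> A \<odot> A) (A \<odot> A) ?e (tr23 (base P) A A A))
      = pair (base P) Z A A f f"
    by simp
  have "?l \<sqsubseteq>[A \<odot> A \<odot> A] ?r"
    by (rule mt_right) auto
  then have "tp (A \<odot> A) \<sqsubseteq>[A \<odot> A] re P (A \<odot> A) (A \<odot> A \<odot> A) ?e ?r"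
    by (subst (asm) elementary_iff) auto
  then have "re P Z (A \<odot> A) ?u (tp (A \<odot> A)) \<sqsubseteq>[Z]
      re P Z (A \<odot> A) ?u (re P (A \<odot> A) (A \<odot> A \<odot> A) ?e ?r)"
    by (rule re_mono[rotated 5]) auto
  then have "tp Z \<sqsubseteq>[Z] re P Z (A \<odot> A) ?u (dlt P A)"
    using u by simp
  then have "\<phi> \<sqsubseteq>[Z] re P Z (A \<odot> A) ?u (dlt P A)"
    by (rule leq_trans[rotated]) auto
  then show ?thesis
    by (simp add: forces_def)
qed

lemma forces_subst_right:
  assumes "forces Z \<phi> X A r h f" "eqv Z \<phi> A f g"
  shows "forces Z \<phi> X A r h g"
proof -
  note t [simp] = forcesD[OF assms(1)] forcesD[OF assms(2)]
  have "\<phi> \<sqsubseteq>[Z] re P Z (X \<odot> A) (pair (base P) Z X A h f) r \<sqinter>[Z]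
      re P Z (A \<odot> A) (pair (base P) Z A A f g) (dlt P A)"
    using assms by (simp add: forces_def leq_mt_iff)
  then have "\<phi> \<sqsubseteq>[Z] re P Z (X \<odot> A) (pair (base P) Z X A h g) r"
    by (rule leq_trans[OF _ leibniz]) auto
  then show ?thesis
    by (simp add: forces_def)
qed

lemma forces_re_prdmor:
  assumes "X \<in> ob" "Y \<in> ob" "X' \<in> ob" "Y' \<in> ob" "f \<in> mor X X'" "g \<in> mor Y Y'"
    "r \<in> el (X' \<odot> Y')" "x \<in> mor Z X" "y \<in> mor Z Y" "Z \<in> ob"
  shows "forces Z \<phi> X Y (re P (X \<odot> Y) (X' \<odot> Y') (prdmor (base P) X X' Y Y' f g) r) x y
    \<longleftrightarrow> forces Z \<phi> X' Y' r (cmp (base P) Z X X' x f) (cmp (base P) Z Y Y' y g)"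
  using assms by (simp add: forces_def)

text \<open>Reading a relation backwards reduces substitution in the first argument to substitution
  in the second.\<close>

lemma forces_converse:
  assumes "X \<in> ob" "Y \<in> ob" "r \<in> el (X \<odot> Y)" "x \<in> mor Z X" "y \<in> mor Z Y" "Z \<in> ob"
  shows "forces Z \<phi> Y X (re P (Y \<odot> X) (X \<odot> Y) (cbraid (base P) Y X) r) y x
    \<longleftrightarrow> forces Z \<phi> X Y r x y"
  using assms by (auto simp add: forces_def)

text \<open>Substitute \<open>g\<close> for the second \<open>f\<close> in the converse of equality
  at \<open>f\<close> and \<open>f\<close>.\<close>

lemma eqv_sym:
  assumes "eqv Z \<phi> A f g"
  shows "eqv Z \<phi> A g f"
proof -
  note t [simp] = forcesD[OF assms]
  have "forces Z \<phi> A A (re P (A \<odot> A) (A \<odot> A) (cbraid (base P) A A) (dlt P A)) f f"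
    by (simp add: forces_converse eqv_refl)
  then have "forces Z \<phi> A A (re P (A \<odot> A) (A \<odot> A) (cbraid (base P) A A) (dlt P A)) f g"
    using assms by (rule forces_subst_right)
  then show ?thesis
    by (simp add: forces_converse)
qed

lemma forces_subst_left:
  assumes "forces Z \<phi> A X r f h" "eqv Z \<phi> A f g"
  shows "forces Z \<phi> A X r g h"
proof -
  note t [simp] = forcesD[OF assms(1)] forcesD[OF assms(2)]
  have "forces Z \<phi> X A (re P (X \<odot> A) (A \<odot> X) (cbraid (base P) X A) r) h f"
    using assms(1) by (simp add: forces_converse)
  then have "forces Z \<phi> X A (re P (X \<odot> A) (A \<odot> X) (cbraid (base P) X A) r) h g"
    using assms(2) by (rule forces_subst_right)
  then show ?thesis
    by (simp add: forces_converse)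
qed

text \<open>Substitution in the second argument of the predicate that compares two elements after
  applying \<open>h\<close>, starting from reflexivity.\<close>

lemma eqv_cmp:
  assumes "eqv Z \<phi> A f g" "h \<in> mor A B" "B \<in> ob"
  shows "eqv Z \<phi> B (cmp (base P) Z A B f h) (cmp (base P) Z A B g h)"
proof -
  note t [simp] = forcesD[OF assms(1)] assms(2,3)
  have "forces Z \<phi> A A (re P (A \<odot> A) (B \<odot> B) (prdmor (base P) A B A B h h) (dlt P B)) f f"
    by (simp add: forces_re_prdmor eqv_refl)
  then have "forces Z \<phi> A A (re P (A \<odot> A) (B \<odot> B) (prdmor (base P) A B A B h h) (dlt P B)) f g"
    using assms(1) by (rule forces_subst_right)
  then show ?thesis
    by (simp add: forces_re_prdmor)
qed

text \<open>The component \<open>b\<close> lives in the context \<open>Z\<close> and cannot be part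
  of a relation on \<open>X\<close> alone. Hence \<open>Z\<close> itself becomes the parameter
  object, with the identity as its element: \<open>?r\<close> relates \<open>z\<close> and
  \<open>x\<close> when the pair of \<open>a\<close> and \<open>b\<close> at \<open>z\<close> equals
  the pair of \<open>x\<close> and \<open>b\<close> at \<open>z\<close>, and \<open>c\<close> is
  substituted for \<open>x\<close>.\<close>

lemma eqv_pair_left:
  assumes "eqv Z \<phi> X a c" "b \<in> mor Z Y" "Y \<in> ob"
  shows "eqv Z \<phi> (X \<odot> Y) (pair (base P) Z X Y a b) (pair (base P) Z X Y c b)"
proof -
  note t [simp] = forcesD[OF assms(1)] assms(2,3)
  let ?p = "pr1 (base P) Z X"
  let ?u = "pair (base P) (Z \<odot> X) (X \<odot> Y) (X \<odot> Y)
    (cmp (base P) (Z \<odot> X) Z (X \<odot> Y) ?p (pair (base P) Z X Y a b))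
    (pair (base P) (Z \<odot> X) X Y (pr2 (base P) Z X) (cmp (base P) (Z \<odot> X) Z Y ?p b))"
  let ?r = "re P (Z \<odot> X) ((X \<odot> Y) \<odot> (X \<odot> Y)) ?u (dlt P (X \<odot> Y))"
  have *: "forces Z \<phi> Z X ?r (ide (base P) Z) x
      \<longleftrightarrow> eqv Z \<phi> (X \<odot> Y) (pair (base P) Z X Y a b) (pair (base P) Z X Y x b)"
    if "x \<in> mor Z X" for x
    using that by (simp add: forces_def)
  have "forces Z \<phi> Z X ?r (ide (base P) Z) a"
    by (simp only: * t) (simp add: eqv_refl)
  then have "forces Z \<phi> Z X ?r (ide (base P) Z) c"
    using assms(1) by (rule forces_subst_right)
  then show ?thesis
    by (simp only: * t)
qed

lemma eqv_pair_right:
  assumes "eqv Z \<phi> Y b d" "a \<in> mor Z X" "X \<in> ob"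
  shows "eqv Z \<phi> (X \<odot> Y) (pair (base P) Z X Y a b) (pair (base P) Z X Y a d)"
  using eqv_cmp[OF eqv_pair_left[OF assms], of "cbraid (base P) Y X" "X \<odot> Y"]
    forcesD[OF assms(1)] assms(2,3) by simp

lemma eqv_trans:
  assumes "eqv Z \<phi> A f g" "eqv Z \<phi> A g h"
  shows "eqv Z \<phi> A f h"
  using assms by (rule forces_subst_right)

lemma eqv_pair_iff [simp]:
  assumes "X \<in> ob" "Y \<in> ob" "Z \<in> ob" "a \<in> mor Z X" "b \<in> mor Z Y" "c \<in> mor Z X" "d \<in> mor Z Y"
  shows "eqv Z \<phi> (X \<odot> Y) (pair (base P) Z X Y a b) (pair (base P) Z X Y c d)
    \<longleftrightarrow> eqv Z \<phi> X a c \<and> eqv Z \<phi> Y b d"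
proof
  assume *: "eqv Z \<phi> (X \<odot> Y) (pair (base P) Z X Y a b) (pair (base P) Z X Y c d)"
  from eqv_cmp[OF *, of "pr1 (base P) X Y" X] eqv_cmp[OF *, of "pr2 (base P) X Y" Y] assms
  show "eqv Z \<phi> X a c \<and> eqv Z \<phi> Y b d" by simp
next
  assume "eqv Z \<phi> X a c \<and> eqv Z \<phi> Y b d"
  then show "eqv Z \<phi> (X \<odot> Y) (pair (base P) Z X Y a b) (pair (base P) Z X Y c d)"
    using assms eqv_trans[OF eqv_pair_left eqv_pair_right] by blast
qed

section \<open>Element-wise description of tensors, graphs and converse graphs\<close>

lemma forces_tensor [simp]:
  assumes "X \<in> ob" "Y \<in> ob" "X' \<in> ob" "Y' \<in> ob" "r \<in> el (X \<odot> Y)" "s \<in> el (X' \<odot> Y')" "Z \<in> ob"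
    "a \<in> mor Z X" "b \<in> mor Z X'" "c \<in> mor Z Y" "d \<in> mor Z Y'"
  shows "forces Z \<phi> (X \<odot> X') (Y \<odot> Y') (rel_tensor P X Y X' Y' r s)
      (pair (base P) Z X X' a b) (pair (base P) Z Y Y' c d)
    \<longleftrightarrow> forces Z \<phi> X Y r a c \<and> forces Z \<phi> X' Y' s b d"
  using assms rel_tensor_in[OF assms(1-6)]
  by (auto simp: forces_def rel_tensor_def Let_def leq_mt_iff)

lemma forces_graph [simp]:
  assumes "X \<in> ob" "Y \<in> ob" "Z \<in> ob" "h \<in> mor X Y" "x \<in> mor Z X" "y \<in> mor Z Y"
  shows "forces Z \<phi> X Y (graph P X Y h) x y \<longleftrightarrow> eqv Z \<phi> Y (cmp (base P) Z X Y x h) y"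
  using assms by (simp add: graph_def forces_re_prdmor)

text \<open>The graph of \<open>h\<close> read backwards, as equality with the image under
  \<open>h\<close>. It turns out to be the right adjoint of the graph, hence the explicit form of
  the starred morphisms.\<close>

definition cograph :: "'o \<Rightarrow> 'o \<Rightarrow> 'm \<Rightarrow> 'p" where
  "cograph X Y h =
     re P (Y \<odot> X) (Y \<odot> Y) (prdmor (base P) Y Y X Y (ide (base P) Y) h) (dlt P Y)"

lemma cograph_in [simp]:
  "\<lbrakk>X \<in> ob; Y \<in> ob; h \<in> mor X Y\<rbrakk> \<Longrightarrow> cograph X Y h \<in> el (Y \<odot> X)"
  by (simp add: cograph_def)

lemma forces_cograph [simp]:
  assumes "X \<in> ob" "Y \<in> ob" "Z \<in> ob" "h \<in> mor X Y" "x \<in> mor Z X" "y \<in> mor Z Y"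
  shows "forces Z \<phi> Y X (cograph X Y h) y x \<longleftrightarrow> eqv Z \<phi> Y y (cmp (base P) Z X Y x h)"
  using assms by (simp add: cograph_def forces_re_prdmor)

text \<open>The one-point rule: a witness tied to \<open>x\<close> by a graph equals the image of
  \<open>x\<close>, so the quantifier disappears. Together with its mirror image for
  \<open>cograph\<close> it lets many axioms be settled by rewriting.\<close>

lemma forces_graph_comp [simp]:
  assumes [simp]: "X \<in> ob" "Y \<in> ob" "Z \<in> ob" "V \<in> ob" "h \<in> mor X Y" "r \<in> el (Y \<odot> Z)"
    "x \<in> mor V X" "z \<in> mor V Z"
  shows "forces V \<phi> X Z (rel_comp P X Y Z (graph P X Y h) r) x z
    \<longleftrightarrow> forces V \<phi> Y Z r (cmp (base P) V X Y x h) z"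
proof
  assume "forces V \<phi> X Z (rel_comp P X Y Z (graph P X Y h) r) x z"
  then obtain W \<psi> p y where c: "covers W \<psi> p V \<phi>" and [simp]: "W \<in> ob" "p \<in> mor W V" "y \<in> mor W Y"
    and "forces W \<psi> X Y (graph P X Y h) (cmp (base P) W V X p x) y"
    and r: "forces W \<psi> Y Z r y (cmp (base P) W V Z p z)"
    by (rule forces_compE) auto
  then have "eqv W \<psi> Y (cmp (base P) W X Y (cmp (base P) W V X p x) h) y"
    by simp
  from forces_subst_left[OF r eqv_sym[OF this]]
  show "forces V \<phi> Y Z r (cmp (base P) V X Y x h) z"
    by (intro forces_local[OF c]) auto
next
  assume r: "forces V \<phi> Y Z r (cmp (base P) V X Y x h) z"
  show "forces V \<phi> X Z (rel_comp P X Y Z (graph P X Y h) r) x z"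
    by (rule forces_compI[OF _ r]) (use forcesD[OF r] in \<open>simp add: eqv_refl\<close>)
qed

lemma forces_comp_cograph [simp]:
  assumes [simp]: "X \<in> ob" "Y \<in> ob" "Z \<in> ob" "V \<in> ob" "h \<in> mor Z Y" "r \<in> el (X \<odot> Y)"
    "x \<in> mor V X" "z \<in> mor V Z"
  shows "forces V \<phi> X Z (rel_comp P X Y Z r (cograph Z Y h)) x z
    \<longleftrightarrow> forces V \<phi> X Y r x (cmp (base P) V Z Y z h)"
proof
  assume "forces V \<phi> X Z (rel_comp P X Y Z r (cograph Z Y h)) x z"
  then obtain W \<psi> p y where c: "covers W \<psi> p V \<phi>" and [simp]: "W \<in> ob" "p \<in> mor W V" "y \<in> mor W Y"
    and r: "forces W \<psi> X Y r (cmp (base P) W V X p x) y"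
    and "forces W \<psi> Y Z (cograph Z Y h) y (cmp (base P) W V Z p z)"
    by (rule forces_compE) auto
  then have "eqv W \<psi> Y y (cmp (base P) W Z Y (cmp (base P) W V Z p z) h)"
    by simp
  from forces_subst_right[OF r this]
  show "forces V \<phi> X Y r x (cmp (base P) V Z Y z h)"
    by (intro forces_local[OF c]) auto
next
  assume r: "forces V \<phi> X Y r x (cmp (base P) V Z Y z h)"
  show "forces V \<phi> X Z (rel_comp P X Y Z r (cograph Z Y h)) x z"
    by (rule forces_compI[OF r]) (use forcesD[OF r] in \<open>simp add: eqv_refl\<close>)
qed

text \<open>Applying \<open>k\<close> to one defining equation and \<open>h\<close> to the other
  turns each into the other. Composites are bracketed to the right here so that \<open>h\<close> and
  \<open>k\<close> meet and cancel.\<close>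

lemma graph_eq_cograph:
  assumes "X \<in> ob" "Y \<in> ob" "inverse_mors (base P) X Y h k"
  shows "graph P X Y h = cograph Y X k"
proof (rule rel_eqI[of X Y])
  note t [simp] = assms(1,2) assms(3)[unfolded inverse_mors_def]
  fix Z \<phi> x y assume [simp]: "Z \<in> ob" "\<phi> \<in> el Z" "x \<in> mor Z X" "y \<in> mor Z Y"
  show "forces Z \<phi> X Y (graph P X Y h) x y \<longleftrightarrow> forces Z \<phi> X Y (cograph Y X k) x y"
    using eqv_cmp[of Z \<phi> Y "cmp (base P) Z X Y x h" y k X]
      eqv_cmp[of Z \<phi> X x "cmp (base P) Z Y X y k" h Y]
    by (auto simp: cmp_assoc simp del: cmp_left_assoc)
qed (use assms in \<open>auto simp: inverse_mors_def\<close>)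

section \<open>Category and tensor laws for relations\<close>

lemma graph_ide [simp]: "X \<in> ob \<Longrightarrow> graph P X X (ide (base P) X) = dlt P X"
  by (simp add: graph_def)

lemma cograph_ide: "X \<in> ob \<Longrightarrow> cograph X X (ide (base P) X) = dlt P X"
  by (simp add: cograph_def)

lemma rel_comp_graph [simp]:
  assumes "X \<in> ob" "Y \<in> ob" "Z \<in> ob" "f \<in> mor X Y" "g \<in> mor Y Z"
  shows "rel_comp P X Y Z (graph P X Y f) (graph P Y Z g) = graph P X Z (cmp (base P) X Y Z f g)"
  by (rule rel_eqI[of X Z]) (use assms in auto)

lemma rel_tensor_graph [simp]:
  assumes "X \<in> ob" "Y \<in> ob" "X' \<in> ob" "Y' \<in> ob" "f \<in> mor X Y" "g \<in> mor X' Y'"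
  shows "rel_tensor P X Y X' Y' (graph P X Y f) (graph P X' Y' g)
    = graph P (X \<odot> X') (Y \<odot> Y') (prdmor (base P) X Y X' Y' f g)"
  by (rule rel_eqI[of "X \<odot> X'" "Y \<odot> Y'"]) (use assms in \<open>auto elim!: pairE\<close>)

lemma rel_comp_dlt_left [simp]:
  assumes "X \<in> ob" "Y \<in> ob" "r \<in> el (X \<odot> Y)"
  shows "rel_comp P X X Y (dlt P X) r = r"
  by (rule rel_eqI[of X Y])
    (use assms forces_graph_comp[of X X Y _ "ide (base P) X" r] in auto)

lemma rel_comp_dlt_right [simp]:
  assumes "X \<in> ob" "Y \<in> ob" "r \<in> el (X \<odot> Y)"
  shows "rel_comp P X Y Y r (dlt P Y) = r"
  by (rule rel_eqI[of X Y])
    (use assms forces_comp_cograph[of X Y Y _ "ide (base P) Y" r] in \<open>auto simp: cograph_ide\<close>)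

text \<open>Both sides assert a chain through some \<open>x\<close> and \<open>y\<close>. The second
  witness appears over a further cover, to which the facts found over the first are restricted
  before reassembly.\<close>

lemma rel_comp_assoc:
  assumes [simp]: "W \<in> ob" "X \<in> ob" "Y \<in> ob" "Z \<in> ob"
    "r \<in> el (W \<odot> X)" "s \<in> el (X \<odot> Y)" "t \<in> el (Y \<odot> Z)"
  shows "rel_comp P W Y Z (rel_comp P W X Y r s) t = rel_comp P W X Z r (rel_comp P X Y Z s t)"
proof (rule rel_eqI[of W Z])
  fix V \<phi> w z assume [simp]: "V \<in> ob" "w \<in> mor V W" "z \<in> mor V Z"
  show "forces V \<phi> W Z (rel_comp P W Y Z (rel_comp P W X Y r s) t) w z
    \<longleftrightarrow> forces V \<phi> W Z (rel_comp P W X Z r (rel_comp P X Y Z s t)) w z" (is "?L \<longleftrightarrow> ?R")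
  proof
    assume ?L
    then obtain U \<psi> p y where c: "covers U \<psi> p V \<phi>" and [simp]: "U \<in> ob" "p \<in> mor U V" "y \<in> mor U Y"
      and 1: "forces U \<psi> W Y (rel_comp P W X Y r s) (cmp (base P) U V W p w) y"
      and t: "forces U \<psi> Y Z t y (cmp (base P) U V Z p z)"
      by (rule forces_compE) auto
    from 1 obtain U' \<psi>' p' x where c': "covers U' \<psi>' p' U \<psi>"
      and [simp]: "U' \<in> ob" "p' \<in> mor U' U" "x \<in> mor U' X"
      and r: "forces U' \<psi>' W X r (cmp (base P) U' U W p' (cmp (base P) U V W p w)) x"
      and s: "forces U' \<psi>' X Y s x (cmp (base P) U' U Y p' y)"
      by (rule forces_compE) auto
    note forces_compI[OF r forces_compI[OF s forces_restrict[OF t c']]]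
    from forces_local[OF c' _ _ this] show ?R
      by (intro forces_local[OF c]) auto
  next
    assume ?R
    then obtain U \<psi> p x where c: "covers U \<psi> p V \<phi>" and [simp]: "U \<in> ob" "p \<in> mor U V" "x \<in> mor U X"
      and r: "forces U \<psi> W X r (cmp (base P) U V W p w) x"
      and 1: "forces U \<psi> X Z (rel_comp P X Y Z s t) x (cmp (base P) U V Z p z)"
      by (rule forces_compE) auto
    from 1 obtain U' \<psi>' p' y where c': "covers U' \<psi>' p' U \<psi>"
      and [simp]: "U' \<in> ob" "p' \<in> mor U' U" "y \<in> mor U' Y"
      and s: "forces U' \<psi>' X Y s (cmp (base P) U' U X p' x) y"
      and t: "forces U' \<psi>' Y Z t y (cmp (base P) U' U Z p' (cmp (base P) U V Z p z))"
      by (rule forces_compE) auto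
    note forces_compI[OF forces_compI[OF forces_restrict[OF r c'] s] t]
    from forces_local[OF c' _ _ this] show ?L
      by (intro forces_local[OF c]) auto
  qed
qed auto

text \<open>A witness for the right-hand side is a pair. From left to right the two quantifiers are
  opened one above the other and the first witness is restricted to the upper cover; conversely, one
  witness is split into components over a single cover.\<close>

lemma rel_tensor_comp:
  assumes [simp]: "X \<in> ob" "Y \<in> ob" "Z \<in> ob" "X' \<in> ob" "Y' \<in> ob" "Z' \<in> ob"
    "r \<in> el (X \<odot> Y)" "s \<in> el (Y \<odot> Z)" "r' \<in> el (X' \<odot> Y')" "s' \<in> el (Y' \<odot> Z')"
  shows "rel_tensor P X Z X' Z' (rel_comp P X Y Z r s) (rel_comp P X' Y' Z' r' s')
    = rel_comp P (X \<odot> X') (Y \<odot> Y') (Z \<odot> Z')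
        (rel_tensor P X Y X' Y' r r') (rel_tensor P Y Z Y' Z' s s')"
proof (rule rel_eqI[of "X \<odot> X'" "Z \<odot> Z'"])
  fix V \<phi> u v assume "V \<in> ob" "u \<in> mor V (X \<odot> X')" "v \<in> mor V (Z \<odot> Z')"
  then obtain x x' z z' where [simp]: "x \<in> mor V X" "x' \<in> mor V X'" "z \<in> mor V Z" "z' \<in> mor V Z'"
      "u = pair (base P) V X X' x x'" "v = pair (base P) V Z Z' z z'" "V \<in> ob"
    by (metis assms(1,3,4,6) pairE)
  show "forces V \<phi> (X \<odot> X') (Z \<odot> Z')
      (rel_tensor P X Z X' Z' (rel_comp P X Y Z r s) (rel_comp P X' Y' Z' r' s')) u v
    \<longleftrightarrow> forces V \<phi> (X \<odot> X') (Z \<odot> Z') (rel_comp P (X \<odot> X') (Y \<odot> Y') (Z \<odot> Z')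
        (rel_tensor P X Y X' Y' r r') (rel_tensor P Y Z Y' Z' s s')) u v" (is "?L \<longleftrightarrow> ?R")
  proof
    assume ?L
    then have 1: "forces V \<phi> X Z (rel_comp P X Y Z r s) x z"
      and 2: "forces V \<phi> X' Z' (rel_comp P X' Y' Z' r' s') x' z'"
      by simp_all
    from 1 obtain U \<psi> p y where c: "covers U \<psi> p V \<phi>" and [simp]: "U \<in> ob" "p \<in> mor U V" "y \<in> mor U Y"
      and r: "forces U \<psi> X Y r (cmp (base P) U V X p x) y"
      and s: "forces U \<psi> Y Z s y (cmp (base P) U V Z p z)"
      by (rule forces_compE) auto
    from forces_restrict[OF 2 c] obtain U' \<psi>' p' y' where c': "covers U' \<psi>' p' U \<psi>"
      and [simp]: "U' \<in> ob" "p' \<in> mor U' U" "y' \<in> mor U' Y'"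
      and r': "forces U' \<psi>' X' Y' r' (cmp (base P) U' U X' p' (cmp (base P) U V X' p x')) y'"
      and s': "forces U' \<psi>' Y' Z' s' y' (cmp (base P) U' U Z' p' (cmp (base P) U V Z' p z'))"
      by (rule forces_compE) auto
    let ?q = "cmp (base P) U' U V p' p"
    let ?y = "pair (base P) U' Y Y' (cmp (base P) U' U Y p' y) y'"
    have "forces U' \<psi>' (X \<odot> X') (Z \<odot> Z') (rel_comp P (X \<odot> X') (Y \<odot> Y') (Z \<odot> Z')
        (rel_tensor P X Y X' Y' r r') (rel_tensor P Y Z Y' Z' s s'))
        (cmp (base P) U' V (X \<odot> X') ?q u) (cmp (base P) U' V (Z \<odot> Z') ?q v)"
      using forces_restrict[OF r c'] forces_restrict[OF s c'] r' s'
      by (intro forces_compI[where y = ?y]) auto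
    \<comment> \<open>Restriction along \<open>?q\<close> is rewritten as two successive
      restrictions, because the two covers are discharged separately.\<close>
    then have "forces U' \<psi>' (X \<odot> X') (Z \<odot> Z') (rel_comp P (X \<odot> X') (Y \<odot> Y') (Z \<odot> Z')
        (rel_tensor P X Y X' Y' r r') (rel_tensor P Y Z Y' Z' s s'))
        (cmp (base P) U' U (X \<odot> X') p' (cmp (base P) U V (X \<odot> X') p u))
        (cmp (base P) U' U (Z \<odot> Z') p' (cmp (base P) U V (Z \<odot> Z') p v))"
      by simp
    from forces_local[OF c' _ _ this] show ?R
      by (intro forces_local[OF c]) auto
  next
    assume ?R
    then obtain U \<psi> p y where c: "covers U \<psi> p V \<phi>" and [simp]: "U \<in> ob" "p \<in> mor U V"
      and y: "y \<in> mor U (Y \<odot> Y')"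
      and r: "forces U \<psi> (X \<odot> X') (Y \<odot> Y') (rel_tensor P X Y X' Y' r r') (cmp (base P) U V (X \<odot> X') p u) y"
      and s: "forces U \<psi> (Y \<odot> Y') (Z \<odot> Z') (rel_tensor P Y Z Y' Z' s s') y (cmp (base P) U V (Z \<odot> Z') p v)"
      by (rule forces_compE) auto
    from y obtain a b where [simp]: "a \<in> mor U Y" "b \<in> mor U Y'" "y = pair (base P) U Y Y' a b"
      by (rule pairE) auto
    have "forces U \<psi> X Y r (cmp (base P) U V X p x) a" "forces U \<psi> X' Y' r' (cmp (base P) U V X' p x') b"
      "forces U \<psi> Y Z s a (cmp (base P) U V Z p z)" "forces U \<psi> Y' Z' s' b (cmp (base P) U V Z' p z')"
      using r s by simp_all
    then have "forces U \<psi> X Z (rel_comp P X Y Z r s) (cmp (base P) U V X p x) (cmp (base P) U V Z p z)"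
      "forces U \<psi> X' Z' (rel_comp P X' Y' Z' r' s') (cmp (base P) U V X' p x') (cmp (base P) U V Z' p z')"
      by (blast intro: forces_compI)+
    then show ?L
      by (auto intro: forces_local[OF c])
  qed
qed auto

lemma rel_comp_mono:
  assumes "X \<in> ob" "Y \<in> ob" "Z \<in> ob" "r \<in> el (X \<odot> Y)" "r' \<in> el (X \<odot> Y)" "s \<in> el (Y \<odot> Z)"
    "s' \<in> el (Y \<odot> Z)" "r \<sqsubseteq>[X \<odot> Y] r'" "s \<sqsubseteq>[Y \<odot> Z] s'"
  shows "rel_comp P X Y Z r s \<sqsubseteq>[X \<odot> Z] rel_comp P X Y Z r' s'"
proof (rule rel_leqI)
  fix V \<phi> x z
  assume xz: "x \<in> mor V X" "z \<in> mor V Z" and "forces V \<phi> X Z (rel_comp P X Y Z r s) x z"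
  from this(3) obtain W \<psi> p y where c: "covers W \<psi> p V \<phi>"
    and "forces W \<psi> X Y r (cmp (base P) W V X p x) y"
    and "forces W \<psi> Y Z s y (cmp (base P) W V Z p z)"
    by (rule forces_compE) (use assms in auto)
  then have "forces W \<psi> X Z (rel_comp P X Y Z r' s') (cmp (base P) W V X p x) (cmp (base P) W V Z p z)"
    using assms by (blast intro: forces_compI forces_mono)
  then show "forces V \<phi> X Z (rel_comp P X Y Z r' s') x z"
    by (rule forces_local[OF c xz])
qed (use assms in auto)

lemma rel_tensor_mono:
  assumes "X \<in> ob" "Y \<in> ob" "X' \<in> ob" "Y' \<in> ob" "r \<in> el (X \<odot> Y)" "r' \<in> el (X \<odot> Y)" "s \<in> el (X' \<odot> Y')"
    "s' \<in> el (X' \<odot> Y')" "r \<sqsubseteq>[X \<odot> Y] r'" "s \<sqsubseteq>[X' \<odot> Y'] s'"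
  shows "rel_tensor P X Y X' Y' r s \<sqsubseteq>[(X \<odot> X') \<odot> (Y \<odot> Y')] rel_tensor P X Y X' Y' r' s'"
  by (rule rel_leqI) (use assms in \<open>auto elim!: pairE intro: forces_mono\<close>)

end

section \<open>The cartesian bicategory of relations\<close>

context poset_symmetric_monoidal_category
begin

lemma hle_antisym:
  assumes "X \<in> Obj \<B>" "Y \<in> Obj \<B>" "f \<in> hom \<B> X Y" "g \<in> hom \<B> X Y" "hle \<B> X Y f g" "hle \<B> X Y g f"
  shows "f = g"
  using partial_order.le_antisym[OF hom_partial_order[OF assms(1,2)], of f g] assms(3-6)
  by (simp add: hom_poset_def)

lemma hle_refl:
  assumes "X \<in> Obj \<B>" "Y \<in> Obj \<B>" "f \<in> hom \<B> X Y"
  shows "hle \<B> X Y f f"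
  using weak_partial_order.le_refl[OF partial_order.axioms(1)[OF hom_partial_order[OF assms(1,2)]], of f]
    assms(3) by (simp add: hom_poset_def)

text \<open>The standard zigzag \<open>g \<le> g ; f ; g' \<le> g'\<close>, from the unit of
  \<open>g'\<close> and the counit of \<open>g\<close>.\<close>

lemma is_radj_le:
  assumes XY: "X \<in> Obj \<B>" "Y \<in> Obj \<B>" and f: "f \<in> hom \<B> X Y"
    and g: "is_radj \<B> X Y f g" and g': "is_radj \<B> X Y f g'"
  shows "hle \<B> Y X g g'"
proof -
  note [simp] = XY f
  have [simp]: "g \<in> hom \<B> Y X" "g' \<in> hom \<B> Y X"
    using g g' by (simp_all add: is_radj_def)
  let ?m = "cmp \<B> Y X X g (cmp \<B> X Y X f g')"
  have m: "?m = cmp \<B> Y Y X (cmp \<B> Y X Y g f) g'"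
    by (rule cmp_left_assoc) auto
  have "hle \<B> Y X (cmp \<B> Y X X g (ide \<B> X)) ?m"
    using g' by (intro cmp_mono) (auto simp: is_radj_def hle_refl)
  then have 1: "hle \<B> Y X g ?m"
    by simp
  have "hle \<B> Y X ?m (cmp \<B> Y Y X (ide \<B> Y) g')"
    unfolding m using g by (intro cmp_mono) (auto simp: is_radj_def hle_refl)
  then have "hle \<B> Y X ?m g'"
    by simp
  with 1 show ?thesis
    using weak_partial_order.le_trans[OF partial_order.axioms(1)[OF hom_partial_order[of Y X]], of g ?m g']
    by (simp add: hom_poset_def)
qed

lemma radj_eqI:
  assumes "X \<in> Obj \<B>" "Y \<in> Obj \<B>" "f \<in> hom \<B> X Y" "is_radj \<B> X Y f g"
  shows "radj \<B> X Y f = g"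
  unfolding radj_def using assms
  by (intro the_equality hle_antisym is_radj_le) (auto simp: is_radj_def intro: is_radj_le)

end

context elementary_existential_doctrine
begin

lemma AP_simps [simp]:
  "Obj (AP P) = ob"
  "hom (AP P) X Y = el (X \<odot> Y)"
  "ide (AP P) = dlt P"
  "cmp (AP P) = rel_comp P"
  "hle (AP P) X Y = le (fib P (X \<odot> Y))"
  "tobj (AP P) X Y = X \<odot> Y"
  "unt (AP P) = trm (base P)"
  "tmor (AP P) = rel_tensor P"
  "assoc (AP P) X Y Z = graph P ((X \<odot> Y) \<odot> Z) (X \<odot> Y \<odot> Z) (cassoc (base P) X Y Z)"
  "lun (AP P) X = graph P (trm (base P) \<odot> X) X (pr2 (base P) (trm (base P)) X)"
  "run (AP P) X = graph P (X \<odot> trm (base P)) X (pr1 (base P) X (trm (base P)))"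
  "braid (AP P) X Y = graph P (X \<odot> Y) (Y \<odot> X) (cbraid (base P) X Y)"
  "dup (AP P) X = graph P X (X \<odot> X) (diag (base P) X)"
  "del (AP P) X = graph P X (trm (base P)) (bang (base P) X)"
  by (simp_all add: AP_def Let_def)

lemma graph_eqI:
  assumes "X \<in> ob" "Y \<in> ob" "f \<in> mor X Y" "g \<in> mor X Y"
    and "\<And>Z x. Z \<in> ob \<Longrightarrow> x \<in> mor Z X \<Longrightarrow> cmp (base P) Z X Y x f = cmp (base P) Z X Y x g"
  shows "graph P X Y f = graph P X Y g"
  using mor_eqI[OF assms] by simp

lemma rel_tensor_graph_dlt [simp]:
  assumes "X \<in> ob" "Y \<in> ob" "X' \<in> ob" "f \<in> mor X Y"
  shows "rel_tensor P X Y X' X' (graph P X Y f) (dlt P X')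
    = graph P (X \<odot> X') (Y \<odot> X') (prdmor (base P) X Y X' X' f (ide (base P) X'))"
  and "rel_tensor P X' X' X Y (dlt P X') (graph P X Y f)
    = graph P (X' \<odot> X) (X' \<odot> Y) (prdmor (base P) X' X' X Y (ide (base P) X') f)"
  using assms rel_tensor_graph[of X Y X' X' f "ide (base P) X'"]
    rel_tensor_graph[of X' X' X Y "ide (base P) X'" f] by auto

lemma category_AP: "category (AP P)"
  by unfold_locales (auto simp: rel_comp_assoc)

lemma inverse_mors_graph:
  assumes "X \<in> ob" "Y \<in> ob" "inverse_mors (base P) X Y f g"
  shows "inverse_mors (AP P) X Y (graph P X Y f) (graph P Y X g)"
  using assms by (auto simp: inverse_mors_def)

text \<open>\<open>middle4\<close> mentions the inverse associators through a definite description;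
  this makes them graphs like the other structural maps.\<close>

lemma inv_mor_graph_cassoc:
  assumes "X \<in> ob" "Y \<in> ob" "Z \<in> ob"
  shows "inv_mor (AP P) ((X \<odot> Y) \<odot> Z) (X \<odot> Y \<odot> Z)
      (graph P ((X \<odot> Y) \<odot> Z) (X \<odot> Y \<odot> Z) (cassoc (base P) X Y Z))
    = graph P (X \<odot> Y \<odot> Z) ((X \<odot> Y) \<odot> Z) (cassoc_inv X Y Z)"
  using assms
  by (intro category.inv_mor_eqI[OF category_AP] inverse_mors_graph cassoc_inverse) auto

text \<open>A graph composed on the right leaves a genuine quantifier in general. For an isomorphism
  it is the converse graph of the inverse, so the one-point rule applies; the naturality squares
  rest on this.\<close>

lemma forces_graph_iso_right:
  assumes "X \<in> ob" "Y \<in> ob" "Z \<in> ob" "V \<in> ob" "inverse_mors (base P) Y Z h k" "r \<in> el (X \<odot> Y)"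
    "x \<in> mor V X" "z \<in> mor V Z"
  shows "forces V \<phi> X Z (rel_comp P X Y Z r (graph P Y Z h)) x z
    \<longleftrightarrow> forces V \<phi> X Y r x (cmp (base P) V Z Y z k)"
  using assms graph_eq_cograph[OF assms(2,3,5)] by (simp add: inverse_mors_def)

lemma poset_symmetric_monoidal_category_AP: "poset_symmetric_monoidal_category (AP P)"
proof (intro poset_symmetric_monoidal_category.intro category_AP
      poset_symmetric_monoidal_category_axioms.intro, unfold AP_simps)
    fix X Y assume [simp]: "X \<in> ob" "Y \<in> ob"
    show "partial_order (hom_poset (AP P) X Y)"
      unfolding hom_poset_def
      by unfold_locales (auto intro: leq_antisym elim: leq_trans)
  next
    fix X Y Z assume [simp]: "X \<in> ob" "Y \<in> ob" "Z \<in> ob"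
    show "iso_mor (AP P) ((X \<odot> Y) \<odot> Z) (X \<odot> Y \<odot> Z)
        (graph P ((X \<odot> Y) \<odot> Z) (X \<odot> Y \<odot> Z) (cassoc (base P) X Y Z))"
      unfolding iso_mor_def
      by (rule exI, rule inverse_mors_graph[OF _ _ cassoc_inverse]) auto
  next
    fix X assume [simp]: "X \<in> ob"
    show "iso_mor (AP P) (trm (base P) \<odot> X) X
        (graph P (trm (base P) \<odot> X) X (pr2 (base P) (trm (base P)) X))"
      unfolding iso_mor_def
      by (rule exI, rule inverse_mors_graph[OF _ _ pr2_inverse]) auto
    show "iso_mor (AP P) (X \<odot> trm (base P)) X
        (graph P (X \<odot> trm (base P)) X (pr1 (base P) X (trm (base P))))"
      unfolding iso_mor_def
      by (rule exI, rule inverse_mors_graph[OF _ _ pr1_inverse]) auto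
  next
    fix X Y Z X' Y' Z' f g h
    assume [simp]: "X \<in> ob" "Y \<in> ob" "Z \<in> ob" "X' \<in> ob" "Y' \<in> ob" "Z' \<in> ob"
      "f \<in> el (X \<odot> X')" "g \<in> el (Y \<odot> Y')" "h \<in> el (Z \<odot> Z')"
    note [simp] = forces_graph_iso_right[OF _ _ _ _ cassoc_inverse]
    show "rel_comp P ((X \<odot> Y) \<odot> Z) ((X' \<odot> Y') \<odot> Z') (X' \<odot> Y' \<odot> Z')
        (rel_tensor P (X \<odot> Y) (X' \<odot> Y') Z Z' (rel_tensor P X X' Y Y' f g) h)
        (graph P ((X' \<odot> Y') \<odot> Z') (X' \<odot> Y' \<odot> Z') (cassoc (base P) X' Y' Z'))
      = rel_comp P ((X \<odot> Y) \<odot> Z) (X \<odot> Y \<odot> Z) (X' \<odot> Y' \<odot> Z')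
        (graph P ((X \<odot> Y) \<odot> Z) (X \<odot> Y \<odot> Z) (cassoc (base P) X Y Z))
        (rel_tensor P X X' (Y \<odot> Z) (Y' \<odot> Z') f (rel_tensor P Y Y' Z Z' g h))"
      by (rule rel_eqI[of "(X \<odot> Y) \<odot> Z" "X' \<odot> Y' \<odot> Z'"]) (auto elim!: pairE)
  next
    fix X Y f assume [simp]: "X \<in> ob" "Y \<in> ob" "f \<in> el (X \<odot> Y)"
    \<comment> \<open>Elements of the terminal object coincide, so the identity on the unit is
      forced by reflexivity.\<close>
    note [simp] = forces_graph_iso_right[OF _ _ _ _ pr1_inverse]
      forces_graph_iso_right[OF _ _ _ _ pr2_inverse] eqv_refl
    show "rel_comp P (trm (base P) \<odot> X) (trm (base P) \<odot> Y) Y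
        (rel_tensor P (trm (base P)) (trm (base P)) X Y (dlt P (trm (base P))) f)
        (graph P (trm (base P) \<odot> Y) Y (pr2 (base P) (trm (base P)) Y))
      = rel_comp P (trm (base P) \<odot> X) X Y
        (graph P (trm (base P) \<odot> X) X (pr2 (base P) (trm (base P)) X)) f"
      by (rule rel_eqI[of "trm (base P) \<odot> X" Y]) (auto elim!: pairE trmE)
    show "rel_comp P (X \<odot> trm (base P)) (Y \<odot> trm (base P)) Y
        (rel_tensor P X Y (trm (base P)) (trm (base P)) f (dlt P (trm (base P))))
        (graph P (Y \<odot> trm (base P)) Y (pr1 (base P) Y (trm (base P))))
      = rel_comp P (X \<odot> trm (base P)) X Y
        (graph P (X \<odot> trm (base P)) X (pr1 (base P) X (trm (base P)))) f"
      by (rule rel_eqI[of "X \<odot> trm (base P)" Y]) (auto elim!: pairE trmE)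
  next
    fix X Y X' Y' f g
    assume [simp]: "X \<in> ob" "Y \<in> ob" "X' \<in> ob" "Y' \<in> ob" "f \<in> el (X \<odot> X')" "g \<in> el (Y \<odot> Y')"
    note [simp] = forces_graph_iso_right[OF _ _ _ _ cbraid_inverse]
    show "rel_comp P (X \<odot> Y) (X' \<odot> Y') (Y' \<odot> X') (rel_tensor P X X' Y Y' f g)
        (graph P (X' \<odot> Y') (Y' \<odot> X') (cbraid (base P) X' Y'))
      = rel_comp P (X \<odot> Y) (Y \<odot> X) (Y' \<odot> X')
        (graph P (X \<odot> Y) (Y \<odot> X) (cbraid (base P) X Y)) (rel_tensor P Y Y' X X' g f)"
      by (rule rel_eqI[of "X \<odot> Y" "Y' \<odot> X'"]) (auto elim!: pairE)
  next
    fix X Y assume [simp]: "X \<in> ob" "Y \<in> ob"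
    show "rel_tensor P X X Y Y (dlt P X) (dlt P Y) = dlt P (X \<odot> Y)"
      by (rule rel_eqI[of "X \<odot> Y" "X \<odot> Y"]) (auto elim!: pairE)
    show "rel_comp P (X \<odot> Y) (Y \<odot> X) (X \<odot> Y) (graph P (X \<odot> Y) (Y \<odot> X) (cbraid (base P) X Y))
        (graph P (Y \<odot> X) (X \<odot> Y) (cbraid (base P) Y X)) = dlt P (X \<odot> Y)"
      using cbraid_inverse[of X Y] by (simp add: inverse_mors_def)
\<comment> \<open>In the coherence axioms every morphism is a graph or an identity. Both sides
  collapse to single graphs, and the base morphisms are compared on tuples.\<close>
qed (auto simp: rel_comp_mono rel_tensor_mono rel_tensor_comp intro!: graph_eqI elim!: pairE trmE)

text \<open>The unit says that \<open>h\<close> sends equals to equals. The counit says that two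
  elements equal to the image of one \<open>x\<close> are equal, by transitivity over the cover
  carrying \<open>x\<close>.\<close>

lemma is_radj_cograph:
  assumes [simp]: "X \<in> ob" "Y \<in> ob" "h \<in> mor X Y"
  shows "is_radj (AP P) X Y (graph P X Y h) (cograph X Y h)"
  unfolding is_radj_def AP_simps
proof (intro conjI)
  show "dlt P X \<sqsubseteq>[X \<odot> X] rel_comp P X Y X (graph P X Y h) (cograph X Y h)"
    by (rule rel_leqI) (auto intro: eqv_cmp)
  show "rel_comp P Y X Y (cograph X Y h) (graph P X Y h) \<sqsubseteq>[Y \<odot> Y] dlt P Y"
  proof (rule rel_leqI)
    fix V \<phi> y z
    assume [simp]: "y \<in> mor V Y" "z \<in> mor V Y"
      and f: "forces V \<phi> Y Y (rel_comp P Y X Y (cograph X Y h) (graph P X Y h)) y z"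
    have [simp]: "V \<in> ob" using forcesD[OF f] by simp
    from f obtain W \<psi> p x where c: "covers W \<psi> p V \<phi>"
      and [simp]: "W \<in> ob" "p \<in> mor W V" "x \<in> mor W X"
      and "forces W \<psi> Y X (cograph X Y h) (cmp (base P) W V Y p y) x"
      and "forces W \<psi> X Y (graph P X Y h) x (cmp (base P) W V Y p z)"
      by (rule forces_compE) auto
    then have "eqv W \<psi> Y (cmp (base P) W V Y p y) (cmp (base P) W V Y p z)"
      by (auto intro: eqv_trans)
    then show "eqv V \<phi> Y y z"
      by (intro forces_local[OF c]) auto
  qed auto
qed auto

lemma radj_graph:
  assumes "X \<in> ob" "Y \<in> ob" "h \<in> mor X Y"
  shows "radj (AP P) X Y (graph P X Y h) = cograph X Y h"
  using assms is_radj_cograph[OF assms]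
  by (intro poset_symmetric_monoidal_category.radj_eqI[OF poset_symmetric_monoidal_category_AP]) auto

text \<open>At the pairs of \<open>a\<close>, \<open>b\<close> and of \<open>c\<close>,
  \<open>d\<close>, the left side reduces by one-point rules to \<open>a = c\<close>,
  \<open>a = d\<close> and \<open>b = d\<close>. The right side keeps a quantifier, claiming a
  common value of all four elements, for which \<open>a\<close> serves as witness.\<close>

lemma frobenius_AP:
  assumes [simp]: "X \<in> ob"
  shows "rel_comp P (X \<odot> X) ((X \<odot> X) \<odot> X) (X \<odot> X)
      (rel_tensor P X (X \<odot> X) X X (graph P X (X \<odot> X) (diag (base P) X)) (dlt P X))
      (rel_comp P ((X \<odot> X) \<odot> X) (X \<odot> X \<odot> X) (X \<odot> X)
        (graph P ((X \<odot> X) \<odot> X) (X \<odot> X \<odot> X) (cassoc (base P) X X X))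
        (rel_tensor P X X (X \<odot> X) X (dlt P X) (cograph X (X \<odot> X) (diag (base P) X))))
    = rel_comp P (X \<odot> X) X (X \<odot> X) (cograph X (X \<odot> X) (diag (base P) X))
        (graph P X (X \<odot> X) (diag (base P) X))" (is "?l = ?r")
proof (rule rel_eqI[of "X \<odot> X" "X \<odot> X"])
  fix V \<phi> u v assume [simp]: "V \<in> ob" and \<phi>: "\<phi> \<in> el V" and uv: "u \<in> mor V (X \<odot> X)" "v \<in> mor V (X \<odot> X)"
  from uv obtain a b c d where [simp]: "a \<in> mor V X" "b \<in> mor V X" "c \<in> mor V X" "d \<in> mor V X"
    "u = pair (base P) V X X a b" "v = pair (base P) V X X c d"
    by (metis assms \<open>V \<in> ob\<close> pairE)
  have l: "forces V \<phi> (X \<odot> X) (X \<odot> X) ?l u v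
      \<longleftrightarrow> eqv V \<phi> X a c \<and> eqv V \<phi> X a d \<and> eqv V \<phi> X b d"
    by simp
  show "forces V \<phi> (X \<odot> X) (X \<odot> X) ?l u v \<longleftrightarrow> forces V \<phi> (X \<odot> X) (X \<odot> X) ?r u v"
  proof
    assume "forces V \<phi> (X \<odot> X) (X \<odot> X) ?l u v"
    then have eq: "eqv V \<phi> X a c" "eqv V \<phi> X a d" "eqv V \<phi> X b d"
      unfolding l by auto
    have "eqv V \<phi> X b a" "eqv V \<phi> X a a"
      using eqv_trans[OF eq(3) eqv_sym[OF eq(2)]] eqv_trans[OF eq(2) eqv_sym[OF eq(2)]] by auto
    with eq show "forces V \<phi> (X \<odot> X) (X \<odot> X) ?r u v"
      by (intro forces_compI[where y = a]) auto
  next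
    assume "forces V \<phi> (X \<odot> X) (X \<odot> X) ?r u v"
    then obtain W \<psi> p x where cv: "covers W \<psi> p V \<phi>"
      and [simp]: "W \<in> ob" "p \<in> mor W V" "x \<in> mor W X"
      and "forces W \<psi> (X \<odot> X) X (cograph X (X \<odot> X) (diag (base P) X)) (cmp (base P) W V (X \<odot> X) p u) x"
      and "forces W \<psi> X (X \<odot> X) (graph P X (X \<odot> X) (diag (base P) X)) x (cmp (base P) W V (X \<odot> X) p v)"
      by (rule forces_compE) auto
    then have "eqv W \<psi> X (cmp (base P) W V X p a) x" "eqv W \<psi> X (cmp (base P) W V X p b) x"
      "eqv W \<psi> X x (cmp (base P) W V X p c)" "eqv W \<psi> X x (cmp (base P) W V X p d)"
      by simp_all
    then have "eqv W \<psi> X (cmp (base P) W V X p a) (cmp (base P) W V X p c)"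
      "eqv W \<psi> X (cmp (base P) W V X p a) (cmp (base P) W V X p d)"
      "eqv W \<psi> X (cmp (base P) W V X p b) (cmp (base P) W V X p d)"
      by (auto intro: eqv_trans)
    then show "forces V \<phi> (X \<odot> X) (X \<odot> X) ?l u v"
      unfolding l by (auto intro: forces_local[OF cv])
  qed
qed auto

lemma cartesian_bicategory_AP: "cartesian_bicategory (AP P)"
proof (intro cartesian_bicategory.intro poset_symmetric_monoidal_category_AP
      cartesian_bicategory_axioms.intro, unfold AP_simps)
    fix X assume [simp]: "X \<in> ob"
    show "\<exists>g. is_radj (AP P) X (X \<odot> X) (graph P X (X \<odot> X) (diag (base P) X)) g"
      by (rule exI, rule is_radj_cograph) auto
    show "\<exists>g. is_radj (AP P) X (trm (base P)) (graph P X (trm (base P)) (bang (base P) X)) g"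
      by (rule exI, rule is_radj_cograph) auto
    show "rel_comp P (X \<odot> X) ((X \<odot> X) \<odot> X) (X \<odot> X)
      (rel_tensor P X (X \<odot> X) X X (graph P X (X \<odot> X) (diag (base P) X)) (dlt P X))
      (rel_comp P ((X \<odot> X) \<odot> X) (X \<odot> X \<odot> X) (X \<odot> X)
        (graph P ((X \<odot> X) \<odot> X) (X \<odot> X \<odot> X) (cassoc (base P) X X X))
        (rel_tensor P X X (X \<odot> X) X (dlt P X)
          (radj (AP P) X (X \<odot> X) (graph P X (X \<odot> X) (diag (base P) X)))))
    = rel_comp P (X \<odot> X) X (X \<odot> X)
        (radj (AP P) X (X \<odot> X) (graph P X (X \<odot> X) (diag (base P) X)))
        (graph P X (X \<odot> X) (diag (base P) X))"
      using frobenius_AP[of X] by (simp add: radj_graph del: rel_tensor_graph_dlt rel_comp_graph)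
  next
    fix X Y r assume [simp]: "X \<in> ob" "Y \<in> ob" "r \<in> el (X \<odot> Y)"
    show "rel_comp P X Y (Y \<odot> Y) r (graph P Y (Y \<odot> Y) (diag (base P) Y)) \<sqsubseteq>[X \<odot> Y \<odot> Y]
      rel_comp P X (X \<odot> X) (Y \<odot> Y) (graph P X (X \<odot> X) (diag (base P) X)) (rel_tensor P X Y X Y r r)"
      (is "?l \<sqsubseteq>[_] ?r")
    proof (rule rel_leqI)
      fix V \<phi> x v assume [simp]: "V \<in> ob" "x \<in> mor V X" and v: "v \<in> mor V (Y \<odot> Y)"
        and f: "forces V \<phi> X (Y \<odot> Y) ?l x v"
      from v obtain b c where [simp]: "b \<in> mor V Y" "c \<in> mor V Y" "v = pair (base P) V Y Y b c"
        by (rule pairE) auto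
      from f obtain W \<psi> p y where cv: "covers W \<psi> p V \<phi>"
        and [simp]: "W \<in> ob" "p \<in> mor W V" "y \<in> mor W Y"
        and r: "forces W \<psi> X Y r (cmp (base P) W V X p x) y"
        and "forces W \<psi> Y (Y \<odot> Y) (graph P Y (Y \<odot> Y) (diag (base P) Y)) y (cmp (base P) W V (Y \<odot> Y) p v)"
        by (rule forces_compE) auto
      then have "eqv W \<psi> Y y (cmp (base P) W V Y p b)" "eqv W \<psi> Y y (cmp (base P) W V Y p c)"
        by simp_all
      \<comment> \<open>Both components of \<open>v\<close> equal the witness over the cover, so
        \<open>r\<close> relates \<open>x\<close> to each of them.\<close>
      from r this[THEN forces_subst_right[OF r]]
      show "forces V \<phi> X (Y \<odot> Y) ?r x v"
        by (auto intro: forces_local[OF cv])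
    qed auto
    show "rel_comp P X Y (trm (base P)) r (graph P Y (trm (base P)) (bang (base P) Y))
      \<sqsubseteq>[X \<odot> trm (base P)] graph P X (trm (base P)) (bang (base P) X)"
      \<comment> \<open>The right-hand side holds at every element, as any two maps into the
        terminal object agree.\<close>
      by (rule rel_leqI) (auto elim!: trmE simp: eqv_refl)
  next
    fix X Y assume [simp]: "X \<in> ob" "Y \<in> ob"
    show "graph P (X \<odot> Y) ((X \<odot> Y) \<odot> (X \<odot> Y)) (diag (base P) (X \<odot> Y))
      = rel_comp P (X \<odot> Y) ((X \<odot> X) \<odot> (Y \<odot> Y)) ((X \<odot> Y) \<odot> (X \<odot> Y))
          (rel_tensor P X (X \<odot> X) Y (Y \<odot> Y) (graph P X (X \<odot> X) (diag (base P) X))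
            (graph P Y (Y \<odot> Y) (diag (base P) Y))) (middle4 (AP P) X Y)"
      \<comment> \<open>All factors of \<open>middle4\<close> are now graphs, so the law becomes an
        equation between base morphisms.\<close>
      by (auto simp: middle4_def Let_def inv_mor_graph_cassoc intro!: graph_eqI elim!: pairE)
\<comment> \<open>Identities are turned back into graphs so that the comonoid laws and the law for
  \<open>del\<close> become equations between graphs.\<close>
qed (auto simp flip: graph_ide intro!: graph_eqI elim!: pairE trmE)

end

section \<open>Functoriality\<close>

lemma cat_functor_fctr_id:
  assumes "category C"
  shows "cat_functor C C (fctr_id C)"
proof -
  interpret category C by fact
  show ?thesis
    by unfold_locales (auto simp: fctr_id_def)
qed

lemma cat_functor_fctr_comp:
  assumes "cat_functor C D F" "cat_functor D E G"
  shows "cat_functor C E (fctr_comp C F G)"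
proof -
  interpret F: cat_functor C D F by fact
  interpret G: cat_functor D E G by fact
  show ?thesis
    by unfold_locales
      (auto simp: fctr_comp_def F.fobj_in F.fmor_in F.fmor_ide F.fmor_cmp
        G.fobj_in G.fmor_in G.fmor_ide G.fmor_cmp)
qed

lemma fctr_comp_id_left:
  assumes "cat_functor C D F"
  shows "fctr_comp C (fctr_id C) F = F"
proof -
  interpret cat_functor C D F by fact
  show ?thesis
    by (rule fctr.equality)
      (auto simp: fctr_comp_def fctr_id_def fun_eq_iff fobj_undefined fmor_undefined)
qed

lemma fctr_comp_id_right:
  assumes "cat_functor C D F"
  shows "fctr_comp C F (fctr_id D) = F"
proof -
  interpret cat_functor C D F by fact
  show ?thesis
    by (rule fctr.equality)
      (auto simp: fctr_comp_def fctr_id_def fun_eq_iff fobj_undefined fmor_undefined fobj_in fmor_in)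
qed

lemma fctr_comp_assoc:
  assumes "cat_functor C D F"
  shows "fctr_comp C (fctr_comp C F G) H = fctr_comp C F (fctr_comp D G H)"
proof -
  interpret cat_functor C D F by fact
  show ?thesis
    by (rule fctr.equality) (auto simp: fctr_comp_def fun_eq_iff fobj_in fmor_in)
qed

section \<open>Strict cartesian functors and the derived product structure\<close>

context strict_cartesian_functor
begin

text \<open>Source and target are variables bound by equations, so that the rule still applies after
  the image of a product has been rewritten.\<close>

lemma fmor_in' [simp]:
  "\<lbrakk>fobj F X = A; fobj F Y = B; X \<in> Obj C; Y \<in> Obj C; f \<in> hom C X Y\<rbrakk> \<Longrightarrow> fmor F X Y f \<in> hom D A B"
  using fmor_in by blast

lemmas functor_simps [simp] =
  fobj_in fmor_ide fmor_cmp fobj_prd fmor_pr1 fmor_pr2 fobj_trm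

text \<open>The image of a pairing has the right components because projections are preserved;
  uniqueness of pairings in \<open>D\<close> does the rest.\<close>

lemma fmor_pair [simp]:
  assumes "Z \<in> Obj C" "X \<in> Obj C" "Y \<in> Obj C" "f \<in> hom C Z X" "g \<in> hom C Z Y"
  shows "fmor F Z (X \<boxtimes>\<^bsub>C\<^esub> Y) (pair C Z X Y f g)
    = pair D (fobj F Z) (fobj F X) (fobj F Y) (fmor F Z X f) (fmor F Z Y g)"
proof -
  let ?h = "fmor F Z (X \<boxtimes>\<^bsub>C\<^esub> Y) (pair C Z X Y f g)"
  have "cmp D (fobj F Z) (fobj F X \<boxtimes>\<^bsub>D\<^esub> fobj F Y) (fobj F X) ?h (pr1 D (fobj F X) (fobj F Y))
      = fmor F Z X f"
    using assms fmor_cmp[of Z "X \<boxtimes>\<^bsub>C\<^esub> Y" X "pair C Z X Y f g" "pr1 C X Y"] by simp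
  moreover have "cmp D (fobj F Z) (fobj F X \<boxtimes>\<^bsub>D\<^esub> fobj F Y) (fobj F Y) ?h (pr2 D (fobj F X) (fobj F Y))
      = fmor F Z Y g"
    using assms fmor_cmp[of Z "X \<boxtimes>\<^bsub>C\<^esub> Y" Y "pair C Z X Y f g" "pr2 C X Y"] by simp
  ultimately show ?thesis
    using cod.pair_unique[of "fobj F Z" "fobj F X" "fobj F Y" ?h] assms by simp
qed

lemma fmor_bang [simp]: "X \<in> Obj C \<Longrightarrow> fmor F X (trm C) (bang C X) = bang D (fobj F X)"
  by (rule cod.bang_unique) auto

lemma fmor_diag [simp]: "X \<in> Obj C \<Longrightarrow> fmor F X (X \<boxtimes>\<^bsub>C\<^esub> X) (diag C X) = diag D (fobj F X)"
  by (simp add: diag_def)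

lemma fmor_prdmor [simp]:
  "\<lbrakk>X \<in> Obj C; Y \<in> Obj C; X' \<in> Obj C; Y' \<in> Obj C; f \<in> hom C X Y; g \<in> hom C X' Y'\<rbrakk>
    \<Longrightarrow> fmor F (X \<boxtimes>\<^bsub>C\<^esub> X') (Y \<boxtimes>\<^bsub>C\<^esub> Y') (prdmor C X Y X' Y' f g)
      = prdmor D (fobj F X) (fobj F Y) (fobj F X') (fobj F Y') (fmor F X Y f) (fmor F X' Y' g)"
  by (simp add: prdmor_def)

lemma fmor_tr [simp]:
  assumes "X \<in> Obj C" "Y \<in> Obj C" "Z \<in> Obj C"
  shows "fmor F (X \<boxtimes>\<^bsub>C\<^esub> Y \<boxtimes>\<^bsub>C\<^esub> Z) (X \<boxtimes>\<^bsub>C\<^esub> Y) (tr12 C X Y Z) = tr12 D (fobj F X) (fobj F Y) (fobj F Z)"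
    "fmor F (X \<boxtimes>\<^bsub>C\<^esub> Y \<boxtimes>\<^bsub>C\<^esub> Z) (Y \<boxtimes>\<^bsub>C\<^esub> Z) (tr23 C X Y Z) = tr23 D (fobj F X) (fobj F Y) (fobj F Z)"
  using assms by (simp_all add: tr12_def tr23_def tr1_def tr2_def tr3_def)

lemma fmor_qu [simp]:
  assumes "X1 \<in> Obj C" "X2 \<in> Obj C" "X3 \<in> Obj C" "X4 \<in> Obj C"
  shows "fmor F ((X1 \<boxtimes>\<^bsub>C\<^esub> X2) \<boxtimes>\<^bsub>C\<^esub> (X3 \<boxtimes>\<^bsub>C\<^esub> X4)) (X1 \<boxtimes>\<^bsub>C\<^esub> X3) (qu13 C X1 X2 X3 X4)
      = qu13 D (fobj F X1) (fobj F X2) (fobj F X3) (fobj F X4)"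
    "fmor F ((X1 \<boxtimes>\<^bsub>C\<^esub> X2) \<boxtimes>\<^bsub>C\<^esub> (X3 \<boxtimes>\<^bsub>C\<^esub> X4)) (X2 \<boxtimes>\<^bsub>C\<^esub> X4) (qu24 C X1 X2 X3 X4)
      = qu24 D (fobj F X1) (fobj F X2) (fobj F X3) (fobj F X4)"
  using assms by (simp_all add: qu13_def qu24_def)

lemma fmor_cassoc [simp]:
  "\<lbrakk>X \<in> Obj C; Y \<in> Obj C; Z \<in> Obj C\<rbrakk>
    \<Longrightarrow> fmor F ((X \<boxtimes>\<^bsub>C\<^esub> Y) \<boxtimes>\<^bsub>C\<^esub> Z) (X \<boxtimes>\<^bsub>C\<^esub> (Y \<boxtimes>\<^bsub>C\<^esub> Z)) (cassoc C X Y Z)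
      = cassoc D (fobj F X) (fobj F Y) (fobj F Z)"
  by (simp add: cassoc_def)

lemma fmor_cbraid [simp]:
  "\<lbrakk>X \<in> Obj C; Y \<in> Obj C\<rbrakk>
    \<Longrightarrow> fmor F (X \<boxtimes>\<^bsub>C\<^esub> Y) (Y \<boxtimes>\<^bsub>C\<^esub> X) (cbraid C X Y) = cbraid D (fobj F X) (fobj F Y)"
  by (simp add: cbraid_def)

end

lemma strict_cartesian_functor_fctr_id:
  assumes "cartesian_category C"
  shows "strict_cartesian_functor C C (fctr_id C)"
proof -
  interpret cartesian_category C by fact
  interpret cat_functor C C "fctr_id C"
    by (rule cat_functor_fctr_id) (rule category_axioms)
  show ?thesis
    by unfold_locales (auto simp: fctr_id_def)
qed

lemma strict_cartesian_functor_fctr_comp: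
  assumes "strict_cartesian_functor C D F" "strict_cartesian_functor D E G"
  shows "strict_cartesian_functor C E (fctr_comp C F G)"
proof -
  interpret F: strict_cartesian_functor C D F by fact
  interpret G: strict_cartesian_functor D E G by fact
  interpret cat_functor C E "fctr_comp C F G"
    by (rule cat_functor_fctr_comp) (rule F.cat_functor_axioms G.cat_functor_axioms)+
  show ?thesis
    by unfold_locales (auto simp: fctr_comp_def)
qed

section \<open>Morphisms of doctrines acting on relations\<close>

context eed_morphism
begin

lemma b_in [simp]:
  "\<lbrakk>fobj F A = B; A \<in> Obj (base P); \<alpha> \<in> carrier (fib P A)\<rbrakk> \<Longrightarrow> b A \<alpha> \<in> carrier (fib R B)"
  using b_hom[of A] by (auto simp: inf_sl_hom_def)

lemma b_meet [simp]:
  "\<lbrakk>A \<in> Obj (base P); \<alpha> \<in> carrier (fib P A); \<beta> \<in> carrier (fib P A)\<rbrakk>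
    \<Longrightarrow> b A (\<alpha> \<sqinter>\<^bsub>fib P A\<^esub> \<beta>) = b A \<alpha> \<sqinter>\<^bsub>fib R (fobj F A)\<^esub> b A \<beta>"
  using b_hom[of A] by (auto simp: inf_sl_hom_def)

lemma b_mono:
  assumes A: "A \<in> Obj (base P)" "\<alpha> \<in> carrier (fib P A)" "\<beta> \<in> carrier (fib P A)"
    and le: "le (fib P A) \<alpha> \<beta>"
  shows "le (fib R (fobj F A)) (b A \<alpha>) (b A \<beta>)"
proof -
  have "\<alpha> \<sqinter>\<^bsub>fib P A\<^esub> \<beta> = \<alpha>"
    using A le by (intro dom.leq_antisym[of A]) (auto simp: dom.leq_mt_iff)
  then show ?thesis
    using A b_meet[OF A] cod.mt_right[of "fobj F A" "b A \<alpha>" "b A \<beta>"] by simp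
qed

lemmas b_simps [simp] = b_natural b_dlt

lemma fmor_mid_last [simp]:
  assumes "X \<in> Obj (base P)" "Y \<in> Obj (base P)" "Z \<in> Obj (base P)"
  shows "fmor F ((X \<boxtimes>\<^bsub>base P\<^esub> Z) \<boxtimes>\<^bsub>base P\<^esub> Y) (X \<boxtimes>\<^bsub>base P\<^esub> Y \<boxtimes>\<^bsub>base P\<^esub> Z) (dom.mid_last X Y Z)
    = cod.mid_last (fobj F X) (fobj F Y) (fobj F Z)"
  using assms by (simp add: dom.mid_last_def cod.mid_last_def Let_def)

lemma b_exq_pr1 [simp]:
  assumes "X \<in> Obj (base P)" "Y \<in> Obj (base P)" "\<alpha> \<in> carrier (fib P (X \<boxtimes>\<^bsub>base P\<^esub> Y))"
  shows "b X (exq P (X \<boxtimes>\<^bsub>base P\<^esub> Y) X (pr1 (base P) X Y) \<alpha>)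
    = exq R (fobj F X \<boxtimes>\<^bsub>base R\<^esub> fobj F Y) (fobj F X) (pr1 (base R) (fobj F X) (fobj F Y))
        (b (X \<boxtimes>\<^bsub>base P\<^esub> Y) \<alpha>)"
  using assms b_exq[OF dom.projection_pr1 assms(3)] by simp

text \<open>\<open>b\<close> is only assumed to commute with \<exists> along projections. In both
  doctrines the quantifier along \<open>tr13\<close> is therefore rewritten through
  \<open>mid_last\<close>, which \<open>F\<close> preserves.\<close>

lemma b_rel_comp [simp]:
  assumes "X \<in> Obj (base P)" "Y \<in> Obj (base P)" "Z \<in> Obj (base P)"
    "r \<in> carrier (fib P (X \<boxtimes>\<^bsub>base P\<^esub> Y))" "s \<in> carrier (fib P (Y \<boxtimes>\<^bsub>base P\<^esub> Z))"
  shows "b (X \<boxtimes>\<^bsub>base P\<^esub> Z) (rel_comp P X Y Z r s)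
    = rel_comp R (fobj F X) (fobj F Y) (fobj F Z) (b (X \<boxtimes>\<^bsub>base P\<^esub> Y) r) (b (Y \<boxtimes>\<^bsub>base P\<^esub> Z) s)"
  using assms by (simp add: rel_comp_def Let_def dom.exq_tr13 cod.exq_tr13)

lemma b_rel_tensor [simp]:
  assumes "X \<in> Obj (base P)" "Y \<in> Obj (base P)" "X' \<in> Obj (base P)" "Y' \<in> Obj (base P)"
    "r \<in> carrier (fib P (X \<boxtimes>\<^bsub>base P\<^esub> Y))" "s \<in> carrier (fib P (X' \<boxtimes>\<^bsub>base P\<^esub> Y'))"
  shows "b ((X \<boxtimes>\<^bsub>base P\<^esub> X') \<boxtimes>\<^bsub>base P\<^esub> (Y \<boxtimes>\<^bsub>base P\<^esub> Y')) (rel_tensor P X Y X' Y' r s)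
    = rel_tensor R (fobj F X) (fobj F Y) (fobj F X') (fobj F Y')
        (b (X \<boxtimes>\<^bsub>base P\<^esub> Y) r) (b (X' \<boxtimes>\<^bsub>base P\<^esub> Y') s)"
  using assms by (simp add: rel_tensor_def Let_def)

lemma b_graph [simp]:
  assumes "X \<in> Obj (base P)" "Y \<in> Obj (base P)" "h \<in> hom (base P) X Y"
  shows "b (X \<boxtimes>\<^bsub>base P\<^esub> Y) (graph P X Y h) = graph R (fobj F X) (fobj F Y) (fmor F X Y h)"
  using assms by (simp add: graph_def)

lemma b_cograph [simp]:
  assumes "X \<in> Obj (base P)" "Y \<in> Obj (base P)" "h \<in> hom (base P) X Y"
  shows "b (Y \<boxtimes>\<^bsub>base P\<^esub> X) (dom.cograph X Y h) = cod.cograph (fobj F X) (fobj F Y) (fmor F X Y h)"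
  using assms by (simp add: dom.cograph_def cod.cograph_def)

lemma cbc_morphism_L_mor: "cbc_morphism (AP P) (AP R) (L_mor P (F, b))"
proof -
  interpret AP: cartesian_bicategory "AP P" by (rule dom.cartesian_bicategory_AP)
  interpret AR: cartesian_bicategory "AP R" by (rule cod.cartesian_bicategory_AP)
  show ?thesis
    \<comment> \<open>The starred morphisms become converse graphs on both sides, and these are
      preserved as reindexed equalities.\<close>
    by unfold_locales (auto simp: dom.radj_graph cod.radj_graph dest: b_mono[rotated 3])
qed

end

section \<open>The category of doctrines\<close>

lemma (in cartesian_category) projectionD:
  assumes "projection C B A p"
  shows "A \<in> Obj C" "B \<in> Obj C" "p \<in> hom C B A"
  using assms by (auto simp: projection_def)

lemma (in strict_cartesian_functor) projection_fmor:
  assumes "projection C B A p"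
  shows "projection D (fobj F B) (fobj F A) (fmor F B A p)"
  using assms by (auto simp: projection_def)

text \<open>Keeps quantified elements inside the guards of identity and composite morphisms, for
  first and second projections alike.\<close>

lemma (in elementary_existential_doctrine) exq_projection_in:
  assumes "projection (base P) B A p" "\<alpha> \<in> carrier (fib P B)"
  shows "exq P B A p \<alpha> \<in> carrier (fib P A)"
proof -
  obtain L where L: "left_adjoint P B A p L"
    using existential[OF assms(1)] ..
  then show ?thesis
    using left_adjoint_exq[OF L assms(2)] projectionD[OF assms(1)] assms(2)
    by (auto simp: left_adjoint_iff)
qed

lemma (in eed_morphism) b_top [simp]:
  "A \<in> Obj (base P) \<Longrightarrow> b A (top (fib P A)) = top (fib R (fobj F A))"
  using b_hom[of A] by (auto simp: inf_sl_hom_def)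

lemma eed_morphism_id:
  assumes "elementary_existential_doctrine P"
  shows "eed_morphism P P (fctr_id (base P))
    (\<lambda>A \<alpha>. if A \<in> Obj (base P) \<and> \<alpha> \<in> carrier (fib P A) then \<alpha> else undefined)"
proof -
  interpret elementary_existential_doctrine P by fact
  interpret strict_cartesian_functor "base P" "base P" "fctr_id (base P)"
    by (rule strict_cartesian_functor_fctr_id) (rule cartesian_category_axioms)
  show ?thesis
    by unfold_locales
      (auto simp: fctr_id_def inf_sl_hom_def exq_projection_in dest: projectionD)
qed

lemma eed_morphism_comp:
  assumes "eed_morphism P R F b" "eed_morphism R S G c"
  shows "eed_morphism P S (fctr_comp (base P) F G)
    (\<lambda>A \<alpha>. if A \<in> Obj (base P) \<and> \<alpha> \<in> carrier (fib P A) then c (fobj F A) (b A \<alpha>) else undefined)"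
proof -
  interpret F: eed_morphism P R F b by fact
  interpret G: eed_morphism R S G c by fact
  interpret strict_cartesian_functor "base P" "base S" "fctr_comp (base P) F G"
    by (rule strict_cartesian_functor_fctr_comp)
      (rule F.strict_cartesian_functor_axioms G.strict_cartesian_functor_axioms)+
  have fobj: "fobj (fctr_comp (base P) F G) A = fobj G (fobj F A)" if "A \<in> Obj (base P)" for A
    using that by (simp add: fctr_comp_def)
  have fmor: "fmor (fctr_comp (base P) F G) X Y f = fmor G (fobj F X) (fobj F Y) (fmor F X Y f)"
    if "X \<in> Obj (base P)" "Y \<in> Obj (base P)" "f \<in> hom (base P) X Y" for X Y f
    using that by (simp add: fctr_comp_def)
  show ?thesis
  proof unfold_locales
    fix B A p \<alpha> assume p: "projection (base P) B A p" and \<alpha>: "\<alpha> \<in> carrier (fib P B)"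
    note [simp] = F.dom.projectionD[OF p] F.dom.exq_projection_in[OF p \<alpha>] \<alpha>
    show "(if A \<in> Obj (base P) \<and> exq P B A p \<alpha> \<in> carrier (fib P A)
        then c (fobj F A) (b A (exq P B A p \<alpha>)) else undefined)
      = exq S (fobj (fctr_comp (base P) F G) B) (fobj (fctr_comp (base P) F G) A)
          (fmor (fctr_comp (base P) F G) B A p)
          (if B \<in> Obj (base P) \<and> \<alpha> \<in> carrier (fib P B) then c (fobj F B) (b B \<alpha>) else undefined)"
      by (simp add: fobj fmor F.b_exq[OF p \<alpha>] G.b_exq[OF F.projection_fmor[OF p]])
  qed (auto simp: fobj fmor inf_sl_hom_def)
qed

text \<open>The unit laws are equations between total functions, so they use the convention that
  functors and components are \<open>undefined\<close> off their domains.\<close>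

lemma category_EED: "category EED"
proof -
  have id_left: "eed_comp P (eed_id P) m = m" if "m \<in> {(F, b). eed_morphism P R F b}"
    for P R :: "('o, 'm, 'p) doctrine" and m
  proof -
    obtain F b where m: "m = (F, b)" by (cases m)
    interpret eed_morphism P R F b using that m by simp
    show ?thesis
      by (auto simp: m eed_id_def fctr_comp_id_left[OF cat_functor_axioms] fun_eq_iff b_undefined)
        (auto simp: fctr_id_def)
  qed
  have id_right: "eed_comp P m (eed_id R) = m" if "m \<in> {(F, b). eed_morphism P R F b}"
    for P R :: "('o, 'm, 'p) doctrine" and m
  proof -
    obtain F b where m: "m = (F, b)" by (cases m)
    interpret eed_morphism P R F b using that m by simp
    show ?thesis
      by (auto simp: m eed_id_def fctr_comp_id_right[OF cat_functor_axioms] fun_eq_iff b_undefined)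
  qed
  have comp_assoc: "eed_comp P (eed_comp P l m) n = eed_comp P l (eed_comp R m n)"
    if "l \<in> {(F, b). eed_morphism P R F b}" for P R :: "('o, 'm, 'p) doctrine" and l m n
  proof -
    obtain F b G c H d where m: "l = (F, b)" "m = (G, c)" "n = (H, d)"
      by (cases l; cases m; cases n)
    interpret eed_morphism P R F b using that m by simp
    show ?thesis
      by (auto simp: m fctr_comp_assoc[OF cat_functor_axioms] fun_eq_iff)
        (auto simp: fctr_comp_def)
  qed
  show ?thesis
    by unfold_locales
      (auto simp: EED_def eed_id_def eed_morphism_id id_left[unfolded eed_id_def]
        id_right[unfolded eed_id_def] comp_assoc intro: eed_morphism_comp)
qed

section \<open>The category of cartesian bicategories\<close>

context cartesian_bicategory
begin

text \<open>The type of \<open>dup_star\<close> comes from existence and uniqueness of the adjoint;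
  without it the identity functor could not be evaluated there.\<close>

lemma dup_star_in: "X \<in> Obj \<B> \<Longrightarrow> dup_star \<B> X \<in> hom \<B> (X \<otimes> X) X"
  using dup_has_radj[of X] radj_eqI[of X "X \<otimes> X" "dup \<B> X"] dup_in[of X] tobj_in[of X X]
  by (auto simp: is_radj_def)

lemma del_star_in: "X \<in> Obj \<B> \<Longrightarrow> del_star \<B> X \<in> hom \<B> \<one> X"
  using del_has_radj[of X] radj_eqI[of X \<one> "del \<B> X"] del_in[of X] unt_in
  by (auto simp: is_radj_def)

lemma structure_in:
  "\<lbrakk>X \<in> Obj \<B>; Y \<in> Obj \<B>; Z \<in> Obj \<B>\<rbrakk>
    \<Longrightarrow> assoc \<B> X Y Z \<in> hom \<B> ((X \<otimes> Y) \<otimes> Z) (X \<otimes> (Y \<otimes> Z))"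
  "X \<in> Obj \<B> \<Longrightarrow> lun \<B> X \<in> hom \<B> (\<one> \<otimes> X) X"
  "X \<in> Obj \<B> \<Longrightarrow> run \<B> X \<in> hom \<B> (X \<otimes> \<one>) X"
  using assoc_iso[of X Y Z] lun_iso[of X] run_iso[of X] by (auto simp: iso_mor_def inverse_mors_def)

lemmas cbc_typing =
  tobj_in unt_in tmor_in structure_in braid_in dup_in del_in dup_star_in del_star_in

end

lemma cbc_morphism_id:
  assumes "cartesian_bicategory \<B>"
  shows "cbc_morphism \<B> \<B> (fctr_id \<B>)"
proof -
  interpret cartesian_bicategory \<B> by fact
  interpret cat_functor \<B> \<B> "fctr_id \<B>"
    by (rule cat_functor_fctr_id) (rule category_axioms)
  show ?thesis
    by unfold_locales (simp_all add: fctr_id_def cbc_typing)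
qed

lemma cbc_morphism_comp:
  assumes "cbc_morphism \<B> \<D> F" "cbc_morphism \<D> \<E> G"
  shows "cbc_morphism \<B> \<E> (fctr_comp \<B> F G)"
proof -
  interpret F: cbc_morphism \<B> \<D> F by fact
  interpret G: cbc_morphism \<D> \<E> G by fact
  interpret cat_functor \<B> \<E> "fctr_comp \<B> F G"
    by (rule cat_functor_fctr_comp) (rule F.cat_functor_axioms G.cat_functor_axioms)+
  note [simp] = F.fmor_mono F.fobj_tobj F.fobj_unt F.fmor_tmor F.fmor_assoc F.fmor_lun F.fmor_run
    F.fmor_braid F.fmor_dup F.fmor_del F.fmor_dup_star F.fmor_del_star F.fobj_in F.fmor_in
    G.fmor_mono G.fobj_tobj G.fobj_unt G.fmor_tmor G.fmor_assoc G.fmor_lun G.fmor_run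
    G.fmor_braid G.fmor_dup G.fmor_del G.fmor_dup_star G.fmor_del_star F.dom.cbc_typing
  show ?thesis
    by unfold_locales (simp_all add: fctr_comp_def)
qed

lemma category_CBC: "category CBC"
proof -
  have is_functor: "cat_functor \<B> \<D> F" if "cbc_morphism \<B> \<D> F"
    for \<B> \<D> :: "('o, 'm) bicat" and F
    using that by (simp add: cbc_morphism_def)
  show ?thesis
    by unfold_locales
      (auto simp: CBC_def intro: cbc_morphism_id cbc_morphism_comp fctr_comp_id_left fctr_comp_id_right
        fctr_comp_assoc is_functor)
qed

section \<open>The functor from doctrines to cartesian bicategories\<close>

lemma L_mor_id:
  assumes "elementary_existential_doctrine P"
  shows "L_mor P (eed_id P) = fctr_id (AP P)"
proof -
  interpret elementary_existential_doctrine P by fact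
  show ?thesis
    by (rule fctr.equality) (auto simp: eed_id_def fctr_id_def fun_eq_iff)
qed

text \<open>\<open>F\<close> preserves products and \<open>b\<close> maps fibres to fibres, so the
  guard of the second functor holds wherever that of the first does.\<close>

lemma L_mor_comp:
  assumes "eed_morphism P R F b"
  shows "L_mor P (eed_comp P (F, b) (G, c)) = fctr_comp (AP P) (L_mor P (F, b)) (L_mor R (G, c))"
proof -
  interpret eed_morphism P R F b by fact
  show ?thesis
    by (rule fctr.equality) (auto simp: fctr_comp_def fun_eq_iff)
qed

lemma cat_functor_L:
  "cat_functor (EED :: (('o, 'm, 'p) doctrine, ('o, 'm, 'p, 'o, 'm, 'p) eed_mor) cat) CBC L_functor"
proof -
  interpret EED: category "EED :: (('o, 'm, 'p) doctrine, ('o, 'm, 'p, 'o, 'm, 'p) eed_mor) cat"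
    by (rule category_EED)
  have L_mor_in: "cbc_morphism (AP P) (AP R) (L_mor P m)" if "m \<in> hom EED P R"
    for P R :: "('o, 'm, 'p) doctrine" and m
    using that by (cases m) (auto simp: EED_def simp del: L_mor.simps intro: eed_morphism.cbc_morphism_L_mor)
  have L_comp: "L_mor P (cmp EED P R S m n) = fctr_comp (AP P) (L_mor P m) (L_mor R n)"
    if "m \<in> hom EED P R" for P R S :: "('o, 'm, 'p) doctrine" and m n
    using that by (cases m; cases n) (auto simp: EED_def L_mor_comp simp del: L_mor.simps eed_comp.simps)
  have L_id: "L_mor P (ide EED P) = fctr_id (AP P)" if "P \<in> Obj EED" for P :: "('o, 'm, 'p) doctrine"
    using that by (simp add: EED_def L_mor_id)
  have L_obj: "cartesian_bicategory (AP P)" if "P \<in> Obj EED" for P :: "('o, 'm, 'p) doctrine"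
    using that by (simp add: EED_def elementary_existential_doctrine.cartesian_bicategory_AP)
  show ?thesis
    by (intro cat_functor.intro cat_functor_axioms.intro category_EED category_CBC)
      (auto simp: CBC_def L_functor_def L_obj L_mor_in L_id L_comp EED.cmp_in_hom EED.ide_in_hom
        simp del: L_mor.simps)
qed

text \<open>A category in HOL has all its objects over one choice of types, so
  \<open>L_functor\<close> relates doctrines over the same three types. The last two clauses give
  the action on morphisms and its compatibility with composition across different types.\<close>

theorem theorem6p3:
  fixes P :: "('o1, 'm1, 'p1) doctrine"
    and R :: "('o2, 'm2, 'p2) doctrine"
    and S :: "('o3, 'm3, 'p3) doctrine"
  shows "(elementary_existential_doctrine P \<longrightarrow> cartesian_bicategory (AP P))
    \<and> cat_functor
        (EED :: (('o, 'm, 'p) doctrine, ('o, 'm, 'p, 'o, 'm, 'p) eed_mor) cat)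
        CBC L_functor
    \<and> (\<forall>F b. eed_morphism P R F b \<longrightarrow> cbc_morphism (AP P) (AP R) (L_mor P (F, b)))
    \<and> (\<forall>F b G c. eed_morphism P R F b \<and> eed_morphism R S G c \<longrightarrow>
         L_mor P (eed_comp P (F, b) (G, c))
           = fctr_comp (AP P) (L_mor P (F, b)) (L_mor R (G, c)))"
  using elementary_existential_doctrine.cartesian_bicategory_AP cat_functor_L
    eed_morphism.cbc_morphism_L_mor L_mor_comp
  by blast

end
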